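(* Let $K$ be a number field of narrow class number one, and let $D$ be a fundamental element of $\mathcal{O}_K$ such that $L=K(\sqrt{D})$ is a quadratic extension of $K$. Fix a square root $\sqrt{D}\in L$ and set $\mathcal{D}=\{u^2D : u\in\mathcal{O}_K^{\times,+}\}$. Then the maps $$\Psi:\ \mathcal{Q}_{\mathcal{D}}\to \mathrm{Cl}^{\mathrm{or}}(L/K),\qquad ax^2+bxy+cy^2\longmapsto \left(\left[a,\tfrac{-b+\sqrt{\mathrm{Disc}(Q)}}{2}\right];\ \underline{\mathrm{sgn}}(a)\right),$$ $$\Phi:\ \mathrm{Cl}^{\mathrm{or}}(L/K)\to \mathcal{Q}_{\mathcal{D}},\qquad \left([\alpha,\beta];\ \underline{\mathrm{sgn}}\Big(\tfrac{\bar\alpha\beta-\alpha\bar\beta}{\sqrt D}\Big)\right)\longmapsto \frac{\alpha\bar\alpha x^2-(\bar\alpha\beta+\alpha\bar\beta)xy+\beta\bar\beta y^2}{\frac{\bar\alpha\beta-\alpha\bar\beta}{\sqrt D}}$$ are well defined on classes and are mutually inverse bijections. Here, for $\mathrm{Disc}(Q)=u^2D$ with $u\in\mathcal{O}_K^{\times,+}$, $\sqrt{\mathrm{Disc}(Q)}$ denotes $u\sqrt D$.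
   Context: $K$ is a number field of narrow class number one (equivalently: class number one and there exist units of every sign combination at the real embeddings). $\mathcal{O}_K$ is its ring of integers, $\mathcal{O}_K^\times$ its unit group, $\mathcal{O}_K^{\times,+}$ the totally positive units. $\sigma_1,\dots,\sigma_r$ are the real embeddings of $K$, and for $a\in K^\times$, $\underline{\mathrm{sgn}}(a)=(\mathrm{sgn}\,\sigma_1(a),\dots,\mathrm{sgn}\,\sigma_r(a))$. For $\alpha\in L$, $\bar\alpha$ is its image under the nontrivial automorphism of $L/K$. An element $d\in\mathcal{O}_K$ is fundamental if $d$ is a square modulo $4\mathcal{O}_K$ and either $d$ is square-free, or for every nonunit $p\in\mathcal{O}_K$ with $p^2\mid d$ one has $p\mid 2$ and $d/p^2$ is not a square modulo $4\mathcal{O}_K$. Every fractional $\mathcal{O}_L$-ideal $I$ is a free $\mathcal{O}_K$-module of rank 2; $[\alpha,\beta]$ denotes $\mathcal{O}_K\alpha+\mathcal{O}_K\beta$. A quadratic form is $Q=ax^2+bxy+cy^2$ with $a,b,c\in\mathcal{O}_K$, $\mathrm{Disc}(Q)=b^2-4ac$, primitive if $\gcd(a,b,c)$ is a unit. Two forms satisfy $\tilde Q\sim Q$ if there are $p,q,r,s\in\mathcal{O}_K$ with $ps-qr\in\mathcal{O}_K^{\times,+}$ and $u\in\mathcal{O}_K^{\times,+}$ with $\tilde Q(x,y)=uQ(px+qy,rx+sy)$. $\mathcal{Q}_{\mathcal{D}}$ is the set of primitive forms with discriminant in $\mathcal{D}$ modulo $\sim$. An oriented ideal is a pair $(I;\varepsilon_1,\dots,\varepsilon_r)$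 with $I$ a fractional $\mathcal{O}_L$-ideal and $\varepsilon_i\in\{\pm1\}$; these form a group under componentwise multiplication, with subgroup of principal oriented ideals $((\gamma);\underline{\mathrm{sgn}}(\gamma\bar\gamma))$, $\gamma\in L^\times$. The relative oriented class group $\mathrm{Cl}^{\mathrm{or}}(L/K)$ is the quotient group.
   Formalization: It is assumed that K has at least one real embedding (r ≥ 1); for r = 0, −1 is vacuously totally positive, so √Disc(Q) = u√D is defined only up to sign and Φ identifies conjugate classes (fails for K = ℚ(i), D = −23). *)

theory Defs
  imports
    "HOL-Computational_Algebra.Polynomial"
    "HOL-Algebra.Algebraic_Closure_Type"
    "HOL-Algebra.Generated_Fields"
    "HOL-Algebra.Embedded_Algebras"
    "HOL-Algebra.Product_Groups"
    "HOL-Algebra.Divisibility"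
begin

text \<open>
  All fields are subfields of one ambient field of characteristic zero, given by the type
  \<^typ>\<open>'a\<close>; an abstract extension \<open>L / K\<close> is covered by taking \<open>L\<close> itself as the ambient type.
\<close>

section \<open>Number fields\<close>

abbreviation ambient :: "'a :: field_char_0 ring" where
  "ambient \<equiv> ring_of_type_algebra"

definition number_field :: "'a :: field_char_0 set \<Rightarrow> bool" where
  "number_field K \<longleftrightarrow> subfield K ambient \<and> ring.finite_dimension ambient \<rat> K"

definition quadratic_extension :: "'a :: field_char_0 set \<Rightarrow> 'a set \<Rightarrow> bool" where
  "quadratic_extension K L \<longleftrightarrow>
     subfield K ambient \<and> subfield L ambient \<and> K \<subseteq> L \<and> ring.dimension ambient 2 K L"

definition conjugation :: "'a :: field_char_0 set \<Rightarrow> 'a set \<Rightarrow> 'a \<Rightarrow> 'a" where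
  "conjugation K L =
     (THE \<tau>. \<tau> \<in> ring_iso (ambient\<lparr>carrier := L\<rparr>) (ambient\<lparr>carrier := L\<rparr>) \<inter> extensional L \<and>
             (\<forall>x\<in>K. \<tau> x = x) \<and> (\<exists>x\<in>L. \<tau> x \<noteq> x))"

definition int_ring :: "'a :: field_char_0 set \<Rightarrow> 'a ring" where
  "int_ring F = ambient\<lparr>carrier := {x \<in> F. algebraic_int x}\<rparr>"

abbreviation ints :: "'a :: field_char_0 set \<Rightarrow> 'a set" where
  "ints F \<equiv> carrier (int_ring F)"


section \<open>Real embeddings and signs\<close>

text \<open>Extensionality makes distinct elements of this set distinct as maps on \<open>K\<close>.\<close>

definition real_embeddings :: "'a :: field_char_0 set \<Rightarrow> ('a \<Rightarrow> real) set" where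
  "real_embeddings K =
     ring_hom (ambient\<lparr>carrier := K\<rparr>) (ambient :: real ring) \<inter> extensional K"

definition totally_positive :: "'a :: field_char_0 set \<Rightarrow> 'a \<Rightarrow> bool" where
  "totally_positive K a \<longleftrightarrow> a \<in> K \<and> a \<noteq> 0 \<and> (\<forall>\<sigma>\<in>real_embeddings K. \<sigma> a > 0)"

definition tp_units :: "'a :: field_char_0 set \<Rightarrow> 'a set" where
  "tp_units K = {u \<in> Units (int_ring K). totally_positive K u}"

text \<open>Sign vectors are indexed by the set of real embeddings instead of by \<open>1, \<dots>, r\<close>.\<close>

definition sgn_vec :: "'a :: field_char_0 set \<Rightarrow> 'a \<Rightarrow> (('a \<Rightarrow> real) \<Rightarrow> real)" where
  "sgn_vec K a = (\<lambda>\<sigma>\<in>real_embeddings K. sgn (\<sigma> a))"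

definition sign_group :: "real monoid" where
  "sign_group = \<lparr>carrier = {-1, 1}, monoid.mult = (*), one = 1\<rparr>"


section \<open>Fractional ideals and class groups\<close>

definition frac_ideals :: "'a :: field_char_0 set \<Rightarrow> 'a set set" where
  "frac_ideals F =
     {I. I \<subseteq> F \<and> 0 \<in> I \<and> I \<noteq> {0} \<and>
         (\<forall>x\<in>I. \<forall>y\<in>I. x + y \<in> I) \<and> (\<forall>r\<in>ints F. \<forall>x\<in>I. r * x \<in> I) \<and>
         (\<exists>d\<in>ints F. d \<noteq> 0 \<and> (\<forall>x\<in>I. d * x \<in> ints F))}"

definition ideal_mult :: "'a :: field_char_0 set \<Rightarrow> 'a set \<Rightarrow> 'a set" where
  "ideal_mult I J = {(\<Sum>k<n. x k * y k) | (n :: nat) x y. \<forall>k<n. x k \<in> I \<and> y k \<in> J}"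

definition principal_ideal :: "'a :: field_char_0 set \<Rightarrow> 'a \<Rightarrow> 'a set" where
  "principal_ideal F g = (\<lambda>x. g * x) ` ints F"

definition ideal_group :: "'a :: field_char_0 set \<Rightarrow> 'a set monoid" where
  "ideal_group F = \<lparr>carrier = frac_ideals F, monoid.mult = ideal_mult, one = ints F\<rparr>"

definition narrow_class_group :: "'a :: field_char_0 set \<Rightarrow> 'a set set monoid" where
  "narrow_class_group K =
     ideal_group K Mod {principal_ideal K g | g. totally_positive K g}"

definition narrow_class_number :: "'a :: field_char_0 set \<Rightarrow> nat" where
  "narrow_class_number K = card (carrier (narrow_class_group K))"

type_synonym 'a oriented_ideal = "'a set \<times> (('a \<Rightarrow> real) \<Rightarrow> real)"

definition oriented_ideal_group ::
    "'a :: field_char_0 set \<Rightarrow> 'a set \<Rightarrow> 'a oriented_ideal monoid" where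
  "oriented_ideal_group K L =
     ideal_group L \<times>\<times> product_group (real_embeddings K) (\<lambda>_. sign_group)"

definition principal_oriented ::
    "'a :: field_char_0 set \<Rightarrow> 'a set \<Rightarrow> 'a oriented_ideal set" where
  "principal_oriented K L =
     {(principal_ideal L g, sgn_vec K (g * conjugation K L g)) | g. g \<in> L \<and> g \<noteq> 0}"

definition oriented_class_group ::
    "'a :: field_char_0 set \<Rightarrow> 'a set \<Rightarrow> 'a oriented_ideal set monoid" where
  "oriented_class_group K L = oriented_ideal_group K L Mod principal_oriented K L"

definition oriented_class ::
    "'a :: field_char_0 set \<Rightarrow> 'a set \<Rightarrow> 'a oriented_ideal \<Rightarrow> 'a oriented_ideal set" where
  "oriented_class K L Z = principal_oriented K L #>\<^bsub>oriented_ideal_group K L\<^esub> Z"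


section \<open>Fundamental elements\<close>

definition square_mod_4 :: "'a :: field_char_0 set \<Rightarrow> 'a \<Rightarrow> bool" where
  "square_mod_4 K d \<longleftrightarrow> (\<exists>t\<in>ints K. 4 divides\<^bsub>int_ring K\<^esub> (d - t\<^sup>2))"

definition fundamental :: "'a :: field_char_0 set \<Rightarrow> 'a \<Rightarrow> bool" where
  "fundamental K d \<longleftrightarrow>
     d \<in> ints K \<and> square_mod_4 K d \<and>
     ((\<forall>p\<in>ints K. p\<^sup>2 divides\<^bsub>int_ring K\<^esub> d \<longrightarrow> p \<in> Units (int_ring K)) \<or>
      (\<forall>p\<in>ints K. p \<notin> Units (int_ring K) \<longrightarrow> p\<^sup>2 divides\<^bsub>int_ring K\<^esub> d \<longrightarrow>
          p divides\<^bsub>int_ring K\<^esub> 2 \<and> \<not> square_mod_4 K (d / p\<^sup>2)))"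


section \<open>Quadratic forms\<close>

text \<open>The triple \<open>(a, b, c)\<close> stands for the form \<open>a x\<^sup>2 + b x y + c y\<^sup>2\<close>.\<close>

type_synonym 'a qform = "'a \<times> 'a \<times> 'a"

fun eval_form :: "'a :: field_char_0 qform \<Rightarrow> 'a \<Rightarrow> 'a \<Rightarrow> 'a" where
  "eval_form (a, b, c) x y = a * x\<^sup>2 + b * x * y + c * y\<^sup>2"

fun disc :: "'a :: field_char_0 qform \<Rightarrow> 'a" where
  "disc (a, b, c) = b\<^sup>2 - 4 * a * c"

definition is_gcd :: "'a :: field_char_0 set \<Rightarrow> 'a \<Rightarrow> 'a set \<Rightarrow> bool" where
  "is_gcd K g A \<longleftrightarrow>
     g \<in> ints K \<and> (\<forall>a\<in>A. g divides\<^bsub>int_ring K\<^esub> a) \<and>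
     (\<forall>h\<in>ints K. (\<forall>a\<in>A. h divides\<^bsub>int_ring K\<^esub> a) \<longrightarrow> h divides\<^bsub>int_ring K\<^esub> g)"

definition primitive_form :: "'a :: field_char_0 set \<Rightarrow> 'a qform \<Rightarrow> bool" where
  "primitive_form K Q \<longleftrightarrow>
     (case Q of (a, b, c) \<Rightarrow> a \<in> ints K \<and> b \<in> ints K \<and> c \<in> ints K \<and>
        (\<exists>g. is_gcd K g {a, b, c} \<and> g \<in> Units (int_ring K)))"

text \<open>
  The ambient field is infinite, so the pointwise identity below is the same as the
  identity of polynomials in \<open>x\<close> and \<open>y\<close>.
\<close>

definition form_equiv :: "'a :: field_char_0 set \<Rightarrow> 'a qform \<Rightarrow> 'a qform \<Rightarrow> bool" where
  "form_equiv K Q' Q \<longleftrightarrow>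
     (\<exists>p\<in>ints K. \<exists>q\<in>ints K. \<exists>r\<in>ints K. \<exists>s\<in>ints K. \<exists>u\<in>tp_units K.
        p * s - q * r \<in> tp_units K \<and>
        (\<forall>x y. eval_form Q' x y = u * eval_form Q (p * x + q * y) (r * x + s * y)))"

definition disc_set :: "'a :: field_char_0 set \<Rightarrow> 'a \<Rightarrow> 'a set" where
  "disc_set K D = {u\<^sup>2 * D | u. u \<in> tp_units K}"

definition forms :: "'a :: field_char_0 set \<Rightarrow> 'a \<Rightarrow> 'a qform set" where
  "forms K D = {Q. primitive_form K Q \<and> disc Q \<in> disc_set K D}"

definition form_rel :: "'a :: field_char_0 set \<Rightarrow> 'a \<Rightarrow> ('a qform \<times> 'a qform) set" where
  "form_rel K D = {(Q', Q). Q' \<in> forms K D \<and> Q \<in> forms K D \<and> form_equiv K Q' Q}"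

definition form_class :: "'a :: field_char_0 set \<Rightarrow> 'a \<Rightarrow> 'a qform \<Rightarrow> 'a qform set" where
  "form_class K D Q = form_rel K D `` {Q}"

definition form_classes :: "'a :: field_char_0 set \<Rightarrow> 'a \<Rightarrow> 'a qform set set" where
  "form_classes K D = forms K D // form_rel K D"


section \<open>The two maps\<close>

definition lattice_span :: "'a :: field_char_0 set \<Rightarrow> 'a \<Rightarrow> 'a \<Rightarrow> 'a set" where
  "lattice_span K \<alpha> \<beta> = {x * \<alpha> + y * \<beta> | x y. x \<in> ints K \<and> y \<in> ints K}"

text \<open>
  Throughout, \<open>w\<close> is the fixed square root of \<open>D\<close>. In \<open>form_to_ideal\<close>, the unit \<open>u\<close> is
  a totally positive unit with \<open>disc (a, b, c) = u\<^sup>2 * D\<close>, so that \<open>u * w\<close> is the chosen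
  square root of the discriminant. Such a \<open>u\<close> is unique as soon as \<open>K\<close> has a real embedding;
  otherwise \<open>-1\<close> is vacuously totally positive and \<open>u\<close> is determined only up to sign.
\<close>

fun form_to_ideal :: "'a :: field_char_0 set \<Rightarrow> 'a \<Rightarrow> 'a \<Rightarrow> 'a qform \<Rightarrow> 'a oriented_ideal" where
  "form_to_ideal K w u (a, b, c) = (lattice_span K a ((- b + u * w) / 2), sgn_vec K a)"

definition basis_det :: "'a :: field_char_0 set \<Rightarrow> 'a set \<Rightarrow> 'a \<Rightarrow> 'a \<Rightarrow> 'a \<Rightarrow> 'a" where
  "basis_det K L w \<alpha> \<beta> = (conjugation K L \<alpha> * \<beta> - \<alpha> * conjugation K L \<beta>) / w"

definition oriented_span ::
    "'a :: field_char_0 set \<Rightarrow> 'a set \<Rightarrow> 'a \<Rightarrow> 'a \<Rightarrow> 'a \<Rightarrow> 'a oriented_ideal" where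
  "oriented_span K L w \<alpha> \<beta> = (lattice_span K \<alpha> \<beta>, sgn_vec K (basis_det K L w \<alpha> \<beta>))"

definition basis_to_form ::
    "'a :: field_char_0 set \<Rightarrow> 'a set \<Rightarrow> 'a \<Rightarrow> 'a \<Rightarrow> 'a \<Rightarrow> 'a qform" where
  "basis_to_form K L w \<alpha> \<beta> =
     (\<alpha> * conjugation K L \<alpha> / basis_det K L w \<alpha> \<beta>,
      - (conjugation K L \<alpha> * \<beta> + \<alpha> * conjugation K L \<beta>) / basis_det K L w \<alpha> \<beta>,
      \<beta> * conjugation K L \<beta> / basis_det K L w \<alpha> \<beta>)"

text \<open>
  The maps on classes pick the value common to all representatives; that such a value
  exists is part of what has to be proved about them.
\<close>

definition Psi ::
    "'a :: field_char_0 set \<Rightarrow> 'a set \<Rightarrow> 'a \<Rightarrow> 'a \<Rightarrow> 'a qform set \<Rightarrow> 'a oriented_ideal set" where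
  "Psi K L D w C =
     (THE Z. \<exists>Q\<in>C. \<exists>u\<in>tp_units K.
        disc Q = u\<^sup>2 * D \<and> Z = oriented_class K L (form_to_ideal K w u Q))"

definition Phi ::
    "'a :: field_char_0 set \<Rightarrow> 'a set \<Rightarrow> 'a \<Rightarrow> 'a \<Rightarrow> 'a oriented_ideal set \<Rightarrow> 'a qform set" where
  "Phi K L D w Z =
     (THE C. \<exists>\<alpha>\<in>L. \<exists>\<beta>\<in>L.
        oriented_span K L w \<alpha> \<beta> \<in> Z \<and> C = form_class K D (basis_to_form K L w \<alpha> \<beta>))"

end

theory Submission
  imports Defs "Jordan_Normal_Form.Char_Poly"
begin

text \<open>
  Narrow class number one makes \<open>\<O>\<^sub>K\<close> a principal ideal domain with units of all
  signatures, so every oriented ideal of \<open>L\<close> is \<open>([\<alpha>, \<beta>]; sgn \<delta>)\<close> with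
  \<open>\<delta> = (cj \<alpha> \<beta> - \<alpha> cj \<beta>) / w\<close>. As \<open>D\<close> is fundamental, \<open>\<O>\<^sub>L = [1, om]\<close> with
  \<open>om = (t + w) / 2\<close>, and the matrix of multiplication by \<open>om\<close> on \<open>[\<alpha>, \<beta>]\<close> has the
  coefficients of the form \<open>N(\<alpha> x - \<beta> y) / \<delta>\<close> as entries; its discriminant is \<open>D\<close>, and an
  integral form whose discriminant is fundamental up to unit squares is primitive.
  Classes of oriented ideals are orbits under scaling by \<open>L\<^sup>\<times>\<close>, which leaves this form unchanged,
  and a change of basis compatible with the orientation is exactly an equivalence of forms.
\<close>

section \<open>Algebraic integers\<close>

text \<open>Narrow class number one is spent twice. Trivial ideal classes give bases and Bezout
  relations. Total positivity of the generators turns an element of K with prescribed signs, found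
  by approximation, into a unit with the same signs; such a unit corrects the orientation of a basis
  without moving its lattice. Fundamentality also acts twice through one statement: if D / n^2 is
  integral and a square modulo 4, then n is a unit. Applied to the denominator of a w-coordinate it
  yields the ring of integers; applied to a common divisor of coefficients it yields primitivity.
  Parity is delicate because 2 need not be prime in K, so halves are shown integral by monic
  quadratic equations. The minus sign in N(\<alpha> x - \<beta> y) conjugates every base change by
  diag(1, -1), whence the entries -q and -r in the equivalences. A real embedding singles out u
  among the square roots of u^2; without one the sign of sqrt(Disc) would be ambiguous.\<close>

definition int_span :: "'a :: field_char_0 set \<Rightarrow> 'a set" where
  "int_span G = {\<Sum>g\<in>G. of_int (c g) * g | c. True}"

text \<open>The multiplier ring of the additive group spanned by \<open>G\<close>. If 1 lies in a
  finite \<open>G\<close>, it consists of algebraic integers, so two algebraic integers have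
  integral sum and product as soon as they lie in one such ring.\<close>

definition multipliers :: "'a :: field_char_0 set \<Rightarrow> 'a set" where
  "multipliers G = {s. \<forall>g\<in>G. s * g \<in> int_span G}"

lemma int_spanI: "x = (\<Sum>g\<in>G. of_int (c g) * g) \<Longrightarrow> x \<in> int_span G"
  unfolding int_span_def by (rule CollectI, rule exI[of _ c]) simp

lemma int_span_0: "0 \<in> int_span G"
  by (rule int_spanI[where c = "\<lambda>_. 0"]) simp

lemma int_span_add: "x \<in> int_span G \<Longrightarrow> y \<in> int_span G \<Longrightarrow> x + y \<in> int_span G"
proof -
  assume "x \<in> int_span G" "y \<in> int_span G"
  then obtain c d where "x = (\<Sum>g\<in>G. of_int (c g) * g)" "y = (\<Sum>g\<in>G. of_int (d g) * g)"
    unfolding int_span_def by auto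
  then have "x + y = (\<Sum>g\<in>G. of_int (c g + d g) * g)"
    by (simp add: sum.distrib algebra_simps)
  then show ?thesis by (rule int_spanI)
qed

lemma int_span_of_int_mult: "x \<in> int_span G \<Longrightarrow> of_int k * x \<in> int_span G"
proof -
  assume "x \<in> int_span G"
  then obtain c where "x = (\<Sum>g\<in>G. of_int (c g) * g)"
    unfolding int_span_def by auto
  then have "of_int k * x = (\<Sum>g\<in>G. of_int (k * c g) * g)"
    by (simp add: sum_distrib_left algebra_simps)
  then show ?thesis by (rule int_spanI)
qed

lemma int_span_sum: "(\<And>i. i \<in> A \<Longrightarrow> f i \<in> int_span G) \<Longrightarrow> (\<Sum>i\<in>A. f i) \<in> int_span G"
  by (induction A rule: infinite_finite_induct) (auto simp: int_span_0 int_span_add)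

lemma int_span_base:
  assumes "finite G" "g \<in> G"
  shows "g \<in> int_span G"
proof -
  have "(\<Sum>h\<in>G. of_int (if h = g then 1 else 0) * h) = (\<Sum>h\<in>G. if h = g then h else 0)"
    by (rule sum.cong) auto
  also have "\<dots> = g"
    using assms by simp
  finally show ?thesis
    by (rule int_spanI[OF sym])
qed

lemma mult_int_span:
  assumes "\<And>g. g \<in> G \<Longrightarrow> s * g \<in> int_span H" "x \<in> int_span G"
  shows "s * x \<in> int_span H"
proof -
  obtain c where x: "x = (\<Sum>g\<in>G. of_int (c g) * g)"
    using assms(2) unfolding int_span_def by auto
  have "s * x = (\<Sum>g\<in>G. of_int (c g) * (s * g))"
    by (simp add: x sum_distrib_left mult_ac)
  also have "\<dots> \<in> int_span H"
    using assms(1) by (intro int_span_sum int_span_of_int_mult)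
  finally show ?thesis .
qed

lemma multipliers_add: "s \<in> multipliers G \<Longrightarrow> t \<in> multipliers G \<Longrightarrow> s + t \<in> multipliers G"
  unfolding multipliers_def by (auto simp: ring_distribs intro: int_span_add)

lemma multipliers_mult: "s \<in> multipliers G \<Longrightarrow> t \<in> multipliers G \<Longrightarrow> s * t \<in> multipliers G"
  unfolding multipliers_def by (auto simp: mult.assoc intro: mult_int_span)

lemma multipliers_of_int: "finite G \<Longrightarrow> of_int k \<in> multipliers G"
  unfolding multipliers_def by (auto intro: int_span_of_int_mult int_span_base)

text \<open>The determinant trick: the nonzero vector \<open>g\<close> is an eigenvector of an
  integer matrix with eigenvalue \<open>x\<close>, and the characteristic polynomial of that matrix
  is monic and integral.\<close>

lemma algebraic_int_if_eigenvalue: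
  fixes x :: "'a :: field_char_0" and g :: "nat \<Rightarrow> 'a"
  assumes eq: "\<And>i. i < n \<Longrightarrow> x * g i = (\<Sum>j<n. of_int (c i j) * g j)"
    and nz: "k < n" "g k \<noteq> 0"
  shows "algebraic_int x"
proof -
  define A where "A = mat n n (\<lambda>(i, j). c i j)"
  define B where "B = map_mat (of_int :: int \<Rightarrow> 'a) A"
  define v where "v = vec n g"
  have A: "A \<in> carrier_mat n n" and B: "B \<in> carrier_mat n n"
    by (auto simp: A_def B_def)
  have "B *\<^sub>v v = x \<cdot>\<^sub>v v"
  proof
    show "dim_vec (B *\<^sub>v v) = dim_vec (x \<cdot>\<^sub>v v)"
      by (simp add: B_def A_def v_def)
    fix i assume "i < dim_vec (x \<cdot>\<^sub>v v)"
    then have i: "i < n" by (simp add: v_def)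
    have "(B *\<^sub>v v) $ i = (\<Sum>j<n. of_int (c i j) * g j)"
      using i by (simp add: B_def A_def v_def scalar_prod_def atLeast0LessThan)
    then show "(B *\<^sub>v v) $ i = (x \<cdot>\<^sub>v v) $ i"
      using i eq by (simp add: v_def)
  qed
  moreover have "v \<noteq> 0\<^sub>v n"
    using nz by (auto simp: v_def vec_eq_iff)
  ultimately have "eigenvector B v x"
    using B by (auto simp: eigenvector_def v_def)
  then have "eigenvalue B x"
    by (auto simp: eigenvalue_def)
  then have "poly (char_poly B) x = 0"
    using eigenvalue_root_char_poly[OF B] by simp
  moreover have "char_poly B = map_poly of_int (char_poly A)"
    unfolding B_def by (rule of_int_hom.char_poly_hom[OF A])
  moreover have "lead_coeff (char_poly A) = 1"
    using degree_monic_char_poly[OF A] by simp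
  ultimately show ?thesis
    unfolding algebraic_int_altdef_ipoly by metis
qed

lemma algebraic_int_if_stable:
  assumes "finite G" "\<And>g. g \<in> G \<Longrightarrow> x * g \<in> int_span G" "h \<in> G" "h \<noteq> 0"
  shows "algebraic_int x"
proof -
  obtain e where e: "bij_betw e {..<card G} G"
    using ex_bij_betw_nat_finite[OF assms(1)] by (auto simp: atLeast0LessThan)
  have "\<forall>g\<in>G. \<exists>c. x * g = (\<Sum>h\<in>G. of_int (c h) * h)"
    using assms(2) unfolding int_span_def by blast
  then obtain c where c: "\<And>g. g \<in> G \<Longrightarrow> x * g = (\<Sum>h\<in>G. of_int (c g h) * h)"
    by metis
  obtain k where k: "k < card G" "e k = h"
    using e assms(3) unfolding bij_betw_def by (metis imageE lessThan_iff)
  show ?thesis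
  proof (rule algebraic_int_if_eigenvalue)
    fix i assume "i < card G"
    then have "e i \<in> G"
      using e unfolding bij_betw_def by auto
    then show "x * e i = (\<Sum>j<card G. of_int (c (e i) (e j)) * e j)"
      using c sum.reindex_bij_betw[OF e, of "\<lambda>h. of_int (c (e i) h) * h"] by simp
  qed (use k assms(4) in auto)
qed

lemma multipliers_algebraic_int:
  "finite G \<Longrightarrow> 1 \<in> G \<Longrightarrow> x \<in> multipliers G \<Longrightarrow> algebraic_int x"
  by (rule algebraic_int_if_stable[of G x 1]) (auto simp: multipliers_def)

text \<open>Adjoins a root of a monic equation to a multiplier ring. The products
  \<open>g * x ^ i\<close> with \<open>i < n\<close> span a group that \<open>x\<close> preserves,
  because the equation rewrites \<open>x ^ n\<close>; the old multipliers preserve it too, since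
  they act on the factor \<open>g\<close> alone.\<close>

lemma multipliers_extend:
  assumes "finite G" "1 \<in> G" "0 < n" "\<And>i. i < n \<Longrightarrow> a i \<in> multipliers G"
    and root: "x ^ n = (\<Sum>i<n. a i * x ^ i)"
  obtains H where "finite H" "1 \<in> H" "insert x (multipliers G) \<subseteq> multipliers H"
proof -
  define H where "H = (\<lambda>(g, i). g * x ^ i) ` (G \<times> {..<n})"
  have fin: "finite H" and one: "1 \<in> H"
    using assms(1-3) by (auto simp: H_def image_iff intro!: bexI[of _ "1"] bexI[of _ "0 :: nat"])
  have inH: "g * x ^ i \<in> H" if "g \<in> G" "i < n" for g i
    using that by (auto simp: H_def)
  have spanH: "y * x ^ i \<in> int_span H" if "y \<in> int_span G" "i < n" for y i
    using mult_int_span[of G "x ^ i" H y] inH int_span_base[OF fin] that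
    by (simp add: mult.commute)
  have x: "x \<in> multipliers H"
    unfolding multipliers_def
  proof (intro CollectI ballI)
    fix h assume "h \<in> H"
    then obtain g i where h: "g \<in> G" "i < n" "h = g * x ^ i"
      by (auto simp: H_def)
    show "x * h \<in> int_span H"
    proof (cases "Suc i < n")
      case True
      then show ?thesis
        using inH[OF h(1) True] int_span_base[OF fin] h(3) by (simp add: mult_ac)
    next
      case False
      then have "n = Suc i"
        using h(2) by simp
      then have "x * h = g * x ^ n"
        by (simp add: h(3) mult_ac)
      also have "\<dots> = (\<Sum>j<n. (a j * g) * x ^ j)"
        by (simp add: root sum_distrib_left mult_ac)
      also have "\<dots> \<in> int_span H"
        using assms(4) h(1) by (intro int_span_sum spanH) (auto simp: multipliers_def)
      finally show ?thesis .
    qed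
  qed
  have "multipliers G \<subseteq> multipliers H"
  proof
    fix s assume s: "s \<in> multipliers G"
    have "s * (g * x ^ i) \<in> int_span H" if "g \<in> G" "i < n" for g i
      using s spanH[of "s * g" i] that by (simp add: multipliers_def mult.assoc)
    then show "s \<in> multipliers H"
      by (auto simp: multipliers_def H_def)
  qed
  with x fin one show ?thesis
    by (intro that) auto
qed

text \<open>Integrality as an explicit equation, to which real embeddings and the conjugation can be
  applied term by term. The degree is positive because the constant 1 has no root.\<close>

lemma algebraic_int_power_eq:
  fixes x :: "'a :: field_char_0"
  assumes "algebraic_int x"
  obtains n c where "0 < n" "x ^ n = (\<Sum>i<n. of_int (c i) * x ^ i)"
proof -
  obtain p where p: "poly (map_poly of_int p) x = 0" "lead_coeff p = 1"
    using assms by (auto simp: algebraic_int_altdef_ipoly)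
  have "degree p \<noteq> 0"
  proof
    assume "degree p = 0"
    then have "p = [:1:]"
      using p(2) by (metis degree_eq_zeroE lead_coeff_pCons(2))
    then show False
      using p(1) by simp
  qed
  moreover have "0 = (\<Sum>i<degree p. of_int (coeff p i) * x ^ i) + x ^ degree p"
    using p by (simp add: poly_altdef lessThan_Suc_atMost[symmetric])
  then have "x ^ degree p = (\<Sum>i<degree p. of_int (- coeff p i) * x ^ i)"
    by (simp add: sum_negf eq_neg_iff_add_eq_0 add.commute)
  ultimately show ?thesis
    using that[of "degree p" "\<lambda>i. - coeff p i"] by blast
qed

lemma multipliers_extend_algebraic_int:
  assumes "finite G" "1 \<in> G" "algebraic_int x"
  obtains H where "finite H" "1 \<in> H" "insert x (multipliers G) \<subseteq> multipliers H"
proof -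
  obtain n c where "0 < n" "x ^ n = (\<Sum>i<n. of_int (c i) * x ^ i)"
    using algebraic_int_power_eq[OF assms(3)] .
  then show ?thesis
    using multipliers_extend[OF assms(1,2), of n "\<lambda>i. of_int (c i)" x]
      multipliers_of_int[OF assms(1)] that by blast
qed

text \<open>Two adjunctions in a row, starting from the span of 1; the second keeps what the first
  has gained.\<close>

lemma common_multipliers:
  fixes x y :: "'a :: field_char_0"
  assumes "algebraic_int x" "algebraic_int y"
  obtains G where "finite G" "1 \<in> G" "x \<in> multipliers G" "y \<in> multipliers G"
proof -
  obtain G where G: "finite G" "1 \<in> G" "insert x (multipliers {1}) \<subseteq> multipliers G"
    using multipliers_extend_algebraic_int[of "{1}" x] assms(1) by auto
  obtain H where "finite H" "1 \<in> H" "insert y (multipliers G) \<subseteq> multipliers H"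
    using multipliers_extend_algebraic_int[OF G(1,2) assms(2)] .
  with G(3) show ?thesis
    by (intro that[of H]) auto
qed

lemma algebraic_int_add:
  "algebraic_int x \<Longrightarrow> algebraic_int y \<Longrightarrow> algebraic_int (x + y :: 'a :: field_char_0)"
  by (erule (1) common_multipliers) (blast intro: multipliers_add multipliers_algebraic_int)

lemma algebraic_int_mult:
  "algebraic_int x \<Longrightarrow> algebraic_int y \<Longrightarrow> algebraic_int (x * y :: 'a :: field_char_0)"
  by (erule (1) common_multipliers) (blast intro: multipliers_mult multipliers_algebraic_int)

lemma algebraic_int_diff:
  "algebraic_int x \<Longrightarrow> algebraic_int y \<Longrightarrow> algebraic_int (x - y :: 'a :: field_char_0)"
  using algebraic_int_add[of x "- y"] by simp

text \<open>Integral closedness in the one degree that matters here: the coefficients may themselves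
  be algebraic integers, as they are placed in a common multiplier ring before the root is
  adjoined.\<close>

lemma algebraic_int_monic_quadratic:
  fixes x :: "'a :: field_char_0"
  assumes "algebraic_int b" "algebraic_int c" "x\<^sup>2 = b * x + c"
  shows "algebraic_int x"
proof -
  obtain G where G: "finite G" "1 \<in> G" "b \<in> multipliers G" "c \<in> multipliers G"
    using common_multipliers[OF assms(1,2)] .
  have "x ^ 2 = (\<Sum>i<2. (if i = 0 then c else b) * x ^ i)"
    by (simp add: assms(3) lessThan_nat_numeral add.commute)
  then obtain H where "finite H" "1 \<in> H" "insert x (multipliers G) \<subseteq> multipliers H"
    by (rule multipliers_extend[OF G(1,2), rotated 2]) (simp_all add: G(3,4))
  then show ?thesis
    using multipliers_algebraic_int by blast
qed

lemma algebraic_int_if_power_eq: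
  fixes x :: "'a :: field_char_0"
  assumes "0 < n" "x ^ n = (\<Sum>i<n. of_int (c i) * x ^ i)"
  shows "algebraic_int x"
proof -
  obtain H where "finite H" "1 \<in> H" "insert x (multipliers {1}) \<subseteq> multipliers H"
    by (rule multipliers_extend[of "{1 :: 'a}" n "\<lambda>i. of_int (c i)" x])
      (use assms in \<open>auto intro: multipliers_of_int\<close>)
  then show ?thesis
    using multipliers_algebraic_int by blast
qed

lemma int_span_mono: "finite H \<Longrightarrow> G \<subseteq> H \<Longrightarrow> x \<in> int_span G \<Longrightarrow> x \<in> int_span H"
  using mult_int_span[of G 1 H x] by (auto intro: int_span_base)

section \<open>Number fields of narrow class number one\<close>

lemma ambient_simps [simp]:
  "carrier ambient = UNIV" "monoid.mult ambient = (*)" "add ambient = (+)"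
  "ring.zero ambient = 0" "one ambient = 1"
  by (simp_all add: ring_of_type_algebra_def)

lemma int_ring_simps [simp]:
  "monoid.mult (int_ring F) = (*)" "one (int_ring F) = 1"
  by (simp_all add: int_ring_def)

lemma ints_iff: "x \<in> ints F \<longleftrightarrow> x \<in> F \<and> algebraic_int x"
  by (simp add: int_ring_def)

lemma divides_iff: "a divides\<^bsub>int_ring F\<^esub> b \<longleftrightarrow> (\<exists>c\<in>ints F. b = a * c)"
  by (simp add: factor_def)

lemma Units_iff: "u \<in> Units (int_ring F) \<longleftrightarrow> u \<in> ints F \<and> u \<noteq> 0 \<and> inverse u \<in> ints F"
proof -
  have "x = inverse u" if "x * u = 1" for x
    using that by (metis inverse_unique mult.commute)
  then show ?thesis
    by (auto simp: Units_def intro!: bexI[of _ "inverse u"])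
qed

lemma real_embeddings_hom:
  assumes "\<sigma> \<in> real_embeddings K"
  shows "x \<in> K \<Longrightarrow> y \<in> K \<Longrightarrow> \<sigma> (x + y) = \<sigma> x + \<sigma> y"
    and "x \<in> K \<Longrightarrow> y \<in> K \<Longrightarrow> \<sigma> (x * y) = \<sigma> x * \<sigma> y"
    and "\<sigma> 1 = 1"
  using assms by (auto simp: real_embeddings_def Ring.ring_hom_def)

locale ambient_subfield =
  fixes F :: "'a :: field_char_0 set"
  assumes subfield: "subfield F ambient"
begin

lemma F_0: "0 \<in> F" and F_1: "1 \<in> F"
  and F_mult: "x \<in> F \<Longrightarrow> y \<in> F \<Longrightarrow> x * y \<in> F"
  and F_add: "x \<in> F \<Longrightarrow> y \<in> F \<Longrightarrow> x + y \<in> F"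
  using subringE[OF subfieldE(1)[OF subfield]] by auto

lemma F_minus: "x \<in> F \<Longrightarrow> - x \<in> F"
proof -
  assume x: "x \<in> F"
  interpret ring "ambient :: 'a ring"
    by (rule ring_from_type_algebra)
  have "\<ominus>\<^bsub>ambient\<^esub> x = - x"
    using minus_equality[of "- x" x] by simp
  then show ?thesis
    using subringE(5)[OF subfieldE(1)[OF subfield] x] by simp
qed

lemma F_inverse: "x \<in> F \<Longrightarrow> inverse x \<in> F"
proof (cases "x = 0")
  case False
  assume "x \<in> F"
  with False have "x \<in> Units (ambient\<lparr>carrier := F\<rparr>)"
    using subfield.subfield_Units[OF subfield] by simp
  then obtain y where "y \<in> F" "y * x = 1"
    by (auto simp: Units_def)
  then show ?thesis
    by (metis inverse_unique mult.commute)
qed (simp add: F_0)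

lemma F_diff: "x \<in> F \<Longrightarrow> y \<in> F \<Longrightarrow> x - y \<in> F"
  using F_add[of x "- y"] F_minus by simp

lemma F_divide: "x \<in> F \<Longrightarrow> y \<in> F \<Longrightarrow> x / y \<in> F"
  by (simp add: divide_inverse F_mult F_inverse)

lemma F_power: "x \<in> F \<Longrightarrow> x ^ n \<in> F"
  by (induction n) (auto simp: F_1 F_mult)

lemma F_of_nat: "of_nat n \<in> F"
  by (induction n) (auto simp: F_0 F_1 F_add)

lemma F_of_int: "of_int k \<in> F"
  by (cases k rule: int_cases2) (auto simp: F_of_nat F_minus)

lemma F_numeral: "numeral k \<in> F"
  using F_of_nat[of "numeral k"] by simp

lemma F_sum: "(\<And>i. i \<in> A \<Longrightarrow> f i \<in> F) \<Longrightarrow> (\<Sum>i\<in>A. f i) \<in> F"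
  by (induction A rule: infinite_finite_induct) (auto simp: F_0 F_add)

lemma F_prod: "(\<And>i. i \<in> A \<Longrightarrow> f i \<in> F) \<Longrightarrow> (\<Prod>i\<in>A. f i) \<in> F"
  by (induction A rule: infinite_finite_induct) (auto simp: F_1 F_mult)

lemmas F_closed = F_0 F_1 F_mult F_add F_minus F_inverse F_diff F_divide F_power F_of_nat
  F_of_int F_numeral F_sum F_prod

lemma ints_in_F: "x \<in> ints F \<Longrightarrow> x \<in> F"
  by (simp add: ints_iff)

lemma ints_0: "0 \<in> ints F" and ints_1: "1 \<in> ints F"
  and ints_mult: "x \<in> ints F \<Longrightarrow> y \<in> ints F \<Longrightarrow> x * y \<in> ints F"
  and ints_add: "x \<in> ints F \<Longrightarrow> y \<in> ints F \<Longrightarrow> x + y \<in> ints F"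
  and ints_minus: "x \<in> ints F \<Longrightarrow> - x \<in> ints F"
  and ints_diff: "x \<in> ints F \<Longrightarrow> y \<in> ints F \<Longrightarrow> x - y \<in> ints F"
  and ints_numeral: "numeral k \<in> ints F"
  and ints_of_int: "of_int m \<in> ints F"
  by (auto simp: ints_iff F_closed algebraic_int_add algebraic_int_mult algebraic_int_diff)

lemma ints_power: "x \<in> ints F \<Longrightarrow> x ^ n \<in> ints F"
  by (induction n) (auto simp: ints_1 ints_mult)

lemmas ints_closed = ints_0 ints_1 ints_mult ints_add ints_minus ints_diff ints_numeral
  ints_of_int ints_power

lemma frac_idealsD:
  assumes "I \<in> frac_ideals F"
  shows "I \<subseteq> F" "0 \<in> I" "I \<noteq> {0}" "x \<in> I \<Longrightarrow> y \<in> I \<Longrightarrow> x + y \<in> I"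
    "r \<in> ints F \<Longrightarrow> x \<in> I \<Longrightarrow> r * x \<in> I"
    "\<exists>d\<in>ints F. d \<noteq> 0 \<and> (\<forall>x\<in>I. d * x \<in> ints F)"
  using assms unfolding frac_ideals_def by simp_all

lemma frac_idealsI:
  assumes "I \<subseteq> F" "0 \<in> I" "I \<noteq> {0}" "\<And>x y. x \<in> I \<Longrightarrow> y \<in> I \<Longrightarrow> x + y \<in> I"
    "\<And>r x. r \<in> ints F \<Longrightarrow> x \<in> I \<Longrightarrow> r * x \<in> I"
    "d \<in> ints F" "d \<noteq> 0" "\<And>x. x \<in> I \<Longrightarrow> d * x \<in> ints F"
  shows "I \<in> frac_ideals F"
  unfolding frac_ideals_def by (intro CollectI conjI ballI bexI[of _ d]) (simp_all add: assms)

text \<open>This turns cosets of principal ideals into orbits under scaling, for the narrow class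
  group of \<open>K\<close> as well as for the oriented class group of \<open>L\<close>.\<close>

lemma ideal_mult_principal:
  assumes I: "I \<in> frac_ideals F"
  shows "ideal_mult (principal_ideal F g) I = (\<lambda>x. g * x) ` I"
proof (intro equalityI subsetI)
  fix z assume "z \<in> ideal_mult (principal_ideal F g) I"
  then obtain n :: nat and x y where z: "z = (\<Sum>k<n. x k * y k)"
    and xy: "\<And>k. k < n \<Longrightarrow> x k \<in> principal_ideal F g \<and> y k \<in> I"
    unfolding ideal_mult_def by blast
  have "\<exists>r. k < n \<longrightarrow> r \<in> ints F \<and> x k = g * r" for k
    using xy[of k] unfolding principal_ideal_def by blast
  then obtain r where r: "\<And>k. k < n \<Longrightarrow> r k \<in> ints F \<and> x k = g * r k"
    by metis
  \<comment> \<open>Generalised to subsets of the index range to allow induction on finite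
    sets.\<close>
  have "(\<Sum>k\<in>A. r k * y k) \<in> I" if "A \<subseteq> {..<n}" for A
    using finite_subset[OF that finite_lessThan] that
    by (induction A rule: finite_induct) (use r xy frac_idealsD[OF I] in auto)
  from this[of "{..<n}"] have "(\<Sum>k<n. r k * y k) \<in> I"
    by simp
  moreover have "z = g * (\<Sum>k<n. r k * y k)"
    by (simp add: z sum_distrib_left r mult.assoc)
  ultimately show "z \<in> (\<lambda>x. g * x) ` I"
    by blast
next
  fix z assume "z \<in> (\<lambda>x. g * x) ` I"
  then obtain y where y: "y \<in> I" "z = g * y"
    by blast
  have "g \<in> principal_ideal F g"
    unfolding principal_ideal_def using ints_1 by force
  with y show "z \<in> ideal_mult (principal_ideal F g) I"
    unfolding ideal_mult_def
    by (intro CollectI exI[of _ 1] exI[of _ "\<lambda>_. g"] exI[of _ "\<lambda>_. y"]) auto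
qed

end

section \<open>Denominators and real embeddings of a number field\<close>

locale num_field = ambient_subfield K for K :: "'a :: field_char_0 set" +
  assumes finite_dim: "ring.finite_dimension ambient \<rat> K"
begin

text \<open>A spanning set over the rationals, phrased through integer multiples so that stability
  arguments can be carried out over the integers.\<close>

lemma rat_span:
  obtains G where "finite G" "G \<subseteq> K" "\<And>x. x \<in> K \<Longrightarrow> \<exists>N :: int. N \<noteq> 0 \<and> of_int N * x \<in> int_span G"
proof -
  interpret A: ring "ambient :: 'a ring"
    by (rule ring_from_type_algebra)
  \<comment> \<open>\<open>P\<close> is inherited by every \<open>line_extension\<close>, the steps
    by which a finite dimension is built up. The member 0 is carried along to place the new vector
    \<open>v\<close> in the extension.\<close>
  define P :: "'a set \<Rightarrow> bool" where "P E \<longleftrightarrow> 0 \<in> E \<and> (\<exists>G. finite G \<and> G \<subseteq> E \<and>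
      (\<forall>x\<in>E. \<exists>N :: int. N \<noteq> 0 \<and> of_int N * x \<in> int_span G))" for E
  have step: "P (A.line_extension \<rat> v E)" if PE: "P E" for v E
  proof -
    have mem: "x \<in> A.line_extension \<rat> v E \<longleftrightarrow> (\<exists>k\<in>\<rat>. \<exists>e\<in>E. x = k * v + e)" for x
      using A.line_extension_mem_iff[of x \<rat> v E] by simp
    obtain G where G: "0 \<in> E" "finite G" "G \<subseteq> E"
      "\<And>x. x \<in> E \<Longrightarrow> \<exists>N :: int. N \<noteq> 0 \<and> of_int N * x \<in> int_span G"
      using PE unfolding P_def by blast
    have "\<exists>N :: int. N \<noteq> 0 \<and> of_int N * x \<in> int_span (insert v G)"
      if x0: "x \<in> A.line_extension \<rat> v E" for x
    proof -
      obtain k e where x: "k \<in> \<rat>" "e \<in> E" "x = k * v + e"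
        using x0 unfolding mem by blast
      obtain a b where k: "b > 0" "k = of_int a / of_int b"
        using x(1) by (auto elim: Rats_cases')
      obtain N :: int where N: "N \<noteq> 0" "of_int N * e \<in> int_span G"
        using G(4)[OF x(2)] by blast
      have "of_int (N * b) * x = of_int (N * a) * v + of_int b * (of_int N * e)"
        using k by (simp add: x(3) field_simps)
      also have "\<dots> \<in> int_span (insert v G)"
        using int_span_mono[OF _ _ N(2), of "insert v G"] G(2)
        by (intro int_span_add int_span_of_int_mult[of v] int_span_of_int_mult[of "_ * e"])
          (auto intro: int_span_base)
      finally show ?thesis
        using N k by (intro exI[of _ "N * b"]) auto
    qed
    moreover have "0 \<in> A.line_extension \<rat> v E"
      unfolding mem using G(1) by (intro bexI[of _ 0]) auto
    moreover have "insert v G \<subseteq> A.line_extension \<rat> v E"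
    proof -
      have "v = 1 * v + 0" and "g = 0 * v + g" for g
        by simp_all
      then show ?thesis
        unfolding subset_iff mem using G(1,3) by (metis Rats_0 Rats_1 insert_iff subsetD)
    qed
    ultimately show ?thesis
      unfolding P_def using G(2) by (meson finite_insert)
  qed
  have "P E" if "A.dimension n R E" "R = \<rat>" for n R E
    using that
  proof (induction rule: A.dimension.induct)
    case (zero_dim R)
    have "P {0}"
      unfolding P_def by (auto intro!: exI[of _ "{}"] exI[of _ 1] simp: int_span_0)
    then show ?case
      by simp
  qed (use step in auto)
  moreover obtain n where "A.dimension n \<rat> K"
    using finite_dim by (auto simp: A.finite_dimension_def)
  ultimately have "P K"
    by blast
  then show ?thesis
    unfolding P_def using that by blast
qed

text \<open>Let \<open>M\<close> clear the denominators of all \<open>x * g\<close> with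
  \<open>g\<close> in the spanning set \<open>G\<close>. Then \<open>M * x\<close> preserves the
  span of \<open>G\<close>, which is not zero because it contains a nonzero multiple of 1.\<close>

lemma ex_int_multiple_algebraic_int:
  assumes "x \<in> K"
  shows "\<exists>N :: int. N \<noteq> 0 \<and> algebraic_int (of_int N * x)"
proof -
  obtain G where G: "finite G" "G \<subseteq> K"
    "\<And>x. x \<in> K \<Longrightarrow> \<exists>N :: int. N \<noteq> 0 \<and> of_int N * x \<in> int_span G"
    using rat_span by blast
  have "\<forall>g\<in>G. \<exists>N :: int. N \<noteq> 0 \<and> of_int N * (x * g) \<in> int_span G"
    using G assms F_mult by blast
  then obtain N :: "'a \<Rightarrow> int" where N: "\<And>g. g \<in> G \<Longrightarrow> N g \<noteq> 0"
    "\<And>g. g \<in> G \<Longrightarrow> of_int (N g) * (x * g) \<in> int_span G"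
    by metis
  define M where "M = (\<Prod>g\<in>G. N g)"
  have M: "of_int M * x * g \<in> int_span G" if "g \<in> G" for g
  proof -
    have "M = (\<Prod>h\<in>G - {g}. N h) * N g"
      using prod.remove[OF G(1) that, of N] by (simp add: M_def)
    then have "of_int M * x * g = of_int (\<Prod>h\<in>G - {g}. N h) * (of_int (N g) * (x * g))"
      by (simp add: mult_ac)
    then show ?thesis
      using int_span_of_int_mult[OF N(2)[OF that]] by metis
  qed
  have "\<exists>h\<in>G. h \<noteq> 0"
  proof (rule ccontr)
    assume "\<not> ?thesis"
    then have "y = 0" if "y \<in> int_span G" for y
      using that unfolding int_span_def by (auto intro!: sum.neutral)
    then show False
      using G(3)[OF F_1] by auto
  qed
  then have "algebraic_int (of_int M * x)"
    using algebraic_int_if_stable[OF G(1), of "of_int M * x"] M by blast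
  moreover have "M \<noteq> 0"
    using N(1) G(1) by (simp add: M_def)
  ultimately show ?thesis
    by blast
qed

lemma real_embedding_simps:
  assumes "\<sigma> \<in> real_embeddings K"
  shows "\<sigma> 0 = 0" "x \<in> K \<Longrightarrow> \<sigma> (- x) = - \<sigma> x" "x \<in> K \<Longrightarrow> y \<in> K \<Longrightarrow> \<sigma> (x - y) = \<sigma> x - \<sigma> y"
    "x \<in> K \<Longrightarrow> \<sigma> x = 0 \<longleftrightarrow> x = 0" "x \<in> K \<Longrightarrow> \<sigma> (inverse x) = inverse (\<sigma> x)"
    "x \<in> K \<Longrightarrow> y \<in> K \<Longrightarrow> \<sigma> (x / y) = \<sigma> x / \<sigma> y" "\<sigma> (of_int k) = of_int k"
    "x \<in> K \<Longrightarrow> \<sigma> (x ^ n) = \<sigma> x ^ n"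
proof -
  note h = real_embeddings_hom[OF assms]
  show 0: "\<sigma> 0 = 0"
    using h(1)[of 0 0] F_0 by simp
  show m: "\<sigma> (- x) = - \<sigma> x" if "x \<in> K" for x
    using h(1)[of x "- x"] F_minus[OF that] that 0 by simp
  show "\<sigma> (x - y) = \<sigma> x - \<sigma> y" if "x \<in> K" "y \<in> K" for x y
    using h(1)[of x "- y"] F_minus[of y] that m[of y] by simp
  have i: "\<sigma> x * \<sigma> (inverse x) = 1" if "x \<in> K" "x \<noteq> 0" for x
    using h(2)[of x "inverse x"] F_inverse[of x] that h(3) by simp
  show z: "\<sigma> x = 0 \<longleftrightarrow> x = 0" if "x \<in> K" for x
    using i[of x] that 0 by (metis mult_zero_left zero_neq_one)
  show j: "\<sigma> (inverse x) = inverse (\<sigma> x)" if "x \<in> K" for x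
    using i[of x] that 0 by (cases "x = 0") (auto simp: inverse_unique)
  show "\<sigma> (x / y) = \<sigma> x / \<sigma> y" if "x \<in> K" "y \<in> K" for x y
    using h(2)[of x "inverse y"] that F_inverse[of y] j by (simp add: divide_inverse)
  have n: "\<sigma> (of_nat k) = of_nat k" for k
    by (induction k) (auto simp: 0 h F_closed)
  show "\<sigma> (of_int k) = of_int k"
    by (cases k rule: int_cases2) (auto simp: n m F_closed)
  show "\<sigma> (x ^ n) = \<sigma> x ^ n" if "x \<in> K"
    using that by (induction n) (auto simp: h F_closed)
qed

lemma real_embedding_sum:
  assumes "\<sigma> \<in> real_embeddings K" "\<And>i. i \<in> A \<Longrightarrow> f i \<in> K"
  shows "\<sigma> (\<Sum>i\<in>A. f i) = (\<Sum>i\<in>A. \<sigma> (f i))"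
  using assms(2) by (induction A rule: infinite_finite_induct)
    (auto simp: real_embedding_simps[OF assms(1)] real_embeddings_hom[OF assms(1)] F_closed)

lemma real_embedding_prod:
  assumes "\<sigma> \<in> real_embeddings K" "\<And>i. i \<in> A \<Longrightarrow> f i \<in> K"
  shows "\<sigma> (\<Prod>i\<in>A. f i) = (\<Prod>i\<in>A. \<sigma> (f i))"
  using assms(2) by (induction A rule: infinite_finite_induct)
    (auto simp: real_embedding_simps[OF assms(1)] real_embeddings_hom[OF assms(1)] F_closed)

text \<open>Some integer multiple of \<open>x\<close> satisfies a monic integral equation. Every
  embedding maps this multiple to a real root of the same polynomial.\<close>

lemma finite_real_embedding_values:
  assumes "x \<in> K"
  shows "finite {\<sigma> x | \<sigma>. \<sigma> \<in> real_embeddings K}"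
proof -
  obtain N :: int where N: "N \<noteq> 0" "algebraic_int (of_int N * x)"
    using ex_int_multiple_algebraic_int[OF assms] by blast
  obtain n c where n: "0 < n" "(of_int N * x) ^ n = (\<Sum>i<n. of_int (c i) * (of_int N * x) ^ i)"
    using algebraic_int_power_eq[OF N(2)] .
  define p :: "real poly" where "p = monom 1 n - (\<Sum>i<n. monom (of_int (c i)) i)"
  have "coeff p n = 1"
    by (simp add: p_def coeff_sum)
  then have "p \<noteq> 0"
    by auto
  then have fin: "finite {r. poly p r = 0}"
    by (rule poly_roots_finite)
  have "\<sigma> x \<in> (\<lambda>r. r / of_int N) ` {r. poly p r = 0}" if s: "\<sigma> \<in> real_embeddings K" for \<sigma>
  proof -
    note h = real_embedding_simps[OF s] real_embeddings_hom[OF s]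
    have "of_int N * x \<in> K"
      using assms by (simp add: F_closed)
    then have "\<sigma> (of_int N * x) ^ n = (\<Sum>i<n. of_int (c i) * \<sigma> (of_int N * x) ^ i)"
      using arg_cong[OF n(2), of \<sigma>] by (simp add: h F_closed real_embedding_sum[OF s])
    then have "poly p (\<sigma> (of_int N * x)) = 0"
      by (simp add: p_def poly_sum poly_monom)
    moreover have "\<sigma> (of_int N * x) = of_int N * \<sigma> x"
      using assms by (simp add: h F_closed)
    ultimately show ?thesis
      using N(1) by (auto simp: image_iff intro!: exI[of _ "of_int N * \<sigma> x"])
  qed
  then show ?thesis
    by (intro finite_subset[OF _ finite_imageI[OF fin, of "\<lambda>r. r / of_int N"]]) auto
qed

text \<open>An embedding is determined by its values on a finite spanning set, and each of these
  takes finitely many values. Finiteness allows sums and products over embeddings when signs are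
  prescribed.\<close>

lemma finite_real_embeddings: "finite (real_embeddings K)"
proof -
  obtain G where G: "finite G" "G \<subseteq> K"
    "\<And>x. x \<in> K \<Longrightarrow> \<exists>N :: int. N \<noteq> 0 \<and> of_int N * x \<in> int_span G"
    using rat_span by blast
  have "inj_on (\<lambda>\<sigma>. restrict \<sigma> G) (real_embeddings K)"
  proof (intro inj_onI)
    fix \<sigma> \<tau> assume s: "\<sigma> \<in> real_embeddings K" and t: "\<tau> \<in> real_embeddings K"
      and eq: "restrict \<sigma> G = restrict \<tau> G"
    have eqG: "\<sigma> g = \<tau> g" if "g \<in> G" for g
      using fun_cong[OF eq, of g] that by simp
    have "\<sigma> x = \<tau> x" if x: "x \<in> K" for x
    proof -
      obtain N :: int and c where N: "N \<noteq> 0" "of_int N * x = (\<Sum>g\<in>G. of_int (c g) * g)"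
        using G(3)[OF x] unfolding int_span_def by auto
      have *: "\<rho> (of_int N * x) = (\<Sum>g\<in>G. of_int (c g) * \<rho> g)" "\<rho> (of_int N * x) = of_int N * \<rho> x"
        if r: "\<rho> \<in> real_embeddings K" for \<rho>
      proof -
        have "\<rho> (\<Sum>g\<in>G. of_int (c g) * g) = (\<Sum>g\<in>G. \<rho> (of_int (c g) * g))"
          using G(2) by (intro real_embedding_sum[OF r] F_mult F_of_int) auto
        also have "\<dots> = (\<Sum>g\<in>G. of_int (c g) * \<rho> g)"
          using G(2) by (intro sum.cong)
            (auto simp: real_embedding_simps[OF r] real_embeddings_hom[OF r] F_closed)
        finally show "\<rho> (of_int N * x) = (\<Sum>g\<in>G. of_int (c g) * \<rho> g)"
          by (simp add: N(2))
        show "\<rho> (of_int N * x) = of_int N * \<rho> x"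
          using x by (simp add: real_embedding_simps[OF r] real_embeddings_hom[OF r] F_closed)
      qed
      have "(\<Sum>g\<in>G. of_int (c g) * \<sigma> g) = (\<Sum>g\<in>G. of_int (c g) * \<tau> g)"
        using eqG by (intro sum.cong) auto
      then show ?thesis
        using *[OF s] *[OF t] N(1) by (metis mult_cancel_left of_int_eq_0_iff)
    qed
    then show "\<sigma> = \<tau>"
      using s t by (intro extensionalityI[of _ K]) (auto simp: real_embeddings_def)
  qed
  moreover have "(\<lambda>\<sigma>. restrict \<sigma> G) ` real_embeddings K \<subseteq>
      (\<Pi>\<^sub>E g\<in>G. {\<sigma> g | \<sigma>. \<sigma> \<in> real_embeddings K})"
    by (auto intro!: PiE_I)
  moreover have "finite (\<Pi>\<^sub>E g\<in>G. {\<sigma> g | \<sigma>. \<sigma> \<in> real_embeddings K})"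
    using G(2) by (intro finite_PiE[OF G(1)] finite_real_embedding_values) auto
  ultimately show ?thesis
    by (meson finite_imageD finite_subset)
qed

text \<open>Two embeddings differ at some \<open>x\<close> but agree on the rationals. Subtracting a
  rational close to \<open>\<sigma> x\<close> makes the value at \<open>\<sigma>\<close> tiny and
  keeps the value at \<open>\<tau>\<close> away from 0; a natural multiple then makes the latter
  exceed 1.\<close>

lemma ex_large_small:
  assumes s: "\<sigma> \<in> real_embeddings K" and t: "\<tau> \<in> real_embeddings K" and "\<sigma> \<noteq> \<tau>" and "0 < (e :: real)"
  shows "\<exists>x\<in>K. \<bar>\<sigma> x\<bar> < e \<and> 1 < \<bar>\<tau> x\<bar>"
proof -
  have "\<exists>x\<in>K. \<sigma> x \<noteq> \<tau> x"
  proof (rule ccontr)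
    assume "\<not> ?thesis"
    then have "\<sigma> = \<tau>"
      using s t by (intro extensionalityI[of _ K]) (auto simp: real_embeddings_def)
    with assms(3) show False by simp
  qed
  then obtain x where x: "x \<in> K" "\<sigma> x \<noteq> \<tau> x"
    by blast
  define d where "d = \<bar>\<sigma> x - \<tau> x\<bar>"
  have d: "d > 0"
    using x by (simp add: d_def)
  \<comment> \<open>The multiplier is fixed before the rational approximation, whose error can then
    be kept below \<open>e / m\<close>.\<close>
  obtain m :: nat where m: "2 / d < real m"
    using reals_Archimedean2 by blast
  have m0: "real m > 0"
    using d m by (meson divide_pos_pos order_less_trans zero_less_numeral)
  define \<delta> where "\<delta> = min (d / 2) (e / real m)"
  have \<delta>: "\<delta> > 0" "\<delta> \<le> d / 2" "\<delta> \<le> e / real m"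
    unfolding \<delta>_def using d assms(4) m0 by (simp_all only: min_less_iff_conj min.cobounded1 min.cobounded2) simp
  obtain r where r: "\<sigma> x - \<delta> < of_rat r" "of_rat r < \<sigma> x"
    using of_rat_dense[of "\<sigma> x - \<delta>" "\<sigma> x"] \<delta>(1) by auto
  obtain a b where ab: "b > 0" "(of_rat r :: real) = of_int a / of_int b"
    by (metis Rats_cases' Rats_of_rat)
  define y where "y = of_int (int m) * (x - of_int a / of_int b)"
  have y: "y \<in> K"
    using x by (simp add: y_def F_closed del: of_int_of_nat_eq)
  have val: "\<rho> y = real m * (\<rho> x - of_rat r)" if "\<rho> \<in> real_embeddings K" for \<rho>
    using x(1) ab(2) by (simp add: y_def real_embedding_simps[OF that] real_embeddings_hom[OF that]
        F_closed del: of_int_of_nat_eq)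
  have "\<bar>\<sigma> x - of_rat r\<bar> < e / real m"
    using r \<delta> by auto
  then have "real m * \<bar>\<sigma> x - of_rat r\<bar> < e"
    using m0 by (simp add: field_simps)
  then have "\<bar>\<sigma> y\<bar> < e"
    by (simp add: val[OF s] abs_mult)
  moreover have "\<bar>\<sigma> x - of_rat r\<bar> < d / 2" "d \<le> \<bar>\<sigma> x - of_rat r\<bar> + \<bar>\<tau> x - of_rat r\<bar>"
    using r \<delta>(2) by (linarith, simp add: d_def)
  then have "\<bar>\<tau> x - of_rat r\<bar> > d / 2"
    by linarith
  then have "real m * \<bar>\<tau> x - of_rat r\<bar> > real m * (d / 2)"
    using m0 by simp
  moreover have "real m * (d / 2) > 1"
    using m d by (simp add: field_simps)
  ultimately show ?thesis
    using y by (intro bexI[of _ y]) (auto simp: val[OF t] abs_mult)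
qed

text \<open>
  If \<open>x \<tau>\<close> is small at \<open>\<sigma>\<close> and large at \<open>\<tau>\<close> for each \<open>\<tau> \<noteq> \<sigma>\<close>, then
  \<open>(\<Sum>\<tau>. (x \<tau>)\<^sup>2) - 1\<close> is negative exactly at \<open>\<sigma>\<close>.
\<close>

lemma ex_negative_only_at:
  assumes s: "\<sigma> \<in> real_embeddings K"
  shows "\<exists>x\<in>K. \<sigma> x < 0 \<and> (\<forall>\<tau>\<in>real_embeddings K - {\<sigma>}. 0 < \<tau> x)"
proof -
  define R where "R = real_embeddings K - {\<sigma>}"
  have fin: "finite R"
    using finite_real_embeddings by (simp add: R_def)
  \<comment> \<open>\<open>card R\<close> squares, each at most \<open>e\<close>, must add up to
    less than 1.\<close>
  define e where "e = 1 / (1 + real (card R))"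
  have e: "0 < e" "e \<le> 1"
    by (auto simp: e_def)
  have "\<forall>\<tau>\<in>R. \<exists>x\<in>K. \<bar>\<sigma> x\<bar> < e \<and> 1 < \<bar>\<tau> x\<bar>"
    using ex_large_small[OF s _ _ e(1)] by (auto simp: R_def)
  then obtain x where x: "\<And>\<tau>. \<tau> \<in> R \<Longrightarrow> x \<tau> \<in> K" "\<And>\<tau>. \<tau> \<in> R \<Longrightarrow> \<bar>\<sigma> (x \<tau>)\<bar> < e"
    "\<And>\<tau>. \<tau> \<in> R \<Longrightarrow> 1 < \<bar>\<tau> (x \<tau>)\<bar>"
    by metis
  define y where "y = (\<Sum>\<tau>\<in>R. (x \<tau>)\<^sup>2) - 1"
  have y: "y \<in> K"
    using x(1) by (auto simp: y_def intro!: F_closed)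
  have val: "\<rho> y = (\<Sum>\<tau>\<in>R. (\<rho> (x \<tau>))\<^sup>2) - 1" if r: "\<rho> \<in> real_embeddings K" for \<rho>
  proof -
    have "\<rho> y = \<rho> (\<Sum>\<tau>\<in>R. (x \<tau>)\<^sup>2) - 1"
      unfolding y_def using x(1)
      by (subst real_embedding_simps(3)[OF r]) (auto intro!: F_closed simp: real_embeddings_hom[OF r])
    also have "\<rho> (\<Sum>\<tau>\<in>R. (x \<tau>)\<^sup>2) = (\<Sum>\<tau>\<in>R. \<rho> ((x \<tau>)\<^sup>2))"
      using x(1) by (intro real_embedding_sum[OF r] F_power)
    also have "\<dots> = (\<Sum>\<tau>\<in>R. (\<rho> (x \<tau>))\<^sup>2)"
      using x(1) by (intro sum.cong) (auto simp: real_embedding_simps[OF r])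
    finally show ?thesis .
  qed
  have "(\<Sum>\<tau>\<in>R. (\<sigma> (x \<tau>))\<^sup>2) \<le> (\<Sum>\<tau>\<in>R. e)"
  proof (rule sum_mono)
    fix \<tau> assume t: "\<tau> \<in> R"
    have "(\<sigma> (x \<tau>))\<^sup>2 = \<bar>\<sigma> (x \<tau>)\<bar> * \<bar>\<sigma> (x \<tau>)\<bar>"
      by (simp add: power2_eq_square abs_mult_self_eq)
    also have "\<dots> \<le> 1 * e"
      using x(2)[OF t] e by (intro mult_mono) auto
    finally show "(\<sigma> (x \<tau>))\<^sup>2 \<le> e" by simp
  qed
  also have "\<dots> < 1"
    by (simp add: e_def)
  finally have "\<sigma> y < 0"
    by (simp add: val[OF s])
  moreover have "0 < \<tau> y" if t: "\<tau> \<in> R" for \<tau>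
  proof -
    have "1 < (\<tau> (x \<tau>))\<^sup>2"
      using less_1_mult[OF x(3)[OF t] x(3)[OF t]] by (simp add: power2_eq_square)
    also have "\<dots> \<le> (\<Sum>\<tau>'\<in>R. (\<tau> (x \<tau>'))\<^sup>2)"
      using fin t by (intro member_le_sum) auto
    finally show ?thesis
      using t val[of \<tau>] by (simp add: R_def)
  qed
  ultimately show ?thesis
    using y by (auto simp: R_def)
qed

text \<open>The product, over the embeddings where \<open>\<epsilon>\<close> is -1, of elements that
  are negative exactly at that embedding.\<close>

lemma ex_prescribed_signs:
  assumes "\<epsilon> \<in> (\<Pi>\<^sub>E \<sigma>\<in>real_embeddings K. {-1, 1})"
  shows "\<exists>x\<in>K. x \<noteq> 0 \<and> sgn_vec K x = \<epsilon>"
proof -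
  let ?R = "real_embeddings K"
  obtain f where f: "\<And>\<sigma>. \<sigma> \<in> ?R \<Longrightarrow> f \<sigma> \<in> K" "\<And>\<sigma>. \<sigma> \<in> ?R \<Longrightarrow> \<sigma> (f \<sigma>) < 0"
    "\<And>\<sigma> \<tau>. \<sigma> \<in> ?R \<Longrightarrow> \<tau> \<in> ?R \<Longrightarrow> \<tau> \<noteq> \<sigma> \<Longrightarrow> 0 < \<tau> (f \<sigma>)"
    using bchoice[of ?R "\<lambda>\<sigma> x. x \<in> K \<and> \<sigma> x < 0 \<and> (\<forall>\<tau>\<in>?R - {\<sigma>}. 0 < \<tau> x)"]
      ex_negative_only_at by (metis DiffI empty_iff insert_iff)
  define S where "S = {\<sigma> \<in> ?R. \<epsilon> \<sigma> = -1}"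
  have S: "S \<subseteq> ?R" "finite S"
    using finite_real_embeddings by (auto simp: S_def)
  define x where "x = (\<Prod>\<sigma>\<in>S. f \<sigma>)"
  have x: "x \<in> K"
    using f(1) S(1) by (auto simp: x_def intro!: F_prod)
  have x0: "x \<noteq> 0"
    unfolding x_def using f(2) S real_embedding_simps(1)
    by (metis (mono_tags, lifting) less_irrefl prod_zero_iff subsetD)
  have "sgn (\<tau> x) = \<epsilon> \<tau>" if t: "\<tau> \<in> ?R" for \<tau>
  proof -
    have "\<tau> x = (\<Prod>\<sigma>\<in>S. \<tau> (f \<sigma>))"
      unfolding x_def using f(1) S(1) by (intro real_embedding_prod[OF t]) auto
    moreover have "sgn (\<Prod>\<sigma>\<in>A. h \<sigma>) = (\<Prod>\<sigma>\<in>A. sgn (h \<sigma>))" for A and h :: "('a \<Rightarrow> real) \<Rightarrow> real"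
      by (induction A rule: infinite_finite_induct) (auto simp: sgn_mult)
    ultimately have "sgn (\<tau> x) = (\<Prod>\<sigma>\<in>S. sgn (\<tau> (f \<sigma>)))"
      by simp
    also have "\<dots> = (\<Prod>\<sigma>\<in>S. if \<sigma> = \<tau> then -1 else 1)"
    proof (intro prod.cong refl)
      fix \<sigma> assume "\<sigma> \<in> S"
      then have "\<sigma> \<in> ?R"
        using S(1) by blast
      then show "sgn (\<tau> (f \<sigma>)) = (if \<sigma> = \<tau> then -1 else 1)"
        using f(2)[of \<sigma>] f(3)[of \<sigma> \<tau>] t by auto
    qed
    also have "\<dots> = (if \<tau> \<in> S then -1 else 1)"
      using S(2) by simp
    also have "\<dots> = \<epsilon> \<tau>"
      using assms t by (auto simp: S_def PiE_iff)
    finally show ?thesis .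
  qed
  then have "sgn_vec K x = \<epsilon>"
    using assms by (auto simp: sgn_vec_def PiE_iff extensional_def)
  with x x0 show ?thesis by blast
qed

lemma principal_frac_ideal: "g \<in> K \<Longrightarrow> g \<noteq> 0 \<Longrightarrow> principal_ideal K g \<in> frac_ideals K"
proof -
  assume g: "g \<in> K" "g \<noteq> 0"
  obtain N :: int where N: "N \<noteq> 0" "algebraic_int (of_int N * g)"
    using ex_int_multiple_algebraic_int[OF g(1)] by blast
  have "of_int N * (g * x) \<in> ints K" if "x \<in> ints K" for x
    using ints_mult[of "of_int N * g" x] that N g(1) by (simp add: ints_iff F_closed mult.assoc)
  moreover have "g \<in> principal_ideal K g"
    unfolding principal_ideal_def using ints_1 by force
  ultimately show ?thesis
    unfolding frac_ideals_def
    using g N(1) F_mult ints_closed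
    by (auto simp: principal_ideal_def ints_in_F distrib_left[symmetric] mult.left_commute
        intro!: bexI[of _ "of_int N"])
qed

end

section \<open>Consequences of narrow class number one\<close>

locale class_number_one = num_field +
  assumes narrow_class_number: "narrow_class_number K = 1"
    and real_embeddings_nonempty: "real_embeddings K \<noteq> {}"
begin

lemma totally_positive_1: "totally_positive K 1"
  by (simp add: totally_positive_def F_1 real_embeddings_hom(3))

text \<open>With a single coset, \<open>I\<close> lies in the coset of \<open>ints K\<close>, whose
  members are the principal ideals with a totally positive generator.\<close>

lemma frac_ideal_principal:
  assumes I: "I \<in> frac_ideals K"
  obtains g where "totally_positive K g" "I = principal_ideal K g"
proof -
  define P where "P = {principal_ideal K g | g. totally_positive K g}"
  have coset: "P #>\<^bsub>ideal_group K\<^esub> J = {(\<lambda>x. g * x) ` J | g. totally_positive K g}"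
    if "J \<in> frac_ideals K" for J
    using ideal_mult_principal[OF that]
    by (auto simp: r_coset_def ideal_group_def P_def; blast)
  have int: "ints K \<in> frac_ideals K"
    using principal_frac_ideal[OF F_1] by (simp add: principal_ideal_def)
  obtain C where "rcosets\<^bsub>ideal_group K\<^esub> P = {C}"
    using narrow_class_number
    by (auto simp: narrow_class_number_def narrow_class_group_def FactGroup_def P_def card_1_singleton_iff)
  moreover have "P #>\<^bsub>ideal_group K\<^esub> J \<in> rcosets\<^bsub>ideal_group K\<^esub> P" if "J \<in> frac_ideals K" for J
    using that by (auto simp: RCOSETS_def ideal_group_def)
  ultimately have "P #>\<^bsub>ideal_group K\<^esub> I = P #>\<^bsub>ideal_group K\<^esub> ints K"
    using I int by (metis singletonD)
  moreover have "I \<in> P #>\<^bsub>ideal_group K\<^esub> I"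
    unfolding coset[OF I] using totally_positive_1 by force
  ultimately show ?thesis
    using that unfolding coset[OF int] principal_ideal_def by blast
qed

text \<open>Take \<open>x\<close> in \<open>K\<close> with the required signs. The ideal of
  \<open>x\<close> also has a totally positive generator \<open>g\<close>, and the unit
  \<open>x / g\<close> has the signs of \<open>x\<close>.\<close>

lemma ex_unit_prescribed_signs:
  assumes "\<epsilon> \<in> (\<Pi>\<^sub>E \<sigma>\<in>real_embeddings K. {-1, 1})"
  obtains u where "u \<in> Units (int_ring K)" "sgn_vec K u = \<epsilon>"
proof -
  obtain x where x: "x \<in> K" "x \<noteq> 0" "sgn_vec K x = \<epsilon>"
    using ex_prescribed_signs[OF assms] by blast
  obtain g where g: "totally_positive K g" "principal_ideal K x = principal_ideal K g"
    using frac_ideal_principal[OF principal_frac_ideal[OF x(1,2)]] .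
  have g': "g \<in> K" "g \<noteq> 0"
    using g(1) by (auto simp: totally_positive_def)
  have "x \<in> principal_ideal K x" "g \<in> principal_ideal K g"
    unfolding principal_ideal_def using ints_1 by force+
  then obtain a b where a: "a \<in> ints K" "x = g * a" and b: "b \<in> ints K" "g = x * b"
    using g(2) unfolding principal_ideal_def by (metis (no_types, lifting) imageE)
  have "a * b = 1"
    using a(2) b(2) x(2) by (auto simp: mult.commute)
  then have "a \<noteq> 0" "inverse a = b"
    by (auto simp: inverse_unique)
  then have "a \<in> Units (int_ring K)"
    using a b by (simp add: Units_iff)
  moreover have "sgn (\<sigma> a) = sgn (\<sigma> x)" if "\<sigma> \<in> real_embeddings K" for \<sigma>
    using that g(1) a ints_in_F[OF a(1)]
    by (simp add: real_embeddings_hom[OF that] sgn_mult totally_positive_def)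
  then have "sgn_vec K a = \<epsilon>"
    using x(3) by (auto simp: sgn_vec_def cong: restrict_cong)
  ultimately show ?thesis
    by (rule that)
qed

text \<open>The fractional ideal spanned by 1 and \<open>y\<close> has a generator \<open>g\<close>.
  From \<open>1 = g * n\<close>, \<open>y = g * m\<close> and \<open>g = b + a * y\<close> one reads
  off the fraction and, after multiplying the last equation by \<open>n\<close>, the Bezout
  relation.\<close>

lemma ex_coprime_fraction:
  assumes "y \<in> K"
  obtains m n a b where "m \<in> ints K" "n \<in> ints K" "n \<noteq> 0" "a \<in> ints K" "b \<in> ints K"
    "y = m / n" "a * m + b * n = 1"
proof -
  define I where "I = {r + s * y | r s. r \<in> ints K \<and> s \<in> ints K}"
  obtain N :: int where N: "N \<noteq> 0" "algebraic_int (of_int N * y)"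
    using ex_int_multiple_algebraic_int[OF assms] by blast
  have Ny: "of_int N * y \<in> ints K"
    using N(2) assms by (simp add: ints_iff F_closed)
  have II: "r + s * y \<in> I" if "r \<in> ints K" "s \<in> ints K" for r s
    using that by (auto simp: I_def)
  have 0: "0 \<in> I" and 1: "1 \<in> I" and y: "y \<in> I"
    using II[of 0 0] II[of 1 0] II[of 0 1] ints_closed by auto
  have "x + z \<in> I" if xz: "x \<in> I" "z \<in> I" for x z
  proof -
    obtain r s r' s' where "r \<in> ints K" "s \<in> ints K" "r' \<in> ints K" "s' \<in> ints K"
      "x = r + s * y" "z = r' + s' * y"
      using xz unfolding I_def by blast
    then show ?thesis
      using II[of "r + r'" "s + s'"] ints_add by (simp add: algebra_simps)
  qed
  moreover have "c * x \<in> I" if cx: "c \<in> ints K" "x \<in> I" for c x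
  proof -
    obtain r s where "r \<in> ints K" "s \<in> ints K" "x = r + s * y"
      using cx unfolding I_def by blast
    then show ?thesis
      using II[of "c * r" "c * s"] ints_mult cx(1) by (simp add: algebra_simps)
  qed
  moreover have "of_int N * x \<in> ints K" if cx: "x \<in> I" for x
  proof -
    obtain r s where "r \<in> ints K" "s \<in> ints K" "x = r + s * y"
      using cx unfolding I_def by blast
    then have "of_int N * x = of_int N * r + s * (of_int N * y)" and "r \<in> ints K" "s \<in> ints K"
      by (simp_all add: algebra_simps)
    then show ?thesis
      using Ny by (simp add: ints_closed)
  qed
  moreover have "I \<subseteq> K"
    using assms by (auto simp: I_def intro!: F_add F_mult dest: ints_in_F)
  ultimately have "I \<in> frac_ideals K"
    unfolding frac_ideals_def using 0 1 N(1) ints_of_int[of N]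
    by (auto intro!: bexI[of _ "of_int N"])
  then obtain g where g: "totally_positive K g" "I = principal_ideal K g"
    using frac_ideal_principal by blast
  obtain n where n: "n \<in> ints K" "1 = g * n"
    using 1 unfolding g(2) principal_ideal_def by blast
  obtain m where m: "m \<in> ints K" "y = g * m"
    using y unfolding g(2) principal_ideal_def by blast
  have "g \<in> I"
    unfolding g(2) principal_ideal_def using ints_1 by force
  then obtain b a where ab: "b \<in> ints K" "a \<in> ints K" "g = b + a * y"
    unfolding I_def by blast
  have n0: "n \<noteq> 0"
    using n(2) by auto
  have gn: "g = 1 / n"
    using n n0 by (simp add: field_simps)
  have "1 = (b + a * y) * n"
    using n(2) ab(3) by simp
  also have "\<dots> = b * n + a * (y * n)"
    by (simp add: algebra_simps)
  also have "y * n = m"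
    using m(2) n0 by (simp add: gn)
  finally have "a * m + b * n = 1"
    by (simp add: add.commute)
  moreover have "y = m / n"
    using m(2) by (simp add: gn)
  ultimately show ?thesis
    using that m(1) n(1) n0 ab by blast
qed

end

section \<open>The quadratic extension\<close>

lemma subfield_ambientI:
  fixes E :: "'a :: field_char_0 set"
  assumes "1 \<in> E" "\<And>x. x \<in> E \<Longrightarrow> - x \<in> E" "\<And>x. x \<in> E \<Longrightarrow> inverse x \<in> E"
    "\<And>x y. x \<in> E \<Longrightarrow> y \<in> E \<Longrightarrow> x + y \<in> E" "\<And>x y. x \<in> E \<Longrightarrow> y \<in> E \<Longrightarrow> x * y \<in> E"
  shows "subfield E ambient"
proof -
  interpret A: field "ambient :: 'a ring"
    by (rule field_from_type_algebra)
  have minus: "\<ominus>\<^bsub>ambient\<^esub> x = - x" for x :: 'a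
    using A.minus_equality[of "- x" x] by simp
  have inv: "inv\<^bsub>ambient\<^esub> x = inverse x" if "x \<noteq> 0" for x :: 'a
    using A.inv_unique'[of x "inverse x"] that by simp
  have "subring E ambient"
    using assms by (intro A.subringI) (auto simp: minus)
  then show ?thesis
    using assms(3) by (intro A.subfieldI') (auto simp: inv)
qed

text \<open>The outer coefficients are the values at (1, 0) and (0, 1); the value at (1, 1) then
  determines the middle one.\<close>

lemma eval_form_eqD:
  assumes "\<And>x y. eval_form (a', b', c') x y = u * eval_form (a, b, c) (p * x + q * y) (r * x + s * y)"
  shows "a' = u * (a * p\<^sup>2 + b * p * r + c * r\<^sup>2)"
    and "b' = u * (2 * a * p * q + b * (p * s + q * r) + 2 * c * r * s)"
    and "c' = u * (a * q\<^sup>2 + b * q * s + c * s\<^sup>2)"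
proof -
  show a: "a' = u * (a * p\<^sup>2 + b * p * r + c * r\<^sup>2)"
    using assms[of 1 0] by simp
  show c: "c' = u * (a * q\<^sup>2 + b * q * s + c * s\<^sup>2)"
    using assms[of 0 1] by simp
  have "b' = u * eval_form (a, b, c) (p + q) (r + s) - a' - c'"
    using assms[of 1 1] by (simp add: algebra_simps)
  then show "b' = u * (2 * a * p * q + b * (p * s + q * r) + 2 * c * r * s)"
    unfolding a c by (simp add: algebra_simps power2_eq_square)
qed

locale quadratic_setting = class_number_one K for K :: "'a :: field_char_0 set" +
  fixes L :: "'a set" and D w :: 'a
  assumes fundamental: "fundamental K D"
    and w_square: "w\<^sup>2 = D"
    and L_eq: "L = generate_field ambient (insert w K)"
    and quadratic: "quadratic_extension K L"
begin

sublocale L: ambient_subfield L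
  by (rule ambient_subfield.intro) (use quadratic in \<open>simp add: quadratic_extension_def\<close>)

lemma K_subset_L: "x \<in> K \<Longrightarrow> x \<in> L"
  using quadratic by (auto simp: quadratic_extension_def)

lemma w_in_L: "w \<in> L"
  unfolding L_eq by (rule generate_field.incl) simp

lemma L_minimal: "subfield E ambient \<Longrightarrow> insert w K \<subseteq> E \<Longrightarrow> L \<subseteq> E"
  unfolding L_eq by (rule field.generate_field_min_subfield1[OF field_from_type_algebra]) auto

text \<open>Otherwise \<open>L\<close> would equal \<open>K\<close> and have dimension both 1 and 2
  over \<open>K\<close>.\<close>

lemma w_notin_K: "w \<notin> K"
proof
  assume "w \<in> K"
  then have "L = K"
    using L_minimal[OF subfield] K_subset_L by auto
  moreover have "ring.dimension ambient 1 K K"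
    by (rule ring.dimension_one[OF ring_from_type_algebra subfield])
  ultimately show False
    using quadratic ring.dimension_is_inj[OF ring_from_type_algebra subfield, of 1 K 2]
    by (simp add: quadratic_extension_def)
qed

lemma D_in_ints: "D \<in> ints K"
  using fundamental by (simp add: fundamental_def)

lemma D_in_K: "D \<in> K"
  using D_in_ints by (rule ints_in_F)

lemma w_nonzero: "w \<noteq> 0"
  using w_notin_K F_0 by auto

lemma D_nonzero: "D \<noteq> 0"
  using w_square w_nonzero by auto

lemma ww: "w * w = D" "w * (w * x) = D * x"
  using w_square by (auto simp: power2_eq_square mult.assoc[symmetric])

lemma coords_unique:
  assumes "x \<in> K" "y \<in> K" "x' \<in> K" "y' \<in> K" "x + y * w = x' + y' * w"
  shows "x = x'" "y = y'"
proof -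
  have eq: "(y - y') * w = x' - x"
    using assms(5) by (simp add: algebra_simps)
  show "y = y'"
  proof (rule ccontr)
    assume "y \<noteq> y'"
    then have "w = (x' - x) / (y - y')"
      using eq by (simp add: field_simps)
    then show False
      using w_notin_K assms by (simp add: F_closed)
  qed
  then show "x = x'"
    using eq by simp
qed

lemma norm_nonzero:
  assumes "x \<in> K" "y \<in> K" "x + y * w \<noteq> 0"
  shows "x\<^sup>2 - y\<^sup>2 * D \<noteq> 0"
proof
  assume eq: "x\<^sup>2 - y\<^sup>2 * D = 0"
  have "(x + y * w) * (x - y * w) = x\<^sup>2 - y\<^sup>2 * D"
    by (simp add: algebra_simps power2_eq_square ww)
  then have "x + (- y) * w = 0 + 0 * w"
    using assms(3) eq by simp
  then have "x = 0" "- y = 0"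
    using coords_unique[of x "- y" 0 0] assms by (auto simp: F_closed)
  with assms(3) show False
    by simp
qed

text \<open>The elements \<open>x + y * w\<close> form a field, because the norm
  \<open>x\<^sup>2 - y\<^sup>2 * D\<close> of a nonzero one does not vanish; minimality of the
  generated field gives the rest.\<close>

lemma L_iff: "z \<in> L \<longleftrightarrow> (\<exists>x\<in>K. \<exists>y\<in>K. z = x + y * w)"
proof
  let ?E = "{x + y * w | x y. x \<in> K \<and> y \<in> K}"
  have E: "x + y * w \<in> ?E" if "x \<in> K" "y \<in> K" for x y
    using that by blast
  have "subfield ?E ambient"
  proof (rule subfield_ambientI)
    show "1 \<in> ?E"
      using E[OF F_1 F_0] by simp
  next
    fix z assume "z \<in> ?E"
    then obtain x y where z: "x \<in> K" "y \<in> K" "z = x + y * w" by blast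
    then show "- z \<in> ?E"
      using E[of "- x" "- y"] F_minus by simp
    show "inverse z \<in> ?E"
    proof (cases "z = 0")
      case True
      then show ?thesis
        using E[OF F_0 F_0] by simp
    next
      case False
      define n where "n = x\<^sup>2 - y\<^sup>2 * D"
      have n: "n \<noteq> 0"
        unfolding n_def using norm_nonzero z False by simp
      have nK: "n \<in> K"
        using z D_in_K by (simp add: n_def F_closed)
      have "(x / n + (- y / n) * w) * z = (x - y * w) * z / n"
        by (simp add: diff_divide_distrib algebra_simps)
      also have "(x - y * w) * z = n"
        by (simp add: z(3) n_def algebra_simps power2_eq_square ww)
      also have "n / n = 1"
        using n by simp
      finally have "inverse z = x / n + (- y / n) * w"
        by (metis inverse_unique mult.commute)
      then show ?thesis
        using E[of "x / n" "- y / n"] z nK by (simp add: F_closed)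
    qed
  next
    fix z z' assume "z \<in> ?E" "z' \<in> ?E"
    then obtain x y x' y' where z: "x \<in> K" "y \<in> K" "z = x + y * w"
      and z': "x' \<in> K" "y' \<in> K" "z' = x' + y' * w" by blast
    show "z + z' \<in> ?E"
      using E[of "x + x'" "y + y'"] z z' by (simp add: F_closed algebra_simps)
    have "z * z' = (x * x' + y * y' * D) + (x * y' + y * x') * w"
      by (simp add: z(3) z'(3) algebra_simps ww)
    then show "z * z' \<in> ?E"
      using E[of "x * x' + y * y' * D" "x * y' + y * x'"] z z' D_in_K by (simp add: F_closed)
  qed
  moreover have "insert w K \<subseteq> ?E"
    using E[OF F_0 F_1] E[OF _ F_0] by auto
  ultimately have "L \<subseteq> ?E"
    by (rule L_minimal)
  then show "z \<in> L \<Longrightarrow> \<exists>x\<in>K. \<exists>y\<in>K. z = x + y * w"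
    by blast
qed (auto intro!: L.F_add L.F_mult w_in_L dest: K_subset_L)

lemma L_cases:
  assumes "z \<in> L"
  obtains x y where "x \<in> K" "y \<in> K" "z = x + y * w"
  using assms unfolding L_iff by blast

section \<open>Conjugation, norm and trace\<close>

definition cj :: "'a \<Rightarrow> 'a" where
  "cj = (\<lambda>z\<in>L. THE c. \<exists>x\<in>K. \<exists>y\<in>K. z = x + y * w \<and> c = x - y * w)"

lemma cj_coords: "x \<in> K \<Longrightarrow> y \<in> K \<Longrightarrow> cj (x + y * w) = x - y * w"
proof -
  assume xy: "x \<in> K" "y \<in> K"
  then have "x + y * w \<in> L"
    using L_iff by blast
  moreover have "(THE c. \<exists>x'\<in>K. \<exists>y'\<in>K. x + y * w = x' + y' * w \<and> c = x' - y' * w) = x - y * w"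
  proof (rule the_equality)
    show "\<exists>x'\<in>K. \<exists>y'\<in>K. x + y * w = x' + y' * w \<and> x - y * w = x' - y' * w"
      using xy by blast
    fix c assume "\<exists>x'\<in>K. \<exists>y'\<in>K. x + y * w = x' + y' * w \<and> c = x' - y' * w"
    then obtain x' y' where "x' \<in> K" "y' \<in> K" "x + y * w = x' + y' * w" "c = x' - y' * w"
      by blast
    then show "c = x - y * w"
      using coords_unique[OF xy] by metis
  qed
  ultimately show ?thesis
    by (simp add: cj_def)
qed

lemma cj_closed: "z \<in> L \<Longrightarrow> cj z \<in> L"
  by (erule L_cases) (auto simp: cj_coords intro!: L.F_diff L.F_mult w_in_L dest: K_subset_L)

lemma cj_cj: "z \<in> L \<Longrightarrow> cj (cj z) = z"
  using cj_coords[of _ "- _"] by (elim L_cases) (simp add: cj_coords F_closed)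

lemma cj_add: "z \<in> L \<Longrightarrow> z' \<in> L \<Longrightarrow> cj (z + z') = cj z + cj z'"
proof (elim L_cases)
  fix x y x' y' assume *: "x \<in> K" "y \<in> K" "z = x + y * w" "x' \<in> K" "y' \<in> K" "z' = x' + y' * w"
  then have "z + z' = (x + x') + (y + y') * w"
    by (simp add: algebra_simps)
  then have c: "cj (z + z') = (x + x') - (y + y') * w"
    using * by (simp only: cj_coords F_add)
  have "cj z = x - y * w" "cj z' = x' - y' * w"
    using * by (simp_all add: cj_coords)
  then show ?thesis
    by (simp only: c) (simp add: algebra_simps)
qed

lemma cj_mult: "z \<in> L \<Longrightarrow> z' \<in> L \<Longrightarrow> cj (z * z') = cj z * cj z'"
proof (elim L_cases)
  fix x y x' y' assume *: "x \<in> K" "y \<in> K" "z = x + y * w" "x' \<in> K" "y' \<in> K" "z' = x' + y' * w"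
  then have "z * z' = (x * x' + y * y' * D) + (x * y' + y * x') * w"
    by (simp add: algebra_simps ww)
  then have c: "cj (z * z') = (x * x' + y * y' * D) - (x * y' + y * x') * w"
    using * D_in_K by (simp only: cj_coords F_add F_mult)
  have "cj z = x - y * w" "cj z' = x' - y' * w"
    using * by (simp_all add: cj_coords)
  then show ?thesis
    by (simp only: c) (simp add: algebra_simps ww)
qed

lemma cj_K: "x \<in> K \<Longrightarrow> cj x = x"
  using cj_coords[of x 0] by (simp add: F_0)

lemma cj_w: "cj w = - w"
  using cj_coords[of 0 1] by (simp add: F_0 F_1)

lemma cj_minus: "z \<in> L \<Longrightarrow> cj (- z) = - cj z"
  using cj_mult[of "-1" z] cj_K[of "-1"] K_subset_L[of "-1"] by (simp add: F_closed)

lemma cj_diff: "z \<in> L \<Longrightarrow> z' \<in> L \<Longrightarrow> cj (z - z') = cj z - cj z'"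
  using cj_add[of z "- z'"] cj_minus[of z'] L.F_minus by simp

lemma cj_eq_iff: "z \<in> L \<Longrightarrow> cj z = z \<longleftrightarrow> z \<in> K"
proof
  assume z: "z \<in> L" "cj z = z"
  then obtain x y where xy: "x \<in> K" "y \<in> K" "z = x + y * w"
    by (elim L_cases)
  then have "x + (- y) * w = x + y * w"
    using z(2) cj_coords[of x y] by simp
  then have "- y = y"
    using coords_unique(2)[of x "- y" x y] xy F_minus by blast
  then have "y = 0"
    by (simp add: equal_neg_zero)
  then show "z \<in> K"
    using xy by simp
qed (simp add: cj_K)

lemma cj_zero_iff: "z \<in> L \<Longrightarrow> cj z = 0 \<longleftrightarrow> z = 0"
  using cj_cj[of z] cj_K[OF F_0] by auto

lemma cj_inverse: "z \<in> L \<Longrightarrow> cj (inverse z) = inverse (cj z)"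
proof (cases "z = 0")
  case False
  assume "z \<in> L"
  then have "cj z * cj (inverse z) = 1"
    using cj_mult[of z "inverse z"] L.F_inverse[of z] False cj_K[OF F_1] by simp
  then show ?thesis
    by (simp add: inverse_unique)
qed (simp add: cj_K F_0)

lemma cj_divide: "z \<in> L \<Longrightarrow> z' \<in> L \<Longrightarrow> cj (z / z') = cj z / cj z'"
  by (simp add: divide_inverse cj_mult cj_inverse L.F_inverse)

lemma norm_in_K: "z \<in> L \<Longrightarrow> z * cj z \<in> K"
  using cj_eq_iff[of "z * cj z"] by (simp add: cj_mult cj_cj cj_closed L.F_mult mult.commute)

lemma trace_in_K: "z \<in> L \<Longrightarrow> z + cj z \<in> K"
  using cj_eq_iff[of "z + cj z"] by (simp add: cj_add cj_cj cj_closed L.F_add add.commute)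

lemma cj_sum: "(\<And>i. i \<in> A \<Longrightarrow> f i \<in> L) \<Longrightarrow> cj (\<Sum>i\<in>A. f i) = (\<Sum>i\<in>A. cj (f i))"
  by (induction A rule: infinite_finite_induct) (auto simp: cj_add L.F_sum cj_K F_0)

lemma cj_power: "z \<in> L \<Longrightarrow> cj (z ^ n) = cj z ^ n"
  by (induction n) (auto simp: cj_mult L.F_power cj_K F_1)

text \<open>Any automorphism over \<open>K\<close> sends \<open>w\<close> to a square root of
  \<open>D\<close>, and a nontrivial one must choose \<open>- w\<close>. The restriction of
  \<open>cj\<close> to \<open>L\<close> makes this an equality of functions, since the description
  asks for an extensional map.\<close>

lemma conjugation_eq: "conjugation K L = cj"
  unfolding conjugation_def
proof (rule the_equality)
  have "bij_betw cj L L"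
    by (rule bij_betwI[of _ _ _ cj]) (auto simp: cj_closed cj_cj)
  then show "cj \<in> ring_iso (ambient\<lparr>carrier := L\<rparr>) (ambient\<lparr>carrier := L\<rparr>) \<inter> extensional L \<and>
      (\<forall>x\<in>K. cj x = x) \<and> (\<exists>x\<in>L. cj x \<noteq> x)"
    using w_in_L w_notin_K cj_eq_iff[OF w_in_L]
    by (auto simp: ring_iso_def Ring.ring_hom_def cj_closed cj_add cj_mult cj_K F_1)
      (auto simp: cj_def)
next
  fix \<tau>
  assume \<tau>: "\<tau> \<in> ring_iso (ambient\<lparr>carrier := L\<rparr>) (ambient\<lparr>carrier := L\<rparr>) \<inter> extensional L \<and>
      (\<forall>x\<in>K. \<tau> x = x) \<and> (\<exists>x\<in>L. \<tau> x \<noteq> x)"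
  then have add: "\<tau> (x + y) = \<tau> x + \<tau> y" and mult: "\<tau> (x * y) = \<tau> x * \<tau> y"
    if "x \<in> L" "y \<in> L" for x y
    using that by (auto simp: ring_iso_def Ring.ring_hom_def)
  have \<tau>K: "\<tau> x = x" if "x \<in> K" for x
    using \<tau> that by blast
  have coords: "\<tau> (x + y * w) = x + y * \<tau> w" if "x \<in> K" "y \<in> K" for x y
    using that by (simp add: add mult \<tau>K K_subset_L L.F_mult w_in_L)
  have "\<tau> w * \<tau> w = D"
    using mult[OF w_in_L w_in_L] \<tau>K[OF D_in_K] by (simp add: ww)
  then have "\<tau> w = w \<or> \<tau> w = - w"
    using w_square by (metis power2_eq_iff power2_eq_square)
  moreover have "\<tau> w \<noteq> w"
    using \<tau> coords by (metis L_cases)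
  ultimately have "\<tau> (x + y * w) = cj (x + y * w)" if "x \<in> K" "y \<in> K" for x y
    using that by (simp add: coords cj_coords)
  then have "\<tau> z = cj z" if "z \<in> L" for z
    using that by (elim L_cases) simp
  then show "\<tau> = cj"
    using \<tau> by (intro extensionalityI[of _ L]) (auto simp: cj_def)
qed

lemma ints_K_subset_L: "x \<in> ints K \<Longrightarrow> x \<in> ints L"
  by (simp add: ints_iff K_subset_L)

text \<open>The monic integral equation of \<open>z\<close> is also satisfied by its
  conjugate.\<close>

lemma cj_ints: "z \<in> ints L \<Longrightarrow> cj z \<in> ints L"
proof -
  assume z: "z \<in> ints L"
  then have zL: "z \<in> L"
    by (rule L.ints_in_F)
  obtain n c where n: "0 < n" "z ^ n = (\<Sum>i<n. of_int (c i) * z ^ i)"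
    using algebraic_int_power_eq z by (auto simp: ints_iff)
  have "cj z ^ n = cj (\<Sum>i<n. of_int (c i) * z ^ i)"
    using zL by (simp add: cj_power flip: n(2))
  also have "\<dots> = (\<Sum>i<n. cj (of_int (c i) * z ^ i))"
    using zL by (intro cj_sum L.F_mult L.F_of_int L.F_power)
  also have "\<dots> = (\<Sum>i<n. of_int (c i) * cj z ^ i)"
    using zL by (intro sum.cong) (auto simp: cj_mult cj_power cj_K L.F_closed F_of_int)
  finally show ?thesis
    using algebraic_int_if_power_eq[OF n(1)] zL by (simp add: ints_iff cj_closed)
qed

lemma norm_ints: "z \<in> ints L \<Longrightarrow> z * cj z \<in> ints K"
  using L.ints_mult[of z "cj z"] cj_ints norm_in_K by (auto simp: ints_iff)

lemma trace_ints: "z \<in> ints L \<Longrightarrow> z + cj z \<in> ints K"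
  using L.ints_add[of z "cj z"] cj_ints trace_in_K by (auto simp: ints_iff)

lemma w_ints: "w \<in> ints L"
proof -
  have "algebraic_int w"
    by (rule algebraic_int_monic_quadratic[of 0 D]) (use D_in_ints in \<open>auto simp: w_square ints_iff\<close>)
  then show ?thesis
    by (simp add: ints_iff w_in_L)
qed

section \<open>The ring of integers of the extension\<close>

text \<open>Congruence of squares modulo 4 forces congruence modulo 2, whatever the splitting of 2:
  \<open>h = (U - V) / 2\<close> satisfies
  \<open>h\<^sup>2 = - V * h + (U\<^sup>2 - V\<^sup>2) / 4\<close>.\<close>

lemma half_diff_ints:
  assumes "U \<in> ints K" "V \<in> ints K" "(U\<^sup>2 - V\<^sup>2) / 4 \<in> ints K"
  shows "(U - V) / 2 \<in> ints K"
proof -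
  have "((U - V) / 2)\<^sup>2 = (- V) * ((U - V) / 2) + (U\<^sup>2 - V\<^sup>2) / 4"
    by (simp add: field_simps power2_eq_square)
  then have "algebraic_int ((U - V) / 2)"
    using assms(2,3)
    by (intro algebraic_int_monic_quadratic[of "- V" "(U\<^sup>2 - V\<^sup>2) / 4" "(U - V) / 2"])
      (simp_all add: ints_iff)
  then show ?thesis
    using assms by (simp add: ints_iff F_closed)
qed

lemma half_sum_ints:
  assumes "U \<in> ints K" "V \<in> ints K" "(U\<^sup>2 - V\<^sup>2) / 4 \<in> ints K"
  shows "(U + V) / 2 \<in> ints K"
  using half_diff_ints[of U "- V"] assms ints_minus by simp

lemma square_mod_4_iff: "square_mod_4 K d \<longleftrightarrow> (\<exists>t\<in>ints K. (d - t\<^sup>2) / 4 \<in> ints K)"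
proof -
  have "(\<exists>c\<in>ints K. x = 4 * c) \<longleftrightarrow> x / 4 \<in> ints K" for x :: 'a
    by (auto intro!: bexI[of _ "x / 4"])
  then show ?thesis
    by (simp add: square_mod_4_def divides_iff)
qed

text \<open>Both alternatives in the definition of \<open>fundamental\<close> rule out a nonunit
  \<open>p\<close> here. Beyond integrality of \<open>D\<close> and its being a square modulo 4,
  fundamentality is used only in this form.\<close>

lemma fundamental_unit:
  assumes "p \<in> ints K" "p \<noteq> 0" "D / p\<^sup>2 \<in> ints K" "square_mod_4 K (D / p\<^sup>2)"
  shows "p \<in> Units (int_ring K)"
proof -
  have "p\<^sup>2 divides\<^bsub>int_ring K\<^esub> D"
    using assms(2,3) by (auto simp: divides_iff intro!: bexI[of _ "D / p\<^sup>2"])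
  then show ?thesis
    using fundamental assms(1,4) unfolding fundamental_def by blast
qed

lemma ex_square_root_mod_4: "\<exists>t\<in>ints K. (D - t\<^sup>2) / 4 \<in> ints K"
  using fundamental square_mod_4_iff by (simp add: fundamental_def)

definition tt :: 'a where
  "tt = (SOME t. t \<in> ints K \<and> (D - t\<^sup>2) / 4 \<in> ints K)"

text \<open>A root of the monic polynomial \<open>X^2 - tt X - (D - tt^2) / 4\<close>, whose
  discriminant is \<open>D\<close>.\<close>

definition om :: 'a where
  "om = (tt + w) / 2"

lemma tt: "tt \<in> ints K" "(D - tt\<^sup>2) / 4 \<in> ints K"
  using ex_square_root_mod_4 someI_ex[of "\<lambda>t. t \<in> ints K \<and> (D - t\<^sup>2) / 4 \<in> ints K"]
  by (auto simp: tt_def)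

lemma om_in_L: "om \<in> L"
  using ints_in_F[OF tt(1)] by (simp add: om_def L.F_closed w_in_L K_subset_L)

lemma om_ints: "om \<in> ints L"
proof -
  have "om\<^sup>2 = tt * om + (D - tt\<^sup>2) / 4"
    by (simp add: om_def field_simps power2_eq_square ww)
  then have "algebraic_int om"
    using tt by (intro algebraic_int_monic_quadratic[of tt "(D - tt\<^sup>2) / 4" om]) (simp_all add: ints_iff)
  then show ?thesis
    using om_in_L by (simp add: ints_iff)
qed

lemma cj_om: "om - cj om = w"
proof -
  have "cj om = (tt - w) / 2"
    using ints_in_F[OF tt(1)]
    by (simp add: om_def cj_divide cj_add cj_K cj_w L.F_closed w_in_L K_subset_L F_closed)
  then show ?thesis
    by (simp add: om_def field_simps)
qed

text \<open>
  If \<open>l = m / n\<close> with \<open>a m + b n = 1\<close>, then \<open>D / n\<^sup>2\<close> is congruent to \<open>(a k + b tt)\<^sup>2\<close>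
  modulo 4, so that \<open>n\<close> is a unit because \<open>D\<close> is fundamental.
\<close>

lemma w_coord_ints:
  assumes k: "k \<in> ints K" and l: "l \<in> K" and kl: "(k\<^sup>2 - l\<^sup>2 * D) / 4 \<in> ints K"
  shows "l \<in> ints K"
proof -
  obtain m n a b where mn: "m \<in> ints K" "n \<in> ints K" "n \<noteq> 0" "a \<in> ints K" "b \<in> ints K"
    "l = m / n" "a * m + b * n = 1"
    using ex_coprime_fraction[OF l] .
  note in_K = mn(1,2,4,5)[THEN ints_in_F] k[THEN ints_in_F] l tt[THEN ints_in_F] D_in_K
  have "l\<^sup>2 * D = k\<^sup>2 - 4 * ((k\<^sup>2 - l\<^sup>2 * D) / 4)"
    by (simp add: field_simps)
  then have lD: "l\<^sup>2 * D \<in> ints K"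
    using k kl by (metis ints_diff ints_mult ints_numeral ints_power)
  have "algebraic_int (l * w)"
    by (rule algebraic_int_monic_quadratic[of 0 "l\<^sup>2 * D"])
      (use lD in \<open>auto simp: ints_iff power_mult_distrib w_square\<close>)
  \<comment> \<open>By the Bezout relation this combination is \<open>w / n\<close>, and its square
    is \<open>D / n\<^sup>2\<close>.\<close>
  then have "algebraic_int (a * (l * w) + b * w)"
    using mn(4,5) w_ints by (auto simp: ints_iff intro!: algebraic_int_add algebraic_int_mult)
  moreover have "a * (l * w) + b * w = (a * m + b * n) * w / n"
    using mn(3) by (simp add: mn(6) field_simps)
  ultimately have "algebraic_int (w / n)"
    by (simp add: mn(7))
  then have "algebraic_int ((w / n) * (w / n))"
    by (intro algebraic_int_mult)
  then have Dn: "D / n\<^sup>2 \<in> ints K"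
    using in_K by (simp add: ww power2_eq_square ints_iff F_closed)
  \<comment> \<open>\<open>V\<close> is \<open>l * D\<close>, written so that its integrality
    follows from that of \<open>D / n\<^sup>2\<close>. It is shown to be congruent to
    \<open>k * tt\<close> modulo 2.\<close>
  define V where "V = m * (D / n)"
  have V: "V \<in> ints K"
  proof -
    have "V = m * (n * (D / n\<^sup>2))"
      using mn(3) by (simp add: V_def power2_eq_square)
    then show ?thesis
      using mn Dn ints_mult by metis
  qed
  define E where "E = (k\<^sup>2 - l\<^sup>2 * D) / 4"
  define F where "F = (D - tt\<^sup>2) / 4"
  have kE: "k\<^sup>2 = l\<^sup>2 * D + 4 * E" and tF: "tt\<^sup>2 = D - 4 * F"
    by (simp_all add: E_def F_def field_simps)
  have EF: "E \<in> ints K" "F \<in> ints K"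
    using kl tt by (simp_all add: E_def F_def)
  have "((k * tt)\<^sup>2 - V\<^sup>2) / 4 = D * E - l\<^sup>2 * D * F - 4 * E * F"
    unfolding power_mult_distrib kE tF V_def using mn(3)
    by (simp add: mn(6) field_simps power2_eq_square)
  also have "\<dots> \<in> ints K"
    by (rule ints_diff[OF ints_diff[OF ints_mult[OF D_in_ints EF(1)] ints_mult[OF lD EF(2)]]
          ints_mult[OF ints_mult[OF ints_numeral EF(1)] EF(2)]])
  finally have "(k * tt - V) / 2 \<in> ints K"
    using k tt V by (intro half_diff_ints ints_mult)
  then obtain h where h: "h \<in> ints K" "k * tt = V + 2 * h"
    by (metis add.commute diff_add_cancel mult.commute nonzero_eq_divide_eq zero_neq_numeral)
  \<comment> \<open>Expand \<open>(a * m + b * n)\<^sup>2 * (D / n\<^sup>2)\<close>. The square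
    terms agree with \<open>a\<^sup>2 * k\<^sup>2\<close> and \<open>b\<^sup>2 * tt\<^sup>2\<close>
    modulo 4; the cross term \<open>2 * a * b * V\<close> agrees with
    \<open>2 * a * b * (k * tt)\<close> because \<open>V\<close> and \<open>k * tt\<close> differ by
    an even element.\<close>
  have "D / n\<^sup>2 - (a * k + b * tt)\<^sup>2 = 4 * (b\<^sup>2 * F - a\<^sup>2 * E - a * b * h)"
  proof -
    have "D / n\<^sup>2 = (a * m + b * n)\<^sup>2 * (D / n\<^sup>2)"
      by (simp add: mn(7))
    also have "\<dots> = a\<^sup>2 * (l\<^sup>2 * D) + b\<^sup>2 * D + 2 * a * b * V"
      using mn(3) by (simp add: mn(6) V_def field_simps power2_eq_square)
    finally have 1: "D / n\<^sup>2 = a\<^sup>2 * (l\<^sup>2 * D) + b\<^sup>2 * D + 2 * a * b * V" .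
    have "(a * k + b * tt)\<^sup>2 = a\<^sup>2 * k\<^sup>2 + b\<^sup>2 * tt\<^sup>2 + 2 * a * b * (k * tt)"
      by (simp add: algebra_simps power2_eq_square)
    then show ?thesis
      unfolding 1 by (simp add: kE tF h(2) algebra_simps)
  qed
  then have "(D / n\<^sup>2 - (a * k + b * tt)\<^sup>2) / 4 = b\<^sup>2 * F - a\<^sup>2 * E - a * b * h"
    by simp
  also have "\<dots> \<in> ints K"
    using mn h EF by (intro ints_diff ints_mult ints_power)
  finally have "square_mod_4 K (D / n\<^sup>2)"
    unfolding square_mod_4_iff using mn k tt by (meson ints_add ints_mult)
  then have "n \<in> Units (int_ring K)"
    using fundamental_unit mn(2,3) Dn by blast
  then have "inverse n \<in> ints K"
    by (simp add: Units_iff)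
  then show ?thesis
    using mn(1) by (simp add: mn(6) divide_inverse ints_mult)
qed

text \<open>Trace and norm make \<open>k = 2 * x'\<close> and
  \<open>(k\<^sup>2 - l\<^sup>2 * D) / 4\<close> integral, where \<open>l = 2 * y'\<close>. Then
  \<open>l\<close> is integral, and since \<open>D\<close> is congruent to \<open>tt\<^sup>2\<close>
  modulo 4, so is \<open>(k - l * tt) / 2\<close>, the remaining coordinate.\<close>

lemma ints_L_coords:
  assumes z: "z \<in> ints L"
  obtains x y where "x \<in> ints K" "y \<in> ints K" "z = x + y * om"
proof -
  obtain x' y' where xy: "x' \<in> K" "y' \<in> K" "z = x' + y' * w"
    using L_cases L.ints_in_F[OF z] by blast
  define k where "k = 2 * x'"
  define l where "l = 2 * y'"
  have cz: "cj z = x' - y' * w"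
    using xy cj_coords by simp
  have k: "k \<in> ints K"
    using trace_ints[OF z] unfolding cz by (simp add: xy(3) k_def)
  have l: "l \<in> K"
    using xy by (simp add: l_def F_closed)
  have "z * cj z = (k\<^sup>2 - l\<^sup>2 * D) / 4"
    unfolding cz by (simp add: xy(3) k_def l_def field_simps power2_eq_square ww)
  then have kl: "(k\<^sup>2 - l\<^sup>2 * D) / 4 \<in> ints K"
    using norm_ints[OF z] by metis
  have l: "l \<in> ints K"
    using w_coord_ints[OF k l kl] .
  have "(k\<^sup>2 - (l * tt)\<^sup>2) / 4 = (k\<^sup>2 - l\<^sup>2 * D) / 4 + l\<^sup>2 * ((D - tt\<^sup>2) / 4)"
    by (simp add: field_simps)
  also have "\<dots> \<in> ints K"
    using kl l tt by (intro ints_add ints_mult ints_power)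
  finally have "(k - l * tt) / 2 \<in> ints K"
    using k l tt by (intro half_diff_ints ints_mult)
  moreover have "z = (k - l * tt) / 2 + l * om"
    by (simp add: xy(3) k_def l_def om_def field_simps)
  ultimately show ?thesis
    using l that by blast
qed

lemma L_int_multiple:
  assumes "z \<in> L"
  shows "\<exists>N\<in>ints L. N \<noteq> 0 \<and> N * z \<in> ints L"
proof -
  obtain x y where xy: "x \<in> K" "y \<in> K" "z = x + y * w"
    using L_cases[OF assms] by blast
  obtain M N :: int where MN: "M \<noteq> 0" "algebraic_int (of_int M * x)" "N \<noteq> 0" "algebraic_int (of_int N * y)"
    using ex_int_multiple_algebraic_int xy by metis
  have M: "of_int M * x \<in> ints L" and N: "of_int N * y \<in> ints L"
    using MN xy by (auto simp: ints_iff L.F_closed K_subset_L)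
  have "of_int (M * N) * z = of_int N * (of_int M * x) + of_int M * (of_int N * y) * w"
    by (simp add: xy(3) algebra_simps)
  also have "\<dots> \<in> ints L"
    by (rule L.ints_add[OF L.ints_mult[OF L.ints_of_int M]
          L.ints_mult[OF L.ints_mult[OF L.ints_of_int N] w_ints]])
  finally show ?thesis
    using MN(1,3) L.ints_of_int[of "M * N"] by (intro bexI[of _ "of_int (M * N)"]) auto
qed

lemma frac_ideal_scale:
  assumes I: "I \<in> frac_ideals L" and g: "g \<in> L" "g \<noteq> 0"
  shows "(\<lambda>x. g * x) ` I \<in> frac_ideals L"
proof -
  note f = L.frac_idealsD[OF I]
  obtain N where N: "N \<in> ints L" "N \<noteq> 0" "N * g \<in> ints L"
    using L_int_multiple[OF g(1)] by blast
  obtain d where d: "d \<in> ints L" "d \<noteq> 0" "\<forall>x\<in>I. d * x \<in> ints L"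
    using f(6) by blast
  have "N * d * (g * x) \<in> ints L" if "x \<in> I" for x
  proof -
    have "N * d * (g * x) = (N * g) * (d * x)"
      by simp
    then show ?thesis
      using N(3) d(3) that L.ints_mult by metis
  qed
  then have "\<exists>d\<in>ints L. d \<noteq> 0 \<and> (\<forall>x\<in>(\<lambda>x. g * x) ` I. d * x \<in> ints L)"
    using N d by (intro bexI[of _ "N * d"]) (auto intro: L.ints_mult)
  moreover have "x + y \<in> (\<lambda>x. g * x) ` I" if "x \<in> (\<lambda>x. g * x) ` I" "y \<in> (\<lambda>x. g * x) ` I" for x y
    using that f(4) by (auto simp: distrib_left[symmetric])
  moreover have "r * x \<in> (\<lambda>x. g * x) ` I" if "r \<in> ints L" "x \<in> (\<lambda>x. g * x) ` I" for r x
    using that f(5) by (auto simp: mult.left_commute[of r g])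
  moreover have "(\<lambda>x. g * x) ` I \<subseteq> L"
    using f(1) g(1) L.F_mult by auto
  moreover have "0 \<in> (\<lambda>x. g * x) ` I"
    using f(2) by force
  moreover have "(\<lambda>x. g * x) ` I \<noteq> {0}"
  proof -
    obtain x where "x \<in> I" "x \<noteq> 0"
      using f(2,3) by blast
    then have "g * x \<in> (\<lambda>x. g * x) ` I" "g * x \<noteq> 0"
      using g(2) by auto
    then show ?thesis
      by blast
  qed
  ultimately show ?thesis
    unfolding frac_ideals_def by simp
qed

section \<open>Lattices spanned by two elements\<close>

lemma lattice_spanI: "x \<in> ints K \<Longrightarrow> y \<in> ints K \<Longrightarrow> x * \<alpha> + y * \<beta> \<in> lattice_span K \<alpha> \<beta>"
  unfolding lattice_span_def by blast

lemma lattice_span_gens: "\<alpha> \<in> lattice_span K \<alpha> \<beta>" "\<beta> \<in> lattice_span K \<alpha> \<beta>"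
  using lattice_spanI[OF ints_1 ints_0] lattice_spanI[OF ints_0 ints_1] by simp_all

lemma lattice_span_add:
  assumes "x \<in> lattice_span K \<alpha> \<beta>" "y \<in> lattice_span K \<alpha> \<beta>"
  shows "x + y \<in> lattice_span K \<alpha> \<beta>"
proof -
  obtain a b c d where "a \<in> ints K" "b \<in> ints K" "c \<in> ints K" "d \<in> ints K"
    "x = a * \<alpha> + b * \<beta>" "y = c * \<alpha> + d * \<beta>"
    using assms unfolding lattice_span_def by blast
  then show ?thesis
    using lattice_spanI[of "a + c" "b + d" \<alpha> \<beta>] by (simp add: ints_add algebra_simps)
qed

lemma lattice_span_mult:
  assumes "x \<in> lattice_span K \<alpha> \<beta>" "r \<in> ints K"
  shows "r * x \<in> lattice_span K \<alpha> \<beta>"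
proof -
  obtain a b where "a \<in> ints K" "b \<in> ints K" "x = a * \<alpha> + b * \<beta>"
    using assms unfolding lattice_span_def by blast
  then show ?thesis
    using lattice_spanI[of "r * a" "r * b" \<alpha> \<beta>] assms(2) by (simp add: ints_mult algebra_simps)
qed

lemma lattice_span_scale: "(\<lambda>x. g * x) ` lattice_span K \<alpha> \<beta> = lattice_span K (g * \<alpha>) (g * \<beta>)"
proof -
  have "g * (x * \<alpha> + y * \<beta>) = x * (g * \<alpha>) + y * (g * \<beta>)" for x y
    by (simp add: algebra_simps)
  then show ?thesis
    unfolding lattice_span_def by (auto simp: image_iff) metis+
qed

text \<open>As 1 and \<open>om\<close> span the integers of \<open>L\<close>, stability under all of
  them reduces to two memberships.\<close>

lemma lattice_frac_ideal:
  assumes ab: "\<alpha> \<in> L" "\<beta> \<in> L" "\<alpha> \<noteq> 0"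
    and om: "om * \<alpha> \<in> lattice_span K \<alpha> \<beta>" "om * \<beta> \<in> lattice_span K \<alpha> \<beta>"
  shows "lattice_span K \<alpha> \<beta> \<in> frac_ideals L"
proof -
  let ?I = "lattice_span K \<alpha> \<beta>"
  have om': "om * x \<in> ?I" if x: "x \<in> ?I" for x
  proof -
    obtain a b where "a \<in> ints K" "b \<in> ints K" "x = a * \<alpha> + b * \<beta>"
      using x unfolding lattice_span_def by blast
    moreover have "om * (a * \<alpha> + b * \<beta>) = a * (om * \<alpha>) + b * (om * \<beta>)"
      by (simp add: algebra_simps)
    ultimately show ?thesis
      using om by (metis lattice_span_add lattice_span_mult)
  qed
  have mult: "r * x \<in> ?I" if r: "r \<in> ints L" and x: "x \<in> ?I" for r x
  proof -
    obtain a b where ab: "a \<in> ints K" "b \<in> ints K" "r = a + b * om"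
      using ints_L_coords[OF r] .
    then have "r * x = a * x + b * (om * x)"
      by (simp add: algebra_simps)
    then show ?thesis
      using ab x om' by (metis lattice_span_add lattice_span_mult)
  qed
  obtain M N where M: "M \<in> ints L" "M \<noteq> 0" "M * \<alpha> \<in> ints L"
    and N: "N \<in> ints L" "N \<noteq> 0" "N * \<beta> \<in> ints L"
    using L_int_multiple ab by meson
  have "M * N * x \<in> ints L" if x: "x \<in> ?I" for x
  proof -
    obtain a b where "a \<in> ints K" "b \<in> ints K" "x = a * \<alpha> + b * \<beta>"
      using x unfolding lattice_span_def by blast
    moreover have "M * N * (a * \<alpha> + b * \<beta>) = a * N * (M * \<alpha>) + b * M * (N * \<beta>)"
      by (simp add: algebra_simps)
    ultimately show ?thesis
      using M N by (metis L.ints_add L.ints_mult ints_K_subset_L)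
  qed
  moreover have "M * N \<in> ints L" "M * N \<noteq> 0"
    using M N L.ints_mult by auto
  moreover have "0 \<in> ?I"
    using lattice_spanI[OF ints_0 ints_0, of \<alpha> \<beta>] by simp
  moreover have "?I \<noteq> {0}"
    using lattice_span_gens(1)[of \<alpha> \<beta>] ab(3) by auto
  moreover have "?I \<subseteq> L"
    using ab by (auto simp: lattice_span_def intro!: L.F_add L.F_mult dest!: ints_in_F dest: K_subset_L)
  ultimately show ?thesis
    unfolding frac_ideals_def using lattice_span_add mult by blast
qed

section \<open>Bases of fractional ideals and their forms\<close>

text \<open>A Hermite normal form: \<open>J\<close> collects the w-coordinates of \<open>I\<close>,
  and \<open>A\<close> is the part of \<open>I\<close> inside \<open>K\<close>. Both are fractional
  ideals of \<open>K\<close>, hence principal. A generator of \<open>A\<close> together with an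
  element of \<open>I\<close> whose w-coordinate generates \<open>J\<close> is a basis.\<close>

lemma frac_ideal_basis:
  assumes I: "I \<in> frac_ideals L"
  obtains \<alpha> \<beta> where "\<alpha> \<in> L" "\<beta> \<in> L" "I = lattice_span K \<alpha> \<beta>"
proof -
  note f = L.frac_idealsD[OF I]
  obtain d where d: "d \<in> ints L" "d \<noteq> 0" "\<And>x. x \<in> I \<Longrightarrow> d * x \<in> ints L"
    using f(6) by blast
  have dL: "d \<in> L"
    using d(1) by (rule L.ints_in_F)
  \<comment> \<open>The norm replaces the denominator \<open>d\<close> by one that lies in
    \<open>K\<close>.\<close>
  define n where "n = d * cj d"
  have n: "n \<in> ints K" "n \<noteq> 0"
    using norm_ints[OF d(1)] d(2) cj_zero_iff[OF dL] by (auto simp: n_def)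
  have nI: "n * x \<in> ints L" if "x \<in> I" for x
    using L.ints_mult[OF cj_ints[OF d(1)] d(3)[OF that]] by (simp add: n_def mult_ac)
  obtain z where z: "z \<in> I" "z \<noteq> 0"
    using f(2,3) by blast
  have zL: "z \<in> L"
    using z f(1) by blast
  define J where "J = {y \<in> K. \<exists>x\<in>K. x + y * w \<in> I}"
  define A where "A = I \<inter> K"
  have "J \<in> frac_ideals K"
  proof -
    have "0 \<in> J"
      using f(2) F_0 by (auto simp: J_def intro!: bexI[of _ 0])
    \<comment> \<open>The w-coordinates of \<open>z\<close> and \<open>w * z\<close> are
      \<open>y\<close> and \<open>x\<close>, which do not both vanish.\<close>
    moreover have "J \<noteq> {0}"
    proof -
      obtain x y where xy: "x \<in> K" "y \<in> K" "z = x + y * w"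
        using L_cases[OF zL] by blast
      have "w * z \<in> I"
        using f(5)[OF w_ints z(1)] .
      moreover have "w * z = y * D + x * w"
        by (simp add: xy(3) algebra_simps ww)
      ultimately have "x \<in> J"
        using xy D_in_K F_mult by (auto simp: J_def)
      moreover have "y \<in> J"
        using xy z by (auto simp: J_def)
      moreover have "x \<noteq> 0 \<or> y \<noteq> 0"
        using xy z by auto
      ultimately show ?thesis
        by auto
    qed
    moreover have "a + b \<in> J" if ab: "a \<in> J" "b \<in> J" for a b
    proof -
      obtain x y where xy: "x \<in> K" "y \<in> K" "x + a * w \<in> I" "y + b * w \<in> I" "a \<in> K" "b \<in> K"
        using ab by (auto simp: J_def)
      then have "(x + y) + (a + b) * w \<in> I"
        using f(4)[OF xy(3,4)] by (simp add: algebra_simps)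
      then show ?thesis
        using xy F_add by (auto simp: J_def)
    qed
    moreover have "r * a \<in> J" if ra: "r \<in> ints K" "a \<in> J" for r a
    proof -
      obtain x where x: "x \<in> K" "x + a * w \<in> I" "a \<in> K"
        using ra by (auto simp: J_def)
      then have "r * x + (r * a) * w \<in> I"
        using f(5)[OF ints_K_subset_L[OF ra(1)] x(2)] by (simp add: algebra_simps)
      then show ?thesis
        using x ra ints_in_F F_mult by (auto simp: J_def)
    qed
    moreover have "2 * n * D * y \<in> ints K" if y: "y \<in> J" for y
    proof -
      obtain x where x: "x \<in> K" "x + y * w \<in> I" "y \<in> K"
        using y by (auto simp: J_def)
      have nK: "n \<in> K"
        using n ints_in_F by blast
      have m: "n * (x + y * w) \<in> ints L"
        using nI x by blast
      have c: "cj (n * (x + y * w)) = n * (x - y * w)"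
        using x nK f(1) by (subst cj_mult) (auto simp: cj_coords cj_K K_subset_L)
      \<comment> \<open>The difference with the conjugate isolates the w-coordinate, and the further
        factor \<open>w\<close> turns it into an element of \<open>K\<close>.\<close>
      have "(n * (x + y * w) - cj (n * (x + y * w))) * w = 2 * n * D * y"
        unfolding c by (simp add: algebra_simps ww)
      then have "2 * n * D * y \<in> ints L"
        using m by (metis L.ints_diff L.ints_mult cj_ints w_ints)
      then show ?thesis
        using x nK D_in_K by (simp add: ints_iff F_closed)
    qed
    moreover have "2 * n * D \<in> ints K" "2 * n * D \<noteq> 0"
      using n D_in_ints D_nonzero by (auto simp: ints_closed)
    moreover have "J \<subseteq> K"
      by (auto simp: J_def)
    ultimately show ?thesis
      by (intro frac_idealsI[of J "2 * n * D"])
  qed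
  then obtain g where g: "J = principal_ideal K g"
    using frac_ideal_principal by blast
  have "A \<in> frac_ideals K"
  proof -
    \<comment> \<open>A nonzero element of \<open>A\<close>: the norm of \<open>d * z\<close> is an
      integral multiple of \<open>z\<close> and lies in \<open>K\<close>.\<close>
    have "cj (d * z) * d * z \<in> I"
      using f(5)[OF L.ints_mult[OF cj_ints[OF d(3)[OF z(1)]] d(1)] z(1)] .
    moreover have "cj (d * z) * d * z = (d * z) * cj (d * z)"
      by (simp add: mult_ac)
    moreover have "(d * z) * cj (d * z) \<in> K"
      using norm_in_K dL zL L.F_mult by blast
    moreover have "(d * z) * cj (d * z) \<noteq> 0"
      using d(2) z(2) cj_zero_iff[OF L.F_mult[OF dL zL]] by simp
    ultimately have "A \<noteq> {0}"
      unfolding A_def by (metis IntI singletonD)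
    moreover have "n * a \<in> ints K" if "a \<in> A" for a
      using nI[of a] that n ints_in_F by (auto simp: A_def ints_iff F_closed)
    moreover have "x + y \<in> A" if "x \<in> A" "y \<in> A" for x y
      using f(4) that F_add by (auto simp: A_def)
    moreover have "r * x \<in> A" if "r \<in> ints K" "x \<in> A" for r x
      using f(5) that ints_in_F F_mult ints_K_subset_L by (auto simp: A_def)
    moreover have "A \<subseteq> K" "0 \<in> A"
      using f(2) F_0 by (auto simp: A_def)
    ultimately show ?thesis
      using n by (intro frac_idealsI[of A n])
  qed
  then obtain h where h: "A = principal_ideal K h"
    using frac_ideal_principal by blast
  have gJ: "g \<in> J" and hA: "h \<in> A"
    unfolding g h principal_ideal_def using ints_1 by force+
  then obtain x0 where x0: "x0 \<in> K" "g \<in> K" "x0 + g * w \<in> I"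
    by (auto simp: J_def)
  have "I = lattice_span K h (x0 + g * w)"
  proof
    show "lattice_span K h (x0 + g * w) \<subseteq> I"
      using hA x0 f(4,5) ints_K_subset_L by (auto simp: lattice_span_def A_def)
    show "I \<subseteq> lattice_span K h (x0 + g * w)"
    proof
      fix v assume v: "v \<in> I"
      then obtain x y where xy: "x \<in> K" "y \<in> K" "v = x + y * w"
        using f(1) L_cases by blast
      then have "y \<in> J"
        using v by (auto simp: J_def)
      then obtain r where r: "r \<in> ints K" "y = g * r"
        unfolding g principal_ideal_def by blast
      have "v + (- r) * (x0 + g * w) \<in> I"
        using f(4)[OF v f(5)[OF ints_K_subset_L[OF ints_minus[OF r(1)]] x0(3)]] .
      moreover have "v + (- r) * (x0 + g * w) = x - r * x0"
        by (simp add: xy(3) r(2) algebra_simps)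
      ultimately have "x - r * x0 \<in> I"
        by simp
      then have "x - r * x0 \<in> A"
        using xy(1) x0(1) ints_in_F[OF r(1)] by (simp add: A_def F_closed)
      then obtain s where s: "s \<in> ints K" "x - r * x0 = h * s"
        unfolding h principal_ideal_def by blast
      have "v = (x - r * x0) + r * (x0 + g * w)"
        by (simp add: xy(3) r(2) algebra_simps)
      then have "v = s * h + r * (x0 + g * w)"
        by (simp add: s(2) mult.commute)
      then show "v \<in> lattice_span K h (x0 + g * w)"
        using s r by (auto intro: lattice_spanI)
    qed
  qed
  moreover have "h \<in> L" "x0 + g * w \<in> L"
    using hA x0 f(1) by (auto simp: A_def)
  ultimately show ?thesis
    using that by blast
qed

section \<open>Orientation and nondegeneracy of a basis\<close>

abbreviation bdet :: "'a \<Rightarrow> 'a \<Rightarrow> 'a" where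
  "bdet \<equiv> basis_det K L w"

lemma bdet_eq: "bdet \<alpha> \<beta> = (cj \<alpha> * \<beta> - \<alpha> * cj \<beta>) / w"
  by (simp add: basis_det_def conjugation_eq)

lemma bdet_w: "cj \<alpha> * \<beta> - \<alpha> * cj \<beta> = bdet \<alpha> \<beta> * w"
  using w_nonzero by (simp add: bdet_eq)

lemma bdet_in_K: "\<alpha> \<in> L \<Longrightarrow> \<beta> \<in> L \<Longrightarrow> bdet \<alpha> \<beta> \<in> K"
proof -
  assume ab: "\<alpha> \<in> L" "\<beta> \<in> L"
  have "bdet \<alpha> \<beta> \<in> L"
    unfolding bdet_eq using ab by (simp add: L.F_closed cj_closed w_in_L)
  moreover have "cj (bdet \<alpha> \<beta>) = bdet \<alpha> \<beta>"
    unfolding bdet_eq using ab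
    by (simp add: cj_divide cj_diff cj_mult cj_cj cj_w cj_closed L.F_closed w_in_L)
      (simp add: field_simps minus_divide_left)
  ultimately show ?thesis
    using cj_eq_iff by blast
qed

text \<open>If the determinant vanished, the lattice would lie on a single line over
  \<open>K\<close>. Being an ideal it is stable under \<open>w\<close>, which would force
  \<open>w\<close> into \<open>K\<close>.\<close>

lemma bdet_nonzero:
  assumes ab: "\<alpha> \<in> L" "\<beta> \<in> L" and I: "lattice_span K \<alpha> \<beta> \<in> frac_ideals L"
  shows "bdet \<alpha> \<beta> \<noteq> 0"
proof
  assume "bdet \<alpha> \<beta> = 0"
  then have eq: "cj \<alpha> * \<beta> = \<alpha> * cj \<beta>"
    using w_nonzero by (simp add: bdet_eq)
  note f = L.frac_idealsD[OF I]
  show False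
  proof (cases "\<alpha> = 0")
    case True
    have "\<beta> \<noteq> 0"
      using f(2,3) True unfolding lattice_span_def by auto
    moreover obtain x y where "y \<in> ints K" "w * \<beta> = x * \<alpha> + y * \<beta>"
      using f(5)[OF w_ints lattice_span_gens(2)] unfolding lattice_span_def by blast
    ultimately have "w \<in> K"
      using True ints_in_F by simp
    then show False
      using w_notin_K by simp
  next
    case False
    define k where "k = \<beta> / \<alpha>"
    have "cj k = k"
      using eq False cj_zero_iff[OF ab(1)] ab by (simp add: k_def cj_divide field_simps)
    then have k: "k \<in> K" "\<beta> = k * \<alpha>"
      using cj_eq_iff[of k] ab False by (auto simp: k_def L.F_divide)
    obtain x y where xy: "x \<in> ints K" "y \<in> ints K" "w * \<alpha> = x * \<alpha> + y * \<beta>"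
      using f(5)[OF w_ints lattice_span_gens(1)] unfolding lattice_span_def by blast
    then have "w * \<alpha> = (x + y * k) * \<alpha>"
      by (simp add: k(2) algebra_simps)
    then have "w = x + y * k"
      using False by simp
    then show False
      using w_notin_K xy k ints_in_F by (simp add: F_closed)
  qed
qed

section \<open>Totally positive units and primitive forms\<close>

lemma tp_unitsD:
  assumes "u \<in> tp_units K"
  shows "u \<in> ints K" "u \<in> K" "u \<noteq> 0" "inverse u \<in> ints K" "\<sigma> \<in> real_embeddings K \<Longrightarrow> \<sigma> u > 0"
  using assms by (auto simp: tp_units_def Units_iff totally_positive_def ints_iff)

lemma tp_units_iff: "u \<in> tp_units K \<longleftrightarrow>
    u \<in> ints K \<and> u \<noteq> 0 \<and> inverse u \<in> ints K \<and> (\<forall>\<sigma>\<in>real_embeddings K. \<sigma> u > 0)"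
  by (auto simp: tp_units_def Units_iff totally_positive_def ints_iff)

lemma tp_units_1: "1 \<in> tp_units K"
  by (simp add: tp_units_iff ints_1 real_embeddings_hom(3))

lemma tp_units_mult: "u \<in> tp_units K \<Longrightarrow> v \<in> tp_units K \<Longrightarrow> u * v \<in> tp_units K"
  by (auto simp: tp_units_iff ints_mult real_embeddings_hom ints_in_F)

lemma tp_units_inverse: "u \<in> tp_units K \<Longrightarrow> inverse u \<in> tp_units K"
  by (auto simp: tp_units_iff real_embedding_simps ints_in_F)

text \<open>A single real embedding suffices to exclude \<open>u = - v\<close>. This fixes the
  square root of the discriminant of a form.\<close>

lemma tp_units_square_unique:
  assumes "u \<in> tp_units K" "v \<in> tp_units K" "u\<^sup>2 = v\<^sup>2"
  shows "u = v"
proof -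
  obtain \<sigma> where s: "\<sigma> \<in> real_embeddings K"
    using real_embeddings_nonempty by blast
  have "u = v \<or> u = - v"
    using assms(3) by (simp add: power2_eq_iff)
  moreover have "u \<noteq> - v"
    using tp_unitsD(5)[OF assms(1) s] tp_unitsD(5)[OF assms(2) s] tp_unitsD(2)[OF assms(2)]
      real_embedding_simps(2)[OF s] by fastforce
  ultimately show ?thesis
    by blast
qed

text \<open>Primitivity is automatic. Dividing the form by a common divisor \<open>g\<close> of its
  coefficients leaves an integral form of discriminant \<open>u\<^sup>2 * D / g\<^sup>2\<close>, so
  \<open>D / g\<^sup>2\<close> is integral and a square modulo 4, and \<open>g\<close> is a
  unit.\<close>

lemma forms_iff: "(a, b, c) \<in> forms K D \<longleftrightarrow>
    a \<in> ints K \<and> b \<in> ints K \<and> c \<in> ints K \<and> (\<exists>u\<in>tp_units K. b\<^sup>2 - 4 * a * c = u\<^sup>2 * D)"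
  (is "?lhs \<longleftrightarrow> ?rhs")
proof
  assume ?lhs
  then show ?rhs
    by (auto simp: forms_def primitive_form_def disc_set_def)
next
  assume ?rhs
  then obtain u where u: "u \<in> tp_units K" "b\<^sup>2 - 4 * a * c = u\<^sup>2 * D"
    and abc: "a \<in> ints K" "b \<in> ints K" "c \<in> ints K"
    by blast
  have unit: "g \<in> Units (int_ring K)" if g: "g \<in> ints K" "g divides\<^bsub>int_ring K\<^esub> a"
    "g divides\<^bsub>int_ring K\<^esub> b" "g divides\<^bsub>int_ring K\<^esub> c" for g
  proof -
    obtain a' b' c' where g': "a' \<in> ints K" "b' \<in> ints K" "c' \<in> ints K"
      "a = g * a'" "b = g * b'" "c = g * c'"
      using g(2-4) unfolding divides_iff by blast
    \<comment> \<open>Scaling the reduced coefficients by \<open>v\<close> absorbs the unit square,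
      so that \<open>D / g\<^sup>2\<close> itself becomes a discriminant.\<close>
    define v where "v = inverse u"
    have v: "v \<in> ints K" "u * v = 1"
      using tp_unitsD[OF u(1)] by (auto simp: v_def)
    have "g\<^sup>2 * (b'\<^sup>2 - 4 * a' * c') = u\<^sup>2 * D"
      using u(2) unfolding g' by (simp add: algebra_simps power2_eq_square)
    then have "v\<^sup>2 * (g\<^sup>2 * (b'\<^sup>2 - 4 * a' * c')) = (u * v)\<^sup>2 * D"
      by (simp add: power_mult_distrib)
    then have D: "D = g\<^sup>2 * ((v * b')\<^sup>2 - 4 * ((v * a') * (v * c')))"
      unfolding v(2) by (simp add: algebra_simps power2_eq_square)
    then have g0: "g \<noteq> 0"
      using D_nonzero by auto
    have Dg: "D / g\<^sup>2 = (v * b')\<^sup>2 - 4 * ((v * a') * (v * c'))"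
      using D g0 by simp
    have "D / g\<^sup>2 \<in> ints K"
      unfolding Dg using v g' by (intro ints_diff ints_mult ints_power ints_numeral)
    moreover have "(D / g\<^sup>2 - (v * b')\<^sup>2) / 4 = - ((v * a') * (v * c'))"
      unfolding Dg by simp
    then have "square_mod_4 K (D / g\<^sup>2)"
      unfolding square_mod_4_iff using v g' by (metis ints_minus ints_mult)
    ultimately show ?thesis
      using fundamental_unit g(1) g0 by blast
  qed
  have "h divides\<^bsub>int_ring K\<^esub> 1" if "h \<in> Units (int_ring K)" for h
    using that by (auto simp: divides_iff Units_iff intro!: bexI[of _ "inverse h"])
  then have "is_gcd K 1 {a, b, c}"
    unfolding is_gcd_def using unit abc by (auto simp: divides_iff[where a = 1] ints_1)
  moreover have "1 \<in> Units (int_ring K)"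
    by (simp add: Units_iff ints_1)
  ultimately show ?lhs
    using u abc by (auto simp: forms_def primitive_form_def disc_set_def)
qed

lemma basis_to_form_eq: "basis_to_form K L w \<alpha> \<beta> =
    (\<alpha> * cj \<alpha> / bdet \<alpha> \<beta>, - (cj \<alpha> * \<beta> + \<alpha> * cj \<beta>) / bdet \<alpha> \<beta>, \<beta> * cj \<beta> / bdet \<alpha> \<beta>)"
  by (simp add: basis_to_form_def conjugation_eq)

text \<open>With conjugates \<open>A\<close> and \<open>B\<close>, \<open>(A \<beta> + \<alpha> B)^2
  - 4 \<alpha> A \<beta> B = (A \<beta> - \<alpha> B)^2\<close>, and the last difference is the
  determinant times \<open>w\<close>.\<close>

lemma disc_basis_to_form:
  assumes "bdet \<alpha> \<beta> \<noteq> 0"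
  shows "disc (basis_to_form K L w \<alpha> \<beta>) = D"
proof -
  let ?d = "bdet \<alpha> \<beta>"
  have "disc (basis_to_form K L w \<alpha> \<beta>) = (cj \<alpha> * \<beta> - \<alpha> * cj \<beta>)\<^sup>2 / ?d\<^sup>2"
    using assms by (simp add: basis_to_form_eq field_simps power2_eq_square)
  also have "\<dots> = (?d * w)\<^sup>2 / ?d\<^sup>2"
    by (simp add: bdet_w)
  also have "\<dots> = D"
    using assms by (simp add: power_mult_distrib w_square)
  finally show ?thesis .
qed

text \<open>
  If multiplication by \<open>om\<close> has matrix \<open>(p, q; r, s)\<close> in the basis \<open>\<alpha>, \<beta>\<close>, then
  the form of the basis is \<open>(q, p - s, - r)\<close>, hence integral.
\<close>

lemma basis_to_form_in_forms:
  assumes ab: "\<alpha> \<in> L" "\<beta> \<in> L" and I: "lattice_span K \<alpha> \<beta> \<in> frac_ideals L"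
  shows "basis_to_form K L w \<alpha> \<beta> \<in> forms K D"
proof -
  define A B \<delta> where "A = cj \<alpha>" and "B = cj \<beta>" and "\<delta> = bdet \<alpha> \<beta>"
  have \<delta>: "\<delta> \<noteq> 0" "A * \<beta> - \<alpha> * B = \<delta> * w"
    using bdet_nonzero[OF ab I] bdet_w by (auto simp: \<delta>_def A_def B_def)
  have nz: "\<alpha> \<noteq> 0" "\<beta> \<noteq> 0"
    using \<delta> w_nonzero cj_K[OF F_0] by (auto simp: A_def B_def)
  note f = L.frac_idealsD[OF I]
  obtain p q where pq: "p \<in> ints K" "q \<in> ints K" "om * \<alpha> = p * \<alpha> + q * \<beta>"
    using f(5)[OF om_ints lattice_span_gens(1)] unfolding lattice_span_def by blast
  obtain r s where rs: "r \<in> ints K" "s \<in> ints K" "om * \<beta> = r * \<alpha> + s * \<beta>"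
    using f(5)[OF om_ints lattice_span_gens(2)] unfolding lattice_span_def by blast
  have L: "x * y \<in> L" if "x \<in> ints K" "y \<in> L" for x y
    using that by (simp add: ints_iff L.F_mult K_subset_L)
  have cjm: "cj (x * y) = x * cj y" if "x \<in> ints K" "y \<in> L" for x y
    using that by (simp add: ints_iff cj_mult cj_K K_subset_L)
  have "cj (om * \<alpha>) = p * A + q * B"
    unfolding pq(3) using pq ab by (simp add: cj_add cjm L A_def B_def)
  then have cpq: "cj om * A = p * A + q * B"
    using om_in_L ab by (simp add: cj_mult A_def)
  have "cj (om * \<beta>) = r * A + s * B"
    unfolding rs(3) using rs ab by (simp add: cj_add cjm L A_def B_def)
  then have crs: "cj om * B = r * A + s * B"
    using om_in_L ab by (simp add: cj_mult B_def)
  \<comment> \<open>Writing \<open>w\<close> as \<open>om - cj om\<close> expresses \<open>w\<close>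
    times a norm through the matrix of \<open>om\<close> and its conjugate relations; one matrix
    entry survives, multiplied by \<open>\<delta> * w\<close>.\<close>
  have w_mult: "w * x = om * x - cj om * x" for x
    by (metis cj_om left_diff_distrib)
  have "w * (\<alpha> * A) = (om * \<alpha>) * A - \<alpha> * (cj om * A)"
    using w_mult[of "\<alpha> * A"] by (simp add: mult_ac)
  also have "\<dots> = q * (A * \<beta> - \<alpha> * B)"
    unfolding pq(3) cpq by (simp add: algebra_simps)
  finally have a: "\<alpha> * A = q * \<delta>"
    using w_nonzero \<delta>(2) by simp
  have "w * (\<beta> * B) = (om * \<beta>) * B - \<beta> * (cj om * B)"
    using w_mult[of "\<beta> * B"] by (simp add: mult_ac)
  also have "\<dots> = - r * (A * \<beta> - \<alpha> * B)"
    unfolding rs(3) crs by (simp add: algebra_simps)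
  finally have "w * (\<beta> * B) = w * (- r * \<delta>)"
    by (simp add: \<delta>(2))
  then have c: "\<beta> * B = - r * \<delta>"
    using w_nonzero by (metis mult_cancel_left)
  \<comment> \<open>Comparing both sides gives a quadratic relation between \<open>\<alpha>\<close>
    and \<open>\<beta>\<close>. After multiplication by \<open>\<delta>\<close> the outer terms
    become norms, and cancelling \<open>\<alpha> * \<beta>\<close> leaves the middle
    coefficient.\<close>
  have "(om * \<alpha>) * \<beta> = \<alpha> * (om * \<beta>)"
    by simp
  then have "q * \<beta> * \<beta> + (p - s) * \<alpha> * \<beta> - r * \<alpha> * \<alpha> = 0"
    unfolding pq(3) rs(3) by (simp add: algebra_simps)
  then have "\<delta> * (q * \<beta> * \<beta> + (p - s) * \<alpha> * \<beta> - r * \<alpha> * \<alpha>) = 0"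
    by simp
  then have "(q * \<delta>) * \<beta> * \<beta> + (p - s) * \<delta> * \<alpha> * \<beta> + (- r * \<delta>) * \<alpha> * \<alpha> = 0"
    by (simp add: algebra_simps)
  then have "\<alpha> * \<beta> * (A * \<beta> + \<alpha> * B + (p - s) * \<delta>) = 0"
    unfolding a[symmetric] c[symmetric] by (simp add: algebra_simps)
  then have b: "- (A * \<beta> + \<alpha> * B) = (p - s) * \<delta>"
    using nz by (simp add: add_eq_0_iff2)
  have eq: "basis_to_form K L w \<alpha> \<beta> = (q, p - s, - r)"
    unfolding basis_to_form_eq A_def[symmetric] B_def[symmetric] \<delta>_def[symmetric] a b c
    using \<delta>(1) by simp
  show ?thesis
    using disc_basis_to_form[of \<alpha> \<beta>] \<delta>(1) pq rs tp_units_1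
    unfolding eq forms_iff \<delta>_def by (auto intro!: ints_closed bexI[of _ 1])
qed

section \<open>Form classes and oriented ideal classes\<close>

lemma form_equivI:
  assumes "p \<in> ints K" "q \<in> ints K" "r \<in> ints K" "s \<in> ints K" "u \<in> tp_units K"
    "p * s - q * r \<in> tp_units K"
    "\<And>x y. eval_form Q' x y = u * eval_form Q (p * x + q * y) (r * x + s * y)"
  shows "form_equiv K Q' Q"
  using assms unfolding form_equiv_def by blast

lemma form_equivE:
  assumes "form_equiv K Q' Q"
  obtains p q r s u where "p \<in> ints K" "q \<in> ints K" "r \<in> ints K" "s \<in> ints K" "u \<in> tp_units K"
    "p * s - q * r \<in> tp_units K"
    "\<And>x y. eval_form Q' x y = u * eval_form Q (p * x + q * y) (r * x + s * y)"
  using assms unfolding form_equiv_def by blast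

lemma form_equiv_refl: "form_equiv K Q Q"
  by (rule form_equivI[of 1 0 0 1 1]) (auto simp: ints_0 ints_1 tp_units_1)

lemma form_equiv_sym:
  assumes "form_equiv K Q' Q"
  shows "form_equiv K Q Q'"
proof -
  obtain p q r s u where pqrs: "p \<in> ints K" "q \<in> ints K" "r \<in> ints K" "s \<in> ints K"
    and u: "u \<in> tp_units K" and e: "p * s - q * r \<in> tp_units K"
    and eq: "\<And>x y. eval_form Q' x y = u * eval_form Q (p * x + q * y) (r * x + s * y)"
    using form_equivE[OF assms] by metis
  define e' where "e' = inverse (p * s - q * r)"
  have e': "e' \<in> tp_units K" "e' * (p * s - q * r) = 1"
    using tp_units_inverse[OF e] tp_unitsD(3)[OF e] by (auto simp: e'_def)
  \<comment> \<open>The inverse matrix is \<open>e'\<close> times the adjugate and has determinant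
    \<open>e'\<close>.\<close>
  show ?thesis
  proof (rule form_equivI[of "e' * s" "- e' * q" "- e' * r" "e' * p" "inverse u"])
    show "inverse u \<in> tp_units K"
      using tp_units_inverse[OF u] .
    have "(e' * s) * (e' * p) - (- e' * q) * (- e' * r) = e' * (e' * (p * s - q * r))"
      by (simp add: algebra_simps)
    then show "(e' * s) * (e' * p) - (- e' * q) * (- e' * r) \<in> tp_units K"
      using e' by simp
    fix x y
    have "p * (e' * s * x + - e' * q * y) + q * (- e' * r * x + e' * p * y) =
        (e' * (p * s - q * r)) * x"
      "r * (e' * s * x + - e' * q * y) + s * (- e' * r * x + e' * p * y) =
        (e' * (p * s - q * r)) * y"
      by (simp_all add: algebra_simps)
    then show "eval_form Q x y =
        inverse u * eval_form Q' (e' * s * x + - e' * q * y) (- e' * r * x + e' * p * y)"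
      unfolding eq e'(2) using tp_unitsD(3)[OF u] by simp
  qed (use pqrs tp_unitsD(1)[OF e'(1)] in \<open>auto intro!: ints_closed\<close>)
qed

lemma form_equiv_trans:
  assumes "form_equiv K Q'' Q'" "form_equiv K Q' Q"
  shows "form_equiv K Q'' Q"
proof -
  obtain p q r s u where pqrs: "p \<in> ints K" "q \<in> ints K" "r \<in> ints K" "s \<in> ints K"
    and u: "u \<in> tp_units K" and e: "p * s - q * r \<in> tp_units K"
    and eq: "\<And>x y. eval_form Q' x y = u * eval_form Q (p * x + q * y) (r * x + s * y)"
    using form_equivE[OF assms(2)] by metis
  obtain p' q' r' s' u' where pqrs': "p' \<in> ints K" "q' \<in> ints K" "r' \<in> ints K" "s' \<in> ints K"
    and u': "u' \<in> tp_units K" and e': "p' * s' - q' * r' \<in> tp_units K"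
    and eq': "\<And>x y. eval_form Q'' x y = u' * eval_form Q' (p' * x + q' * y) (r' * x + s' * y)"
    using form_equivE[OF assms(1)] by metis
  show ?thesis
  proof (rule form_equivI[of "p * p' + q * r'" "p * q' + q * s'" "r * p' + s * r'" "r * q' + s * s'" "u' * u"])
    have "(p * p' + q * r') * (r * q' + s * s') - (p * q' + q * s') * (r * p' + s * r') =
        (p * s - q * r) * (p' * s' - q' * r')"
      by (simp add: algebra_simps)
    then show "(p * p' + q * r') * (r * q' + s * s') - (p * q' + q * s') * (r * p' + s * r') \<in> tp_units K"
      using tp_units_mult[OF e e'] by simp
    fix x y
    show "eval_form Q'' x y = u' * u * eval_form Q ((p * p' + q * r') * x + (p * q' + q * s') * y)
        ((r * p' + s * r') * x + (r * q' + s * s') * y)"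
      unfolding eq' eq by (simp add: algebra_simps)
  qed (use pqrs pqrs' tp_units_mult[OF u' u] in \<open>auto intro!: ints_closed\<close>)
qed

lemma form_class_iff: "Q \<in> forms K D \<Longrightarrow> Q' \<in> form_class K D Q \<longleftrightarrow> Q' \<in> forms K D \<and> form_equiv K Q Q'"
  by (auto simp: form_class_def form_rel_def)

lemma form_class_eq:
  assumes "Q \<in> forms K D" "Q' \<in> forms K D" "form_equiv K Q' Q"
  shows "form_class K D Q' = form_class K D Q"
proof -
  have "form_equiv K Q' R \<longleftrightarrow> form_equiv K Q R" for R
    using form_equiv_trans[OF assms(3), of R] form_equiv_trans[OF form_equiv_sym[OF assms(3)], of R] by blast
  then show ?thesis
    using assms(1,2) by (auto simp: form_class_iff)
qed

lemma form_classes_eq: "form_classes K D = form_class K D ` forms K D"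
  by (auto simp: form_classes_def form_class_def quotient_def)

section \<open>Sign vectors and oriented ideal classes\<close>

lemma sgn_vec_mult:
  "a \<in> K \<Longrightarrow> b \<in> K \<Longrightarrow> (\<lambda>\<sigma>\<in>real_embeddings K. sgn_vec K a \<sigma> * sgn_vec K b \<sigma>) = sgn_vec K (a * b)"
  by (auto simp: sgn_vec_def real_embeddings_hom sgn_mult)

lemma sgn_vec_in: "a \<in> K \<Longrightarrow> a \<noteq> 0 \<Longrightarrow> sgn_vec K a \<in> (\<Pi>\<^sub>E \<sigma>\<in>real_embeddings K. {-1, 1})"
  by (auto simp: sgn_vec_def sgn_if real_embedding_simps)

lemma sgn_vec_cong:
  "(\<And>\<sigma>. \<sigma> \<in> real_embeddings K \<Longrightarrow> sgn (\<sigma> a) = sgn (\<sigma> b)) \<Longrightarrow> sgn_vec K a = sgn_vec K b"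
  unfolding sgn_vec_def by (rule restrict_ext)

lemma sgn_vec_tp:
  "a \<in> K \<Longrightarrow> u \<in> tp_units K \<Longrightarrow> sgn_vec K (a * u) = sgn_vec K a"
  by (rule sgn_vec_cong) (auto simp: real_embeddings_hom sgn_mult tp_unitsD)

lemma carrier_oriented:
  "Z \<in> carrier (oriented_ideal_group K L) \<longleftrightarrow>
     fst Z \<in> frac_ideals L \<and> snd Z \<in> (\<Pi>\<^sub>E \<sigma>\<in>real_embeddings K. {-1, 1})"
  by (cases Z) (auto simp: oriented_ideal_group_def ideal_group_def sign_group_def DirProd_def)

text \<open>Multiplication by a principal oriented ideal scales the ideal by \<open>g\<close> and
  the orientation by the signs of the norm of \<open>g\<close>. Representing orientations by
  elements \<open>a\<close> of \<open>K\<close> lets the norm be multiplied into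
  \<open>a\<close>.\<close>

lemma mem_oriented_class:
  assumes I: "I \<in> frac_ideals L" and a: "a \<in> K"
  shows "(J, e) \<in> oriented_class K L (I, sgn_vec K a) \<longleftrightarrow>
    (\<exists>g\<in>L. g \<noteq> 0 \<and> J = (\<lambda>x. g * x) ` I \<and> e = sgn_vec K (g * cj g * a))"
proof -
  have "oriented_class K L (I, sgn_vec K a) = {(principal_ideal L g, sgn_vec K (g * cj g))
      \<otimes>\<^bsub>oriented_ideal_group K L\<^esub> (I, sgn_vec K a) | g. g \<in> L \<and> g \<noteq> 0}"
    by (auto simp: oriented_class_def r_coset_def principal_oriented_def conjugation_eq)
  also have "\<dots> = {((\<lambda>x. g * x) ` I, sgn_vec K (g * cj g * a)) | g. g \<in> L \<and> g \<noteq> 0}"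
  proof -
    have "(principal_ideal L g, sgn_vec K (g * cj g)) \<otimes>\<^bsub>oriented_ideal_group K L\<^esub> (I, sgn_vec K a) =
        ((\<lambda>x. g * x) ` I, sgn_vec K (g * cj g * a))" if "g \<in> L" for g
      using L.ideal_mult_principal[OF I, of g] sgn_vec_mult[OF norm_in_K[OF that] a]
      by (simp add: oriented_ideal_group_def ideal_group_def sign_group_def)
    then show ?thesis
      by (metis (no_types, lifting))
  qed
  finally show ?thesis
    by auto
qed

lemma oriented_class_eq:
  assumes I: "I \<in> frac_ideals L" and a: "a \<in> K" and g: "g \<in> L" "g \<noteq> 0"
  shows "oriented_class K L ((\<lambda>x. g * x) ` I, sgn_vec K (g * cj g * a)) =
    oriented_class K L (I, sgn_vec K a)"
proof -
  have gI: "(\<lambda>x. g * x) ` I \<in> frac_ideals L"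
    by (rule frac_ideal_scale[OF I g])
  have ga: "g * cj g * a \<in> K"
    using norm_in_K[OF g(1)] a by (rule F_mult)
  have N: "h * g * cj (h * g) * a = h * cj h * (g * cj g * a)" if "h \<in> L" for h
    using that g by (simp add: cj_mult mult_ac)
  have S: "(\<lambda>x. h * x) ` (\<lambda>x. g * x) ` I = (\<lambda>x. h * g * x) ` I" for h
    by (simp add: image_image mult.assoc)
  have "(J, e) \<in> oriented_class K L ((\<lambda>x. g * x) ` I, sgn_vec K (g * cj g * a)) \<longleftrightarrow>
      (J, e) \<in> oriented_class K L (I, sgn_vec K a)" for J e
    unfolding mem_oriented_class[OF gI ga] mem_oriented_class[OF I a]
  proof
    assume "\<exists>h\<in>L. h \<noteq> 0 \<and> J = (\<lambda>x. h * x) ` (\<lambda>x. g * x) ` I \<and> e = sgn_vec K (h * cj h * (g * cj g * a))"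
    then obtain h where "h \<in> L" "h \<noteq> 0" "J = (\<lambda>x. h * x) ` (\<lambda>x. g * x) ` I"
      "e = sgn_vec K (h * cj h * (g * cj g * a))" by blast
    then show "\<exists>h\<in>L. h \<noteq> 0 \<and> J = (\<lambda>x. h * x) ` I \<and> e = sgn_vec K (h * cj h * a)"
      using g by (intro bexI[of _ "h * g"]) (simp_all add: S L.F_mult N)
  next
    assume "\<exists>h\<in>L. h \<noteq> 0 \<and> J = (\<lambda>x. h * x) ` I \<and> e = sgn_vec K (h * cj h * a)"
    then obtain h where h: "h \<in> L" "h \<noteq> 0" "J = (\<lambda>x. h * x) ` I" "e = sgn_vec K (h * cj h * a)"
      by blast
    obtain k where k: "k \<in> L" "k \<noteq> 0" "h = k * g"
    proof (rule that[of "h / g"])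
      show "h / g \<in> L" "h / g \<noteq> 0" "h = h / g * g"
        using h g by (auto simp: L.F_divide)
    qed
    then show "\<exists>h\<in>L. h \<noteq> 0 \<and> J = (\<lambda>x. h * x) ` (\<lambda>x. g * x) ` I \<and> e = sgn_vec K (h * cj h * (g * cj g * a))"
      using h(3,4) by (intro bexI[of _ k]) (simp_all add: S N)
  qed
  then show ?thesis
    by auto
qed

lemma oriented_span_eq: "oriented_span K L w \<alpha> \<beta> = (lattice_span K \<alpha> \<beta>, sgn_vec K (bdet \<alpha> \<beta>))"
  by (simp add: oriented_span_def)

lemma oriented_span_carrier:
  assumes "\<alpha> \<in> L" "\<beta> \<in> L" "lattice_span K \<alpha> \<beta> \<in> frac_ideals L"
  shows "oriented_span K L w \<alpha> \<beta> \<in> carrier (oriented_ideal_group K L)"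
  using assms sgn_vec_in[OF bdet_in_K bdet_nonzero]
  unfolding carrier_oriented oriented_span_eq by simp

text \<open>A basis of the ideal may carry the wrong orientation. Multiplying
  \<open>\<alpha>\<close> by a unit \<open>v\<close> keeps the lattice and multiplies the
  determinant by \<open>v\<close>, whose signs are chosen as the quotient of the wanted and the
  actual ones.\<close>

lemma oriented_ideal_is_span:
  assumes Z: "Z \<in> carrier (oriented_ideal_group K L)"
  obtains \<alpha> \<beta> where "\<alpha> \<in> L" "\<beta> \<in> L" "Z = oriented_span K L w \<alpha> \<beta>"
proof -
  let ?R = "real_embeddings K"
  obtain I e where Ie: "Z = (I, e)" "I \<in> frac_ideals L" "e \<in> (\<Pi>\<^sub>E \<sigma>\<in>?R. {-1, 1})"
    using Z by (cases Z) (auto simp: carrier_oriented)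
  obtain \<alpha> \<beta> where ab: "\<alpha> \<in> L" "\<beta> \<in> L" "I = lattice_span K \<alpha> \<beta>"
    using frac_ideal_basis[OF Ie(2)] .
  define d where "d = bdet \<alpha> \<beta>"
  have d: "d \<in> K" "d \<noteq> 0"
    using bdet_in_K bdet_nonzero ab Ie(2) by (auto simp: d_def)
  have sd: "sgn_vec K d \<sigma> = -1 \<or> sgn_vec K d \<sigma> = 1" "e \<sigma> = -1 \<or> e \<sigma> = 1" if "\<sigma> \<in> ?R" for \<sigma>
    using sgn_vec_in[OF d] Ie(3) that by (auto simp: PiE_iff)
  have "(\<lambda>\<sigma>\<in>?R. sgn_vec K d \<sigma> * e \<sigma>) \<in> (\<Pi>\<^sub>E \<sigma>\<in>?R. {-1, 1})"
    using sd by (intro restrict_PiE_iff[THEN iffD2]) fastforce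
  then obtain v where v: "v \<in> Units (int_ring K)" "sgn_vec K v = (\<lambda>\<sigma>\<in>?R. sgn_vec K d \<sigma> * e \<sigma>)"
    using ex_unit_prescribed_signs by blast
  have v': "v \<in> ints K" "v \<noteq> 0" "inverse v \<in> ints K" "v \<in> K"
    using v(1) by (auto simp: Units_iff ints_iff)
  have "lattice_span K (v * \<alpha>) \<beta> = lattice_span K \<alpha> \<beta>"
  proof (intro equalityI subsetI)
    fix z assume "z \<in> lattice_span K (v * \<alpha>) \<beta>"
    then obtain x y where "x \<in> ints K" "y \<in> ints K" "z = (x * v) * \<alpha> + y * \<beta>"
      by (auto simp: lattice_span_def mult.assoc)
    then show "z \<in> lattice_span K \<alpha> \<beta>"
      using v' by (auto intro!: lattice_spanI ints_mult)
  next
    fix z assume "z \<in> lattice_span K \<alpha> \<beta>"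
    then obtain x y where "x \<in> ints K" "y \<in> ints K" "z = x * \<alpha> + y * \<beta>"
      by (auto simp: lattice_span_def)
    moreover from this have "z = (x * inverse v) * (v * \<alpha>) + y * \<beta>"
      using v' by simp
    ultimately show "z \<in> lattice_span K (v * \<alpha>) \<beta>"
      using v' by (metis ints_mult lattice_spanI)
  qed
  moreover have "bdet (v * \<alpha>) \<beta> = v * d"
    using ab v' by (simp add: d_def bdet_eq cj_mult cj_K K_subset_L algebra_simps diff_divide_distrib)
  moreover have "sgn_vec K (v * d) = e"
  proof -
    have "sgn_vec K (v * d) = (\<lambda>\<sigma>\<in>?R. sgn_vec K v \<sigma> * sgn_vec K d \<sigma>)"
      using sgn_vec_mult[OF v'(4) d(1)] by simp
    also have "\<dots> = (\<lambda>\<sigma>\<in>?R. e \<sigma>)"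
      using sd unfolding v(2) by (intro restrict_ext) fastforce
    also have "\<dots> = e"
      using Ie(3) by (auto simp: PiE_iff extensional_restrict)
    finally show ?thesis .
  qed
  ultimately have "Z = oriented_span K L w (v * \<alpha>) \<beta>"
    by (simp add: oriented_span_eq Ie(1) ab(3))
  moreover have "v * \<alpha> \<in> L"
    using v' ab by (simp add: L.F_mult K_subset_L)
  ultimately show ?thesis
    using ab that by blast
qed

section \<open>The two maps\<close>

text \<open>Otherwise the discriminant would be a square in \<open>K\<close>, and \<open>w\<close>
  would lie in \<open>K\<close>.\<close>

lemma form_first_coeff_nonzero:
  assumes "(a, b, c) \<in> forms K D"
  shows "a \<noteq> 0"
proof
  assume "a = 0"
  then obtain u where u: "u \<in> tp_units K" "b\<^sup>2 = u\<^sup>2 * D" and b: "b \<in> ints K"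
    using assms unfolding forms_iff by auto
  then have "(b / u)\<^sup>2 = w\<^sup>2"
    using tp_unitsD(3)[OF u(1)] by (simp add: power_divide w_square)
  then have "w = b / u \<or> w = - (b / u)"
    by (metis power2_eq_iff minus_minus)
  moreover have "b / u \<in> K"
    using b u tp_unitsD(2) ints_in_F by (simp add: F_divide)
  ultimately show False
    using w_notin_K F_minus by metis
qed

lemma cj_form_root:
  assumes "b \<in> K" "u \<in> K"
  shows "cj ((- b + u * w) / 2) = (- b - u * w) / 2"
proof -
  have "(- b + u * w) / 2 = - b / 2 + (u / 2) * w"
    by (simp add: field_simps)
  then show ?thesis
    using cj_coords[of "- b / 2" "u / 2"] assms by (simp add: F_closed field_simps)
qed

lemma form_root_in_L: "b \<in> K \<Longrightarrow> u \<in> K \<Longrightarrow> (- b + u * w) / 2 \<in> L"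
  by (simp add: L.F_closed w_in_L K_subset_L)

text \<open>\<open>\<theta>\<close> is a root of \<open>X^2 + b X + a c\<close>, and
  \<open>u * om\<close> differs from \<open>\<theta>\<close> by an element of \<open>ints K\<close>,
  so \<open>om\<close> preserves the lattice. The determinant \<open>a * u\<close> has the signs of
  \<open>a\<close>, and the form of this basis is the original one divided by
  \<open>u\<close>.\<close>

lemma form_to_ideal_span:
  assumes Q: "(a, b, c) \<in> forms K D" and u: "u \<in> tp_units K" and disc: "b\<^sup>2 - 4 * a * c = u\<^sup>2 * D"
  defines "\<theta> \<equiv> (- b + u * w) / 2"
  shows "lattice_span K a \<theta> \<in> frac_ideals L"
    and "bdet a \<theta> = a * u"
    and "form_to_ideal K w u (a, b, c) = oriented_span K L w a \<theta>"
    and "basis_to_form K L w a \<theta> = (a / u, b / u, c / u)"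
proof -
  have abc: "a \<in> ints K" "b \<in> ints K" "c \<in> ints K"
    using Q unfolding forms_iff by auto
  note abcK = abc[THEN ints_in_F]
  note u' = tp_unitsD[OF u]
  have a0: "a \<noteq> 0"
    using form_first_coeff_nonzero[OF Q] .
  have \<theta>L: "\<theta> \<in> L"
    unfolding \<theta>_def using abcK u' by (intro form_root_in_L)
  have c\<theta>: "cj \<theta> = (- b - u * w) / 2"
    unfolding \<theta>_def using abcK u' by (intro cj_form_root)
  have uw: "(u * w) * (u * w) = b * b - 4 * a * c"
    using disc by (simp add: power2_eq_square algebra_simps ww)
  have "\<theta> * \<theta> = (b * b - 2 * b * (u * w) + (u * w) * (u * w)) / 4"
    by (simp add: \<theta>_def field_simps)
  also have "\<dots> = - b * \<theta> - a * c"
    unfolding uw by (simp add: \<theta>_def field_simps)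
  finally have \<theta>\<theta>: "\<theta> * \<theta> = - b * \<theta> - a * c" .
  \<comment> \<open>The difference of \<open>u * om\<close> and \<open>\<theta>\<close>; it is
    integral because \<open>b\<close> and \<open>u * tt\<close> have congruent squares modulo
    4.\<close>
  define k where "k = (b + u * tt) / 2"
  have "(b\<^sup>2 - (u * tt)\<^sup>2) / 4 = a * c + u\<^sup>2 * ((D - tt\<^sup>2) / 4)"
  proof -
    have "b\<^sup>2 = 4 * a * c + u\<^sup>2 * D"
      using disc by (simp add: algebra_simps)
    then show ?thesis
      by (simp add: power_mult_distrib field_simps)
  qed
  also have "\<dots> \<in> ints K"
    using abc u'(1) tt by (intro ints_add ints_mult ints_power)
  finally have "(b\<^sup>2 - (u * tt)\<^sup>2) / 4 \<in> ints K" .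
  then have k: "k \<in> ints K"
    unfolding k_def using abc u'(1) tt by (intro half_sum_ints ints_mult)
  define v where "v = inverse u"
  have v: "v \<in> ints K" "v * u = 1"
    using u' by (auto simp: v_def)
  have "u * om = \<theta> + k"
    by (simp add: om_def \<theta>_def k_def field_simps)
  then have "v * u * om = v * (\<theta> + k)"
    by (simp add: mult.assoc)
  then have om: "om = v * (\<theta> + k)"
    by (simp add: v(2))
  show I: "lattice_span K a \<theta> \<in> frac_ideals L"
  proof (rule lattice_frac_ideal)
    have "om * a = (v * k) * a + (v * a) * \<theta>"
      by (simp add: om algebra_simps)
    then show "om * a \<in> lattice_span K a \<theta>"
      using v k abc by (auto intro!: lattice_spanI ints_mult)
    have "om * \<theta> = v * (\<theta> * \<theta>) + v * k * \<theta>"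
      by (simp add: om algebra_simps)
    also have "\<dots> = (- (v * c)) * a + (v * (k - b)) * \<theta>"
      by (simp add: \<theta>\<theta> algebra_simps)
    finally have om\<theta>: "om * \<theta> = (- (v * c)) * a + (v * (k - b)) * \<theta>" .
    show "om * \<theta> \<in> lattice_span K a \<theta>"
      unfolding om\<theta> using v k abc by (intro lattice_spanI ints_mult ints_diff ints_minus)
  qed (use a0 abcK \<theta>L K_subset_L in auto)
  show det: "bdet a \<theta> = a * u"
    using abcK w_nonzero unfolding bdet_eq c\<theta> by (simp add: \<theta>_def cj_K field_simps)
  show "form_to_ideal K w u (a, b, c) = oriented_span K L w a \<theta>"
    unfolding oriented_span_eq det sgn_vec_tp[OF abcK(1) u] by (simp add: \<theta>_def)
  have "\<theta> * cj \<theta> = a * c"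
  proof -
    have "\<theta> * cj \<theta> = (b * b - (u * w) * (u * w)) / 4"
      unfolding c\<theta> by (simp add: \<theta>_def field_simps)
    then show ?thesis
      by (simp add: uw)
  qed
  moreover have "- (a * \<theta> + a * cj \<theta>) = a * b"
    unfolding c\<theta> by (simp add: \<theta>_def field_simps)
  ultimately show "basis_to_form K L w a \<theta> = (a / u, b / u, c / u)"
    using a0 abcK u'(3) unfolding basis_to_form_eq det by (simp add: cj_K)
qed

text \<open>For \<open>x\<close> and \<open>y\<close> in \<open>K\<close> this is the norm of
  \<open>x * \<alpha> - y * \<beta>\<close> over the determinant. Conjugating only the basis keeps
  the identity valid on the whole ambient field, over which \<open>form_equiv\<close>
  quantifies.\<close>

lemma eval_basis_to_form:
  "eval_form (basis_to_form K L w \<alpha> \<beta>) x y =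
    (x * \<alpha> - y * \<beta>) * (x * cj \<alpha> - y * cj \<beta>) / bdet \<alpha> \<beta>"
  by (simp add: basis_to_form_eq diff_divide_distrib add_divide_distrib algebra_simps power2_eq_square)

section \<open>Change of basis and invariance of Phi\<close>

lemma bdet_base_change:
  assumes "\<alpha> \<in> L" "\<beta> \<in> L" "p \<in> ints K" "q \<in> ints K" "r \<in> ints K" "s \<in> ints K"
  shows "cj (p * \<alpha> + r * \<beta>) = p * cj \<alpha> + r * cj \<beta>"
    and "bdet (p * \<alpha> + r * \<beta>) (q * \<alpha> + s * \<beta>) = (p * s - q * r) * bdet \<alpha> \<beta>"
proof -
  have c: "cj (x * \<alpha> + y * \<beta>) = x * cj \<alpha> + y * cj \<beta>" if "x \<in> ints K" "y \<in> ints K" for x y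
    using that[THEN ints_in_F] assms(1,2) by (simp add: cj_add cj_mult cj_K L.F_mult K_subset_L)
  show "cj (p * \<alpha> + r * \<beta>) = p * cj \<alpha> + r * cj \<beta>"
    using c assms by blast
  have "bdet (p * \<alpha> + r * \<beta>) (q * \<alpha> + s * \<beta>) =
      ((p * cj \<alpha> + r * cj \<beta>) * (q * \<alpha> + s * \<beta>) - (p * \<alpha> + r * \<beta>) * (q * cj \<alpha> + s * cj \<beta>)) / w"
    using assms by (simp only: bdet_eq c)
  also have "\<dots> = (p * s - q * r) * ((cj \<alpha> * \<beta> - \<alpha> * cj \<beta>) / w)"
    by (simp add: algebra_simps diff_divide_distrib add_divide_distrib)
  finally show "bdet (p * \<alpha> + r * \<beta>) (q * \<alpha> + s * \<beta>) = (p * s - q * r) * bdet \<alpha> \<beta>"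
    by (simp only: bdet_eq)
qed

text \<open>The base changes in the two directions have inverse determinants, and equal orientations
  make these totally positive.\<close>

lemma same_lattice_form_equiv:
  assumes ab: "\<alpha> \<in> L" "\<beta> \<in> L" and ab': "\<alpha>' \<in> L" "\<beta>' \<in> L"
    and eq: "lattice_span K \<alpha>' \<beta>' = lattice_span K \<alpha> \<beta>"
    and sgn: "sgn_vec K (bdet \<alpha>' \<beta>') = sgn_vec K (bdet \<alpha> \<beta>)"
    and nz: "bdet \<alpha> \<beta> \<noteq> 0" "bdet \<alpha>' \<beta>' \<noteq> 0"
  shows "form_equiv K (basis_to_form K L w \<alpha>' \<beta>') (basis_to_form K L w \<alpha> \<beta>)"
proof -
  note gens = lattice_span_gens[where \<alpha> = \<alpha>' and \<beta> = \<beta>', unfolded eq]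
    lattice_span_gens[where \<alpha> = \<alpha> and \<beta> = \<beta>, folded eq]
  obtain p r where pr: "p \<in> ints K" "r \<in> ints K" "\<alpha>' = p * \<alpha> + r * \<beta>"
    using gens(1) unfolding lattice_span_def by blast
  obtain q s where qs: "q \<in> ints K" "s \<in> ints K" "\<beta>' = q * \<alpha> + s * \<beta>"
    using gens(2) unfolding lattice_span_def by blast
  obtain p' r' where pr': "p' \<in> ints K" "r' \<in> ints K" "\<alpha> = p' * \<alpha>' + r' * \<beta>'"
    using gens(3) unfolding lattice_span_def by blast
  obtain q' s' where qs': "q' \<in> ints K" "s' \<in> ints K" "\<beta> = q' * \<alpha>' + s' * \<beta>'"
    using gens(4) unfolding lattice_span_def by blast
  define e where "e = p * s - q * r"
  define e' where "e' = p' * s' - q' * r'"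
  have ints: "e \<in> ints K" "e' \<in> ints K"
    using pr(1,2) qs(1,2) pr'(1,2) qs'(1,2) by (auto simp: e_def e'_def intro!: ints_diff ints_mult)
  have de: "bdet \<alpha>' \<beta>' = e * bdet \<alpha> \<beta>"
    using bdet_base_change(2)[OF ab pr(1) qs(1) pr(2) qs(2)] by (simp add: pr(3) qs(3) e_def)
  have de': "bdet \<alpha> \<beta> = e' * bdet \<alpha>' \<beta>'"
    using bdet_base_change(2)[OF ab' pr'(1) qs'(1) pr'(2) qs'(2), folded pr'(3) qs'(3)] by (simp add: e'_def)
  \<comment> \<open>Cancelling the nonzero determinant gives invertibility without comparing
    coordinates in the two bases.\<close>
  have "e * e' * bdet \<alpha> \<beta> = 1 * bdet \<alpha> \<beta>"
    using de'[unfolded de] by (simp add: mult_ac)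
  then have ee': "e * e' = 1"
    using nz by (metis mult_cancel_right)
  then have inv: "e \<noteq> 0" "inverse e = e'"
    by (auto simp: inverse_unique)
  have "0 < \<sigma> e" if s: "\<sigma> \<in> real_embeddings K" for \<sigma>
  proof -
    have dK: "bdet \<alpha> \<beta> \<in> K"
      using bdet_in_K[OF ab] .
    have "sgn (\<sigma> (bdet \<alpha>' \<beta>')) = sgn (\<sigma> (bdet \<alpha> \<beta>))"
      using fun_cong[OF sgn, of \<sigma>] s by (simp add: sgn_vec_def)
    then have "sgn (\<sigma> e) * sgn (\<sigma> (bdet \<alpha> \<beta>)) = sgn (\<sigma> (bdet \<alpha> \<beta>))"
      using dK ints_in_F[OF ints(1)] by (simp add: de real_embeddings_hom[OF s] sgn_mult)
    moreover have "\<sigma> (bdet \<alpha> \<beta>) \<noteq> 0"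
      using real_embedding_simps(4)[OF s dK] nz by simp
    ultimately show ?thesis
      by (simp add: sgn_1_pos sgn_zero_iff)
  qed
  then have e: "e \<in> tp_units K"
    using ints inv by (simp add: tp_units_iff)
  have c: "cj \<alpha>' = p * cj \<alpha> + r * cj \<beta>" "cj \<beta>' = q * cj \<alpha> + s * cj \<beta>"
    using bdet_base_change(1)[OF ab pr(1) qs(1) pr(2) qs(2)]
      bdet_base_change(1)[OF ab qs(1) pr(1) qs(2) pr(2)] by (simp_all add: pr(3) qs(3))
  \<comment> \<open>The off-diagonal signs stem from evaluating the form at
    \<open>x * \<alpha> - y * \<beta>\<close>; the factor \<open>inverse e\<close> accounts for the
    new denominator.\<close>
  show ?thesis
  proof (rule form_equivI[of p "- q" "- r" s "inverse e"])
    show "p * s - - q * - r \<in> tp_units K"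
      using e by (simp add: e_def)
    fix x y
    show "eval_form (basis_to_form K L w \<alpha>' \<beta>') x y =
        inverse e * eval_form (basis_to_form K L w \<alpha> \<beta>) (p * x + - q * y) (- r * x + s * y)"
    proof -
      have 1: "x * \<alpha>' - y * \<beta>' = (p * x + - q * y) * \<alpha> - (- r * x + s * y) * \<beta>"
        by (simp add: pr(3) qs(3) algebra_simps)
      have 2: "x * cj \<alpha>' - y * cj \<beta>' = (p * x + - q * y) * cj \<alpha> - (- r * x + s * y) * cj \<beta>"
        by (simp add: c algebra_simps)
      show ?thesis
        unfolding eval_basis_to_form de 1 2 by (simp add: divide_inverse mult_ac)
    qed
  qed (use pr(1,2) qs(1,2) tp_units_inverse[OF e] in \<open>auto intro: ints_minus\<close>)
qed

text \<open>Numerators and determinant all acquire the norm of \<open>g\<close>, which cancels in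
  the form.\<close>

lemma scaled_basis:
  assumes "\<alpha> \<in> L" "\<beta> \<in> L" "g \<in> L" "g \<noteq> 0"
  shows "bdet (g * \<alpha>) (g * \<beta>) = g * cj g * bdet \<alpha> \<beta>"
    and "basis_to_form K L w (g * \<alpha>) (g * \<beta>) = basis_to_form K L w \<alpha> \<beta>"
proof -
  show d: "bdet (g * \<alpha>) (g * \<beta>) = g * cj g * bdet \<alpha> \<beta>"
    using assms by (simp add: bdet_eq cj_mult algebra_simps diff_divide_distrib)
  have n: "g * cj g \<noteq> 0"
    using assms cj_zero_iff by simp
  have cancel: "n * x / (n * y) = x / y" if "n \<noteq> 0" for n x y :: 'a
    using that by simp
  have "basis_to_form K L w (g * \<alpha>) (g * \<beta>) =
      (g * cj g * (\<alpha> * cj \<alpha>) / (g * cj g * bdet \<alpha> \<beta>),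
       g * cj g * - (cj \<alpha> * \<beta> + \<alpha> * cj \<beta>) / (g * cj g * bdet \<alpha> \<beta>),
       g * cj g * (\<beta> * cj \<beta>) / (g * cj g * bdet \<alpha> \<beta>))"
    unfolding basis_to_form_eq d using assms by (simp add: cj_mult algebra_simps)
  then show "basis_to_form K L w (g * \<alpha>) (g * \<beta>) = basis_to_form K L w \<alpha> \<beta>"
    unfolding basis_to_form_eq cancel[OF n] .
qed

text \<open>Scaling the given basis by the \<open>g\<close> that relates the two oriented ideals
  leaves its form unchanged and reduces the claim to two bases of one lattice with the same
  orientation.\<close>

lemma Phi_invariant:
  assumes ab: "\<alpha> \<in> L" "\<beta> \<in> L" "lattice_span K \<alpha> \<beta> \<in> frac_ideals L" and ab': "\<alpha>' \<in> L" "\<beta>' \<in> L"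
    and mem: "oriented_span K L w \<alpha>' \<beta>' \<in> oriented_class K L (oriented_span K L w \<alpha> \<beta>)"
  shows "form_class K D (basis_to_form K L w \<alpha>' \<beta>') = form_class K D (basis_to_form K L w \<alpha> \<beta>)"
proof -
  have dK: "bdet \<alpha> \<beta> \<in> K"
    using bdet_in_K ab by blast
  obtain g where g: "g \<in> L" "g \<noteq> 0" "lattice_span K \<alpha>' \<beta>' = (\<lambda>x. g * x) ` lattice_span K \<alpha> \<beta>"
    "sgn_vec K (bdet \<alpha>' \<beta>') = sgn_vec K (g * cj g * bdet \<alpha> \<beta>)"
    using mem unfolding oriented_span_eq mem_oriented_class[OF ab(3) dK] by blast
  have I': "lattice_span K \<alpha>' \<beta>' \<in> frac_ideals L"
    unfolding g(3) by (rule frac_ideal_scale[OF ab(3) g(1,2)])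
  have gab: "g * \<alpha> \<in> L" "g * \<beta> \<in> L"
    using g ab L.F_mult by auto
  have eq: "lattice_span K \<alpha>' \<beta>' = lattice_span K (g * \<alpha>) (g * \<beta>)"
    unfolding g(3) by (rule lattice_span_scale)
  have "form_equiv K (basis_to_form K L w \<alpha>' \<beta>') (basis_to_form K L w (g * \<alpha>) (g * \<beta>))"
    using same_lattice_form_equiv[OF gab ab' eq] g(4) scaled_basis(1)[OF ab(1,2) g(1,2)]
      bdet_nonzero[OF ab' I'] bdet_nonzero[OF gab] I' eq by simp
  then show ?thesis
    using basis_to_form_in_forms[OF ab] basis_to_form_in_forms[OF ab' I']
    by (intro form_class_eq) (simp_all add: scaled_basis[OF ab(1,2) g(1,2)])
qed

section \<open>Invariance of Psi\<close>

lemma disc_form_equiv: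
  assumes "\<And>x y. eval_form Q' x y = u * eval_form Q (p * x + q * y) (r * x + s * y)"
  shows "disc Q' = u\<^sup>2 * (p * s - q * r)\<^sup>2 * disc Q"
proof (cases Q; cases Q')
  fix a b c a' b' c' assume Q: "Q = (a, b, c)" "Q' = (a', b', c')"
  note co = eval_form_eqD[OF assms[unfolded Q]]
  show ?thesis
    unfolding Q disc.simps co by (simp add: algebra_simps power2_eq_square)
qed

text \<open>
  With \<open>\<theta> = (- b + v w) / 2\<close>, the form \<open>(a, b, c)\<close> is \<open>N(a x - \<theta> y) / a\<close>. Substituting gives the
  basis \<open>\<alpha>1 = p a - r \<theta>\<close>, \<open>\<beta>1 = s \<theta> - q a\<close> of the same lattice, and multiplication by
  \<open>u cj \<alpha>1 / a\<close> sends it to the basis attached to the transformed form.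
\<close>

lemma Psi_invariant:
  assumes Q: "Q \<in> forms K D" "Q' \<in> forms K D" "form_equiv K Q' Q"
    and v: "v \<in> tp_units K" "disc Q = v\<^sup>2 * D" and v': "v' \<in> tp_units K" "disc Q' = v'\<^sup>2 * D"
  shows "oriented_class K L (form_to_ideal K w v' Q') = oriented_class K L (form_to_ideal K w v Q)"
proof -
  obtain a b c a' b' c' where abc: "Q = (a, b, c)" "Q' = (a', b', c')"
    by (cases Q; cases Q') auto
  obtain p q r s u where pqrs: "p \<in> ints K" "q \<in> ints K" "r \<in> ints K" "s \<in> ints K"
    and u: "u \<in> tp_units K" and e: "p * s - q * r \<in> tp_units K"
    and eq: "\<And>x y. eval_form Q' x y = u * eval_form Q (p * x + q * y) (r * x + s * y)"
    using form_equivE[OF Q(3)] by metis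
  note co = eval_form_eqD[OF eq[unfolded abc]]
  have ints: "a \<in> ints K" "b \<in> ints K" "c \<in> ints K" "a' \<in> ints K" "b' \<in> ints K"
    using Q(1,2) unfolding abc forms_iff by auto
  note inK = ints[THEN ints_in_F] pqrs[THEN ints_in_F] tp_unitsD(2)[OF u] tp_unitsD(2)[OF v(1)]
  have a0: "a \<noteq> 0" "a' \<noteq> 0"
    using form_first_coeff_nonzero Q(1,2) by (auto simp: abc)
  define e where "e = p * s - q * r"
  have etp: "e \<in> tp_units K"
    using \<open>p * s - q * r \<in> tp_units K\<close> by (simp add: e_def)
  have "v'\<^sup>2 * D = (u * e * v)\<^sup>2 * D"
    using disc_form_equiv[OF eq] v(2) v'(2) by (simp add: e_def power_mult_distrib mult_ac)
  then have "v'\<^sup>2 = (u * e * v)\<^sup>2"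
    using D_nonzero by simp
  \<comment> \<open>Comparison of discriminants determines \<open>v'\<close> only up to sign; total
    positivity settles the sign.\<close>
  then have v'eq: "v' = u * e * v"
    by (rule tp_units_square_unique[OF v'(1) tp_units_mult[OF tp_units_mult[OF u etp] v(1)]])
  define \<theta> where "\<theta> = (- b + v * w) / 2"
  define \<theta>' where "\<theta>' = (- b' + v' * w) / 2"
  have dQ: "b\<^sup>2 - 4 * a * c = v\<^sup>2 * D" "b'\<^sup>2 - 4 * a' * c' = v'\<^sup>2 * D"
    using v(2) v'(2) by (simp_all add: abc)
  note span = form_to_ideal_span[OF Q(1)[unfolded abc] v(1) dQ(1), folded \<theta>_def]
  have \<theta>L: "\<theta> \<in> L"
    unfolding \<theta>_def using inK by (intro form_root_in_L)
  have aL: "a \<in> L"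
    using inK K_subset_L by blast
  have c\<theta>: "cj \<theta> = (- b - v * w) / 2"
    unfolding \<theta>_def using inK by (intro cj_form_root)
  define \<alpha>1 where "\<alpha>1 = p * a + (- r) * \<theta>"
  define \<beta>1 where "\<beta>1 = (- q) * a + s * \<theta>"
  have L1: "\<alpha>1 \<in> L" "\<beta>1 \<in> L"
    unfolding \<alpha>1_def \<beta>1_def using aL \<theta>L inK by (auto intro!: L.F_diff L.F_mult dest: K_subset_L)
  have c\<alpha>1: "cj \<alpha>1 = p * a - r * cj \<theta>"
    unfolding \<alpha>1_def
    using bdet_base_change(1)[OF aL \<theta>L pqrs(1) pqrs(1) ints_minus[OF pqrs(3)] pqrs(1)] inK by (simp add: cj_K)
  have vw: "v * w * (v * w) = b * b - 4 * a * c"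
    using dQ(1) by (simp add: power2_eq_square algebra_simps ww)
  have tr: "\<theta> + cj \<theta> = - b" and di: "\<theta> - cj \<theta> = v * w"
    unfolding c\<theta> by (simp_all add: \<theta>_def field_simps)
  have "\<theta> * cj \<theta> = (b * b - v * w * (v * w)) / 4"
    unfolding c\<theta> by (simp add: \<theta>_def field_simps)
  then have no: "\<theta> * cj \<theta> = a * c"
    by (simp add: vw)
  define g where "g = u * cj \<alpha>1 / a"
  have a1: "u * (cj \<alpha>1 * \<alpha>1) = a * a'"
  proof -
    have "cj \<alpha>1 * \<alpha>1 = p * p * a * a - p * r * a * (\<theta> + cj \<theta>) + r * r * (\<theta> * cj \<theta>)"
      unfolding c\<alpha>1 by (simp add: \<alpha>1_def algebra_simps)
    also have "\<dots> = a * (a * p\<^sup>2 + b * p * r + c * r\<^sup>2)"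
      unfolding tr no by (simp add: algebra_simps power2_eq_square)
    finally show ?thesis
      unfolding co(1) by (simp add: mult_ac)
  qed
  then have g\<alpha>: "g * \<alpha>1 = a'"
    using a0 by (simp add: g_def field_simps)
  \<comment> \<open>Doubled so that \<open>2 * \<theta>\<close> splits into the trace and the
    difference \<open>v * w\<close>; the latter contributes the root of the new
    discriminant.\<close>
  have b1: "2 * (u * (cj \<alpha>1 * \<beta>1)) = a * (2 * \<theta>')"
  proof -
    have "2 * (cj \<alpha>1 * \<beta>1) = - 2 * (p * q * a * a) + (p * s + q * r) * a * (\<theta> + cj \<theta>)
        - 2 * (r * s * (\<theta> * cj \<theta>)) + (p * s - q * r) * a * (\<theta> - cj \<theta>)"
      unfolding c\<alpha>1 \<beta>1_def by (simp add: algebra_simps)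
    also have "\<dots> = a * (- (2 * a * p * q + b * (p * s + q * r) + 2 * c * r * s) + e * v * w)"
      unfolding tr no di e_def by (simp add: algebra_simps)
    finally have ab: "2 * (cj \<alpha>1 * \<beta>1) =
        a * (- (2 * a * p * q + b * (p * s + q * r) + 2 * c * r * s) + e * v * w)" .
    have "2 * (u * (cj \<alpha>1 * \<beta>1)) = u * (2 * (cj \<alpha>1 * \<beta>1))"
      by simp
    also have "\<dots> = a * (- b' + v' * w)"
      unfolding ab co(2) v'eq by (simp add: algebra_simps)
    finally show ?thesis
      by (simp add: \<theta>'_def)
  qed
  then have "2 * (u * (cj \<alpha>1 * \<beta>1)) = 2 * (a * \<theta>')"
    by (simp only: mult.left_commute)
  then have "u * (cj \<alpha>1 * \<beta>1) = a * \<theta>'"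
    by (metis mult_cancel_left zero_neq_numeral)
  then have g\<beta>: "g * \<beta>1 = \<theta>'"
    using a0 by (simp add: g_def field_simps)
  have "g \<in> L"
    unfolding g_def by (rule L.F_divide[OF L.F_mult[OF K_subset_L[OF tp_unitsD(2)[OF u]] cj_closed[OF L1(1)]] aL])
  moreover have "g \<noteq> 0"
    using g\<alpha> a0(2) by auto
  ultimately have g: "g \<in> L" "g \<noteq> 0"
    by auto
  have lat: "lattice_span K \<alpha>1 \<beta>1 = lattice_span K a \<theta>"
  proof (intro equalityI subsetI)
    fix z assume "z \<in> lattice_span K \<alpha>1 \<beta>1"
    then obtain x y where xy: "x \<in> ints K" "y \<in> ints K" "z = x * \<alpha>1 + y * \<beta>1"
      unfolding lattice_span_def by blast
    have "z = (x * p - y * q) * a + (y * s - x * r) * \<theta>"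
      by (simp add: xy(3) \<alpha>1_def \<beta>1_def algebra_simps)
    then show "z \<in> lattice_span K a \<theta>"
      using xy pqrs by (auto intro!: lattice_spanI ints_diff ints_mult)
  next
    fix z assume "z \<in> lattice_span K a \<theta>"
    then obtain x y where xy: "x \<in> ints K" "y \<in> ints K" "z = x * a + y * \<theta>"
      unfolding lattice_span_def by blast
    \<comment> \<open>Coordinates in the new basis come from inverting the base change, whose
      determinant is the unit \<open>e\<close>.\<close>
    define i where "i = inverse e"
    have i: "i \<in> ints K" "i * e = 1"
      using tp_unitsD[OF etp] by (auto simp: i_def)
    have "i * (x * s + y * q) * \<alpha>1 + i * (x * r + y * p) * \<beta>1 = (i * e) * (x * a + y * \<theta>)"
      by (simp add: \<alpha>1_def \<beta>1_def e_def algebra_simps)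
    then have "z = i * (x * s + y * q) * \<alpha>1 + i * (x * r + y * p) * \<beta>1"
      by (simp add: i(2) xy(3))
    then show "z \<in> lattice_span K \<alpha>1 \<beta>1"
      using xy pqrs i by (auto intro!: lattice_spanI ints_add ints_mult)
  qed
  have gI: "lattice_span K a' \<theta>' = (\<lambda>x. g * x) ` lattice_span K a \<theta>"
    unfolding lat[symmetric] lattice_span_scale g\<alpha> g\<beta> ..
  \<comment> \<open>The orientations match because the norm of \<open>g\<close> times
    \<open>a\<close> is \<open>a'\<close> up to the totally positive unit \<open>u\<close>.\<close>
  have "a * (g * cj g * a) = a * (a' * u)"
  proof -
    have "cj g = u * \<alpha>1 / a"
      using inK aL L1 by (simp add: g_def cj_divide cj_mult cj_cj cj_K cj_closed L.F_mult K_subset_L)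
    then have "a * (g * cj g * a) = u * (u * (cj \<alpha>1 * \<alpha>1))"
      using a0 by (simp add: g_def field_simps)
    then show ?thesis
      unfolding a1 by (simp add: mult_ac)
  qed
  then have "g * cj g * a = a' * u"
    using a0 by simp
  then have sg: "sgn_vec K (g * cj g * a) = sgn_vec K a'"
    using sgn_vec_tp[OF inK(4) u] by simp
  have "form_to_ideal K w v' Q' = ((\<lambda>x. g * x) ` lattice_span K a \<theta>, sgn_vec K (g * cj g * a))"
    unfolding sg gI[symmetric] by (simp add: abc \<theta>'_def)
  moreover have "form_to_ideal K w v Q = (lattice_span K a \<theta>, sgn_vec K a)"
    by (simp add: abc \<theta>_def)
  ultimately show ?thesis
    using oriented_class_eq[OF span(1) inK(1) g] by simp
qed

section \<open>The maps on classes and their composites\<close>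

lemma Psi_form_class:
  assumes Q: "Q \<in> forms K D" and u: "u \<in> tp_units K" "disc Q = u\<^sup>2 * D"
  shows "Psi K L D w (form_class K D Q) = oriented_class K L (form_to_ideal K w u Q)"
  unfolding Psi_def
proof (rule the_equality)
  show "\<exists>Q'\<in>form_class K D Q. \<exists>v\<in>tp_units K. disc Q' = v\<^sup>2 * D \<and>
      oriented_class K L (form_to_ideal K w u Q) = oriented_class K L (form_to_ideal K w v Q')"
    using Q u form_equiv_refl form_class_iff by blast
  \<comment> \<open>Any other representative, with any admissible unit, yields the same class, so
    the definite description denotes it.\<close>
  fix Z assume "\<exists>Q'\<in>form_class K D Q. \<exists>v\<in>tp_units K. disc Q' = v\<^sup>2 * D \<and>
      Z = oriented_class K L (form_to_ideal K w v Q')"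
  then obtain Q' v where "Q' \<in> forms K D" "form_equiv K Q Q'" "v \<in> tp_units K" "disc Q' = v\<^sup>2 * D"
    "Z = oriented_class K L (form_to_ideal K w v Q')"
    using form_class_iff[OF Q] by blast
  then show "Z = oriented_class K L (form_to_ideal K w u Q)"
    using Psi_invariant[OF Q, of Q' u v] u form_equiv_sym by blast
qed

lemma Phi_oriented_class:
  assumes ab: "\<alpha> \<in> L" "\<beta> \<in> L" "lattice_span K \<alpha> \<beta> \<in> frac_ideals L"
  shows "Phi K L D w (oriented_class K L (oriented_span K L w \<alpha> \<beta>)) =
    form_class K D (basis_to_form K L w \<alpha> \<beta>)"
  unfolding Phi_def
proof (rule the_equality)
  have "bdet \<alpha> \<beta> \<in> K"
    using bdet_in_K ab by blast
  then have "oriented_span K L w \<alpha> \<beta> \<in> oriented_class K L (oriented_span K L w \<alpha> \<beta>)"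
    unfolding oriented_span_eq mem_oriented_class[OF ab(3) \<open>bdet \<alpha> \<beta> \<in> K\<close>]
    using cj_K[OF F_1] L.F_1 by (intro bexI[of _ 1]) auto
  then show "\<exists>\<alpha>'\<in>L. \<exists>\<beta>'\<in>L. oriented_span K L w \<alpha>' \<beta>' \<in> oriented_class K L (oriented_span K L w \<alpha> \<beta>) \<and>
      form_class K D (basis_to_form K L w \<alpha> \<beta>) = form_class K D (basis_to_form K L w \<alpha>' \<beta>')"
    using ab by blast
  fix C assume "\<exists>\<alpha>'\<in>L. \<exists>\<beta>'\<in>L. oriented_span K L w \<alpha>' \<beta>' \<in> oriented_class K L (oriented_span K L w \<alpha> \<beta>) \<and>
      C = form_class K D (basis_to_form K L w \<alpha>' \<beta>')"
  then show "C = form_class K D (basis_to_form K L w \<alpha> \<beta>)"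
    using Phi_invariant[OF ab] by blast
qed

text \<open>The form that comes back is \<open>Q\<close> divided by \<open>u\<close>, equivalent to
  \<open>Q\<close> through the identity matrix and the totally positive factor
  \<open>inverse u\<close>.\<close>

lemma Phi_Psi:
  assumes Q: "Q \<in> forms K D"
  shows "Phi K L D w (Psi K L D w (form_class K D Q)) = form_class K D Q"
proof -
  obtain a b c where abc: "Q = (a, b, c)"
    by (cases Q) auto
  obtain u where u: "u \<in> tp_units K" "b\<^sup>2 - 4 * a * c = u\<^sup>2 * D"
    and ints: "a \<in> ints K" "b \<in> ints K" "c \<in> ints K"
    using Q unfolding abc forms_iff by blast
  define \<theta> where "\<theta> = (- b + u * w) / 2"
  note span = form_to_ideal_span[OF Q[unfolded abc] u, folded \<theta>_def]
  have L: "a \<in> L" "\<theta> \<in> L"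
    using ints u tp_unitsD(2)[OF u(1)] ints_in_F K_subset_L form_root_in_L by (auto simp: \<theta>_def)
  have "Psi K L D w (form_class K D Q) = oriented_class K L (oriented_span K L w a \<theta>)"
    using Psi_form_class[OF Q u(1)] u(2) span(3) by (simp add: abc)
  then have "Phi K L D w (Psi K L D w (form_class K D Q)) = form_class K D (basis_to_form K L w a \<theta>)"
    using Phi_oriented_class[OF L span(1)] by simp
  also have "\<dots> = form_class K D Q"
  proof (rule form_class_eq[OF Q basis_to_form_in_forms[OF L span(1)]])
    show "form_equiv K (basis_to_form K L w a \<theta>) Q"
      unfolding span(4) abc
      by (rule form_equivI[of 1 0 0 1 "inverse u"])
        (auto simp: ints_0 ints_1 tp_units_1 tp_units_inverse[OF u(1)] divide_inverse algebra_simps)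
  qed
  finally show ?thesis .
qed

text \<open>The form of a basis has discriminant exactly \<open>D\<close>, so Psi can be evaluated
  with the unit 1; the resulting oriented ideal is a multiple of the original one.\<close>

lemma Psi_Phi:
  assumes ab: "\<alpha> \<in> L" "\<beta> \<in> L" "lattice_span K \<alpha> \<beta> \<in> frac_ideals L"
  shows "Psi K L D w (form_class K D (basis_to_form K L w \<alpha> \<beta>)) =
    oriented_class K L (oriented_span K L w \<alpha> \<beta>)"
proof -
  define \<delta> where "\<delta> = bdet \<alpha> \<beta>"
  have \<delta>: "\<delta> \<in> K" "\<delta> \<noteq> 0"
    using bdet_in_K bdet_nonzero ab by (auto simp: \<delta>_def)
  have w: "cj \<alpha> * \<beta> - \<alpha> * cj \<beta> = \<delta> * w"
    unfolding \<delta>_def by (rule bdet_w)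
  have \<alpha>: "\<alpha> \<noteq> 0"
    using w \<delta> w_nonzero cj_K[OF F_0] by auto
  \<comment> \<open>The scalar sending \<open>\<alpha>\<close> to the first coefficient and
    \<open>\<beta>\<close> to the root attached to the form. Its norm times \<open>\<delta>\<close>
    is again the first coefficient, so the orientations agree.\<close>
  define g where "g = cj \<alpha> / \<delta>"
  have g: "g \<in> L" "g \<noteq> 0"
    using ab \<delta> \<alpha> cj_zero_iff[OF ab(1)] by (auto simp: g_def cj_closed K_subset_L intro!: L.F_divide)
  have "(- (- (cj \<alpha> * \<beta> + \<alpha> * cj \<beta>) / \<delta>) + 1 * w) / 2 = (cj \<alpha> * \<beta> + \<alpha> * cj \<beta> + \<delta> * w) / (2 * \<delta>)"
    using \<delta>(2) by (simp add: field_simps)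
  also have "\<dots> = g * \<beta>"
    unfolding w[symmetric] using \<delta>(2) by (simp add: g_def field_simps)
  finally have 1: "(- (- (cj \<alpha> * \<beta> + \<alpha> * cj \<beta>) / \<delta>) + 1 * w) / 2 = g * \<beta>" .
  have 2: "\<alpha> * cj \<alpha> / \<delta> = g * \<alpha>"
    by (simp add: g_def)
  have 3: "sgn_vec K (g * \<alpha>) = sgn_vec K (g * cj g * \<delta>)"
  proof -
    have "cj g = \<alpha> / \<delta>"
      using ab \<delta> by (simp add: g_def cj_divide cj_cj cj_K cj_closed K_subset_L)
    then have "g * cj g * \<delta> = g * \<alpha>"
      using \<delta>(2) by simp
    then show ?thesis by (simp only:)
  qed
  have "form_to_ideal K w 1 (basis_to_form K L w \<alpha> \<beta>) =
      ((\<lambda>x. g * x) ` lattice_span K \<alpha> \<beta>, sgn_vec K (g * cj g * \<delta>))"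
    unfolding basis_to_form_eq \<delta>_def[symmetric] form_to_ideal.simps 1 2 3 lattice_span_scale ..
  moreover have "Psi K L D w (form_class K D (basis_to_form K L w \<alpha> \<beta>)) =
      oriented_class K L (form_to_ideal K w 1 (basis_to_form K L w \<alpha> \<beta>))"
    using \<delta>(2) disc_basis_to_form[of \<alpha> \<beta>]
    by (intro Psi_form_class basis_to_form_in_forms ab tp_units_1) (simp add: \<delta>_def)
  ultimately show ?thesis
    using oriented_class_eq[OF ab(3) \<delta>(1) g] by (simp add: oriented_span_eq \<delta>_def)
qed

lemma carrier_oriented_class_group:
  "carrier (oriented_class_group K L) = oriented_class K L ` carrier (oriented_ideal_group K L)"
  unfolding oriented_class_group_def carrier_FactGroup oriented_class_def ..

end

theorem theorem3p6:
  fixes K L :: "'a :: field_char_0 set" and D w :: 'a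
  assumes "number_field K"
    and "narrow_class_number K = 1"
    and "real_embeddings K \<noteq> {}"
    and "fundamental K D"
    and "w\<^sup>2 = D"
    and "L = generate_field ambient (insert w K)"
    and "quadratic_extension K L"
  shows
    "(\<forall>Q\<in>forms K D. \<forall>u\<in>tp_units K. disc Q = u\<^sup>2 * D \<longrightarrow>
        form_to_ideal K w u Q \<in> carrier (oriented_ideal_group K L) \<and>
        Psi K L D w (form_class K D Q) = oriented_class K L (form_to_ideal K w u Q)) \<and>
     (\<forall>Z\<in>carrier (oriented_ideal_group K L). \<exists>\<alpha>\<in>L. \<exists>\<beta>\<in>L. Z = oriented_span K L w \<alpha> \<beta>) \<and>
     (\<forall>\<alpha>\<in>L. \<forall>\<beta>\<in>L. lattice_span K \<alpha> \<beta> \<in> frac_ideals L \<longrightarrow>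
        oriented_span K L w \<alpha> \<beta> \<in> carrier (oriented_ideal_group K L) \<and>
        basis_to_form K L w \<alpha> \<beta> \<in> forms K D \<and>
        Phi K L D w (oriented_class K L (oriented_span K L w \<alpha> \<beta>)) =
          form_class K D (basis_to_form K L w \<alpha> \<beta>)) \<and>
     bij_betw (Psi K L D w) (form_classes K D) (carrier (oriented_class_group K L)) \<and>
     bij_betw (Phi K L D w) (carrier (oriented_class_group K L)) (form_classes K D) \<and>
     (\<forall>C\<in>form_classes K D. Phi K L D w (Psi K L D w C) = C) \<and>
     (\<forall>Z\<in>carrier (oriented_class_group K L). Psi K L D w (Phi K L D w Z) = Z)"
proof -
  have K: "subfield K ambient" "ring.finite_dimension ambient \<rat> K"
    using assms(1) by (simp_all add: number_field_def)
  interpret quadratic_setting K L D w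
    by (intro quadratic_setting.intro class_number_one.intro num_field.intro ambient_subfield.intro
        num_field_axioms.intro class_number_one_axioms.intro quadratic_setting_axioms.intro)
      (rule K assms)+
  have to_ideal: "form_to_ideal K w u Q \<in> carrier (oriented_ideal_group K L)"
    if Q: "Q \<in> forms K D" and u: "u \<in> tp_units K" "disc Q = u\<^sup>2 * D" for Q u
  proof (cases Q)
    case (fields a b c)
    have L: "a \<in> L" "(- b + u * w) / 2 \<in> L"
      using Q tp_unitsD(2)[OF u(1)] ints_in_F K_subset_L form_root_in_L
      by (auto simp: fields forms_iff)
    note span = form_to_ideal_span[OF Q[unfolded fields] u(1)]
    show ?thesis
      using span(1,3) oriented_span_carrier[OF L] u(2) by (simp add: fields)
  qed
  \<comment> \<open>The lattice is also recorded as a fractional ideal, as the formulas for Phi and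
    the second composite require.\<close>
  have span: "\<exists>\<alpha>\<in>L. \<exists>\<beta>\<in>L. lattice_span K \<alpha> \<beta> \<in> frac_ideals L \<and> Z = oriented_span K L w \<alpha> \<beta>"
    if Z: "Z \<in> carrier (oriented_ideal_group K L)" for Z
  proof -
    obtain \<alpha> \<beta> where "\<alpha> \<in> L" "\<beta> \<in> L" "Z = oriented_span K L w \<alpha> \<beta>"
      using oriented_ideal_is_span[OF Z] .
    then show ?thesis
      using Z unfolding carrier_oriented oriented_span_eq by auto
  qed
  have classE: "\<exists>\<alpha>\<in>L. \<exists>\<beta>\<in>L. lattice_span K \<alpha> \<beta> \<in> frac_ideals L \<and>
      Z = oriented_class K L (oriented_span K L w \<alpha> \<beta>)"
    if "Z \<in> carrier (oriented_class_group K L)" for Z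
    using that span unfolding carrier_oriented_class_group by blast
  have Psi_in: "Psi K L D w C \<in> carrier (oriented_class_group K L)" if C: "C \<in> form_classes K D" for C
  proof -
    obtain Q where Q: "Q \<in> forms K D" "C = form_class K D Q"
      using C unfolding form_classes_eq by blast
    obtain u where "u \<in> tp_units K" "disc Q = u\<^sup>2 * D"
      using Q(1) by (auto simp: forms_def disc_set_def)
    then show ?thesis
      using Psi_form_class[OF Q(1)] to_ideal[OF Q(1)]
      unfolding Q(2) carrier_oriented_class_group by blast
  qed
  have Phi_in: "Phi K L D w Z \<in> form_classes K D" if "Z \<in> carrier (oriented_class_group K L)" for Z
    using classE[OF that] Phi_oriented_class basis_to_form_in_forms unfolding form_classes_eq by auto
  have 1: "Phi K L D w (Psi K L D w C) = C" if "C \<in> form_classes K D" for C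
    using that Phi_Psi unfolding form_classes_eq by auto
  have 2: "Psi K L D w (Phi K L D w Z) = Z" if "Z \<in> carrier (oriented_class_group K L)" for Z
    using classE[OF that] Phi_oriented_class Psi_Phi by auto
  have "bij_betw (Psi K L D w) (form_classes K D) (carrier (oriented_class_group K L))"
    using Psi_in Phi_in 1 2 by (intro bij_betwI[of _ _ _ "Phi K L D w"]) auto
  moreover have "bij_betw (Phi K L D w) (carrier (oriented_class_group K L)) (form_classes K D)"
    using Psi_in Phi_in 1 2 by (intro bij_betwI[of _ _ _ "Psi K L D w"]) auto
  moreover have "\<forall>Z\<in>carrier (oriented_ideal_group K L). \<exists>\<alpha>\<in>L. \<exists>\<beta>\<in>L. Z = oriented_span K L w \<alpha> \<beta>"
    using span by blast
  ultimately show ?thesis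
    using to_ideal Psi_form_class oriented_span_carrier basis_to_form_in_forms
      Phi_oriented_class 1 2 by (intro conjI ballI impI) simp_all
qed

end
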